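(* Let $\mathbb{K}$ be an algebraically closed field of characteristic $0$ and $n\ge 2$. If $\mathcal{E}$ is an orthogonal instanton bundle of trivial splitting type on $\mathbb{P}^n$ over $\mathbb{K}$, then its charge $c=c_2(\mathcal{E})$ is even. In particular, for $c$ odd and any $r>0$, the moduli space $\mathcal{M}^{o}_{\mathbb{P}^n}(r,c)$ of orthogonal instanton bundles of trivial splitting type of rank $r$ and charge $c$ is empty.
   Context: An instanton sheaf of charge $c>0$ and rank $r$ on $\mathbb{P}^n$ is a coherent sheaf that is the cohomology $\ker b/\operatorname{im} a$ of a monad $\mathcal{O}(-1)^{\oplus c}\xrightarrow{a}\mathcal{O}^{\oplus r+2c}\xrightarrow{b}\mathcal{O}(1)^{\oplus c}$ ($b\circ a=0$, $a$ injective and $b$ surjective as sheaf maps); it is an instanton bundle if it is locally free. One has $c_1(\mathcal{E})=0$ and $c_2(\mathcal{E})=c$. An orthogonal instanton bundle is an instanton bundle $\mathcal{E}$ with an isomorphism $\varphi\colon\mathcal{E}\to\mathcal{E}^\vee$ satisfying $\varphi^\vee=\varphi$. $\mathcal{E}$ is of trivial splitting type if there is a line $l\subset\mathbb{P}^n$ with $\mathcal{E}|_l\cong\mathcal{O}_l^{\oplus r}$. *)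

theory Defs
  imports
    "HOL-Analysis.Cartesian_Space"
    "HOL-Computational_Algebra.Polynomial"
    "HOL-Algebra.Module"
begin

section \<open>Projective space\<close>

text \<open>
  For an algebraically closed field \<open>'k\<close>, projective \<open>n\<close>-space is treated as a classical variety.
  Its homogeneous coordinates are vectors in \<open>'k ^ 'n\<close>, where \<open>'n\<close> is a type with \<open>n + 1\<close> elements.
  A subset of projective space is represented by its preimage under the quotient map
  \<open>'k ^ 'n - {0} \<rightarrow> \<P>\<^sup>n\<close>, that is, by the punctured cone over it.
\<close>

definition proj_space :: "('k::field ^ 'n) set" where
  "proj_space = UNIV - {0}"

definition hom_poly :: "nat \<Rightarrow> ('k::field ^ 'n \<Rightarrow> 'k) set" where
  "hom_poly d = {f. \<exists>c :: ('n \<Rightarrow> nat) \<Rightarrow> 'k. \<forall>v.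
     f v = (\<Sum>m | (\<Sum>i\<in>UNIV. m i) = d. c m * (\<Prod>i\<in>UNIV. (v $ i) ^ m i))}"

definition zariski_open :: "('k::field ^ 'n) set \<Rightarrow> bool" where
  "zariski_open W \<longleftrightarrow> (\<exists>S \<subseteq> (\<Union>d. hom_poly d). W = {v \<in> proj_space. \<exists>f\<in>S. f v \<noteq> 0})"

definition opens :: "('k::field ^ 'n) set \<Rightarrow> ('k ^ 'n) set set" where
  "opens X = {X \<inter> W | W. zariski_open W}"

text \<open>
  Sections over \<open>U\<close> of the \<open>d\<close>-th twist of the structure sheaf: functions on the cone over \<open>U\<close> that
  are locally a fraction of homogeneous polynomials whose degrees differ by \<open>d\<close>. Off \<open>U\<close> they are
  set to \<open>0\<close>, so that a section is determined by its values on \<open>U\<close>. The set \<open>U\<close> may also be an open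
  subset of a closed subvariety; for \<open>d = 0\<close> this gives the regular functions on \<open>U\<close>.
\<close>

definition twist_sections :: "int \<Rightarrow> ('k::field ^ 'n) set \<Rightarrow> ('k ^ 'n \<Rightarrow> 'k) set" where
  "twist_sections d U = {s. (\<forall>v. v \<notin> U \<longrightarrow> s v = 0) \<and>
     (\<forall>v\<in>U. \<exists>W e e'. \<exists>g\<in>hom_poly e. \<exists>h\<in>hom_poly e'.
        zariski_open W \<and> v \<in> W \<and> int e - int e' = d \<and>
        (\<forall>w\<in>U \<inter> W. h w \<noteq> 0 \<and> s w = g w / h w))}"

definition cut :: "'p set \<Rightarrow> ('p \<Rightarrow> 'k::zero) \<Rightarrow> 'p \<Rightarrow> 'k" where
  "cut V s = (\<lambda>v. if v \<in> V then s v else 0)"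

definition regular_ring :: "('k::field ^ 'n) set \<Rightarrow> ('k ^ 'n \<Rightarrow> 'k) ring" where
  "regular_ring U = \<lparr>carrier = twist_sections 0 U, mult = (\<lambda>f g v. f v * g v), one = cut U (\<lambda>_. 1),
     zero = (\<lambda>_. 0), add = (\<lambda>f g v. f v + g v)\<rparr>"


section \<open>Sheaves of modules\<close>

text \<open>
  The library's record of modules extends that of rings; its multiplication and unit fields play no
  role for modules and are left \<open>undefined\<close>. In \<open>restr F U V\<close> the restriction goes from \<open>U\<close> to \<open>V\<close>.
\<close>

record ('p, 'k, 'm) mod_sheaf =
  sections :: "'p set \<Rightarrow> ('p \<Rightarrow> 'k, 'm) module"
  restr :: "'p set \<Rightarrow> 'p set \<Rightarrow> 'm \<Rightarrow> 'm"

abbreviation sect :: "('p, 'k, 'm, 'z) mod_sheaf_scheme \<Rightarrow> 'p set \<Rightarrow> 'm set" where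
  "sect F U \<equiv> carrier (sections F U)"

locale module_sheaf =
  fixes X :: "('k::field ^ 'n) set" and F :: "('k ^ 'n, 'k, 'm) mod_sheaf"
  assumes module: "U \<in> opens X \<Longrightarrow> Module.module (regular_ring U) (sections F U)"
    and restr_closed: "\<lbrakk>U \<in> opens X; V \<in> opens X; V \<subseteq> U; s \<in> sect F U\<rbrakk> \<Longrightarrow> restr F U V s \<in> sect F V"
    and restr_add: "\<lbrakk>U \<in> opens X; V \<in> opens X; V \<subseteq> U; s \<in> sect F U; t \<in> sect F U\<rbrakk> \<Longrightarrow>
      restr F U V (s \<oplus>\<^bsub>sections F U\<^esub> t) = restr F U V s \<oplus>\<^bsub>sections F V\<^esub> restr F U V t"
    and restr_smult: "\<lbrakk>U \<in> opens X; V \<in> opens X; V \<subseteq> U; f \<in> carrier (regular_ring U); s \<in> sect F U\<rbrakk> \<Longrightarrow>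
      restr F U V (f \<odot>\<^bsub>sections F U\<^esub> s) = cut V f \<odot>\<^bsub>sections F V\<^esub> restr F U V s"
    and restr_id: "\<lbrakk>U \<in> opens X; s \<in> sect F U\<rbrakk> \<Longrightarrow> restr F U U s = s"
    and restr_comp: "\<lbrakk>U \<in> opens X; V \<in> opens X; W \<in> opens X; W \<subseteq> V; V \<subseteq> U; s \<in> sect F U\<rbrakk> \<Longrightarrow>
      restr F V W (restr F U V s) = restr F U W s"
    and separated: "\<lbrakk>C \<subseteq> opens X; s \<in> sect F (\<Union>C); t \<in> sect F (\<Union>C);
      \<And>V. V \<in> C \<Longrightarrow> restr F (\<Union>C) V s = restr F (\<Union>C) V t\<rbrakk> \<Longrightarrow> s = t"
    and gluing: "\<lbrakk>C \<subseteq> opens X; \<And>V. V \<in> C \<Longrightarrow> \<sigma> V \<in> sect F V;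
      \<And>V W. \<lbrakk>V \<in> C; W \<in> C\<rbrakk> \<Longrightarrow> restr F V (V \<inter> W) (\<sigma> V) = restr F W (V \<inter> W) (\<sigma> W)\<rbrakk> \<Longrightarrow>
      \<exists>s\<in>sect F (\<Union>C). \<forall>V\<in>C. restr F (\<Union>C) V s = \<sigma> V"

type_synonym ('p, 'm, 'm2) sheaf_map = "'p set \<Rightarrow> 'm \<Rightarrow> 'm2"

text \<open>
  If \<open>U\<close> is open in \<open>X\<close>, then \<open>opens U\<close> consists of the members of \<open>opens X\<close> contained in \<open>U\<close>. Hence
  the predicates below, used with \<open>U\<close> in place of \<open>X\<close>, speak about the restrictions of the sheaves
  to \<open>U\<close>.
\<close>

definition sheaf_mor :: "('k::field ^ 'n) set \<Rightarrow> ('k ^ 'n, 'k, 'm) mod_sheaf \<Rightarrow>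
    ('k ^ 'n, 'k, 'm2) mod_sheaf \<Rightarrow> ('k ^ 'n, 'm, 'm2) sheaf_map \<Rightarrow> bool" where
  "sheaf_mor X F G f \<longleftrightarrow>
     (\<forall>U\<in>opens X. f U \<in> sect F U \<rightarrow> sect G U \<and>
        (\<forall>s\<in>sect F U. \<forall>t\<in>sect F U. f U (s \<oplus>\<^bsub>sections F U\<^esub> t) = f U s \<oplus>\<^bsub>sections G U\<^esub> f U t) \<and>
        (\<forall>x\<in>carrier (regular_ring U). \<forall>s\<in>sect F U.
           f U (x \<odot>\<^bsub>sections F U\<^esub> s) = x \<odot>\<^bsub>sections G U\<^esub> f U s)) \<and>
     (\<forall>U\<in>opens X. \<forall>V\<in>opens X. V \<subseteq> U \<longrightarrow>
        (\<forall>s\<in>sect F U. f V (restr F U V s) = restr G U V (f U s)))"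

definition sheaf_iso :: "('k::field ^ 'n) set \<Rightarrow> ('k ^ 'n, 'k, 'm) mod_sheaf \<Rightarrow>
    ('k ^ 'n, 'k, 'm2) mod_sheaf \<Rightarrow> ('k ^ 'n, 'm, 'm2) sheaf_map \<Rightarrow> bool" where
  "sheaf_iso X F G f \<longleftrightarrow>
     sheaf_mor X F G f \<and> (\<forall>U\<in>opens X. bij_betw (f U) (sect F U) (sect G U))"

definition sheaf_inj :: "('k::field ^ 'n) set \<Rightarrow> ('k ^ 'n, 'k, 'm) mod_sheaf \<Rightarrow>
    ('k ^ 'n, 'k, 'm2) mod_sheaf \<Rightarrow> ('k ^ 'n, 'm, 'm2) sheaf_map \<Rightarrow> bool" where
  "sheaf_inj X F G f \<longleftrightarrow> sheaf_mor X F G f \<and> (\<forall>U\<in>opens X. inj_on (f U) (sect F U))"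

text \<open>The sections over \<open>U\<close> of the image sheaf: those that lie locally in the image.\<close>

definition image_sections :: "('k::field ^ 'n) set \<Rightarrow> ('k ^ 'n, 'k, 'm) mod_sheaf \<Rightarrow>
    ('k ^ 'n, 'k, 'm2) mod_sheaf \<Rightarrow> ('k ^ 'n, 'm, 'm2) sheaf_map \<Rightarrow> ('k ^ 'n) set \<Rightarrow> 'm2 set" where
  "image_sections X F G f U =
     {t \<in> sect G U. \<forall>v\<in>U. \<exists>V\<in>opens X. v \<in> V \<and> V \<subseteq> U \<and> restr G U V t \<in> f V ` sect F V}"

definition sheaf_surj :: "('k::field ^ 'n) set \<Rightarrow> ('k ^ 'n, 'k, 'm) mod_sheaf \<Rightarrow>
    ('k ^ 'n, 'k, 'm2) mod_sheaf \<Rightarrow> ('k ^ 'n, 'm, 'm2) sheaf_map \<Rightarrow> bool" where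
  "sheaf_surj X F G f \<longleftrightarrow>
     sheaf_mor X F G f \<and> (\<forall>U\<in>opens X. image_sections X F G f U = sect G U)"

definition kernel_sheaf :: "('k::field ^ 'n, 'k, 'm) mod_sheaf \<Rightarrow>
    ('k ^ 'n, 'k, 'm2) mod_sheaf \<Rightarrow> ('k ^ 'n, 'm, 'm2) sheaf_map \<Rightarrow> ('k ^ 'n, 'k, 'm) mod_sheaf" where
  "kernel_sheaf F G f = F\<lparr>sections := (\<lambda>U. (sections F U)
     \<lparr>carrier := {s \<in> sect F U. f U s = \<zero>\<^bsub>sections G U\<^esub>}\<rparr>)\<rparr>"

definition twist :: "int \<Rightarrow> ('k::field ^ 'n, 'k, 'k ^ 'n \<Rightarrow> 'k) mod_sheaf" where
  "twist d = \<lparr>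
     sections = (\<lambda>U. \<lparr>carrier = twist_sections d U, mult = undefined, one = undefined,
       zero = (\<lambda>_. 0), add = (\<lambda>s t v. s v + t v), smult = (\<lambda>x s v. x v * s v)\<rparr>),
     restr = (\<lambda>U V s. cut V s)\<rparr>"

abbreviation structure_sheaf :: "('k::field ^ 'n, 'k, 'k ^ 'n \<Rightarrow> 'k) mod_sheaf" where
  "structure_sheaf \<equiv> twist 0"

text \<open>The direct sum of \<open>m\<close> copies of \<open>F\<close>, with families indexed by \<open>i < m\<close> and continued by zero.\<close>

definition sheaf_power :: "('k::field ^ 'n, 'k, 'm) mod_sheaf \<Rightarrow> nat \<Rightarrow>
    ('k ^ 'n, 'k, nat \<Rightarrow> 'm) mod_sheaf" where
  "sheaf_power F m = \<lparr>
     sections = (\<lambda>U. \<lparr>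
       carrier = {s. (\<forall>i<m. s i \<in> sect F U) \<and> (\<forall>i\<ge>m. s i = \<zero>\<^bsub>sections F U\<^esub>)},
       mult = undefined, one = undefined,
       zero = (\<lambda>_. \<zero>\<^bsub>sections F U\<^esub>),
       add = (\<lambda>s t i. s i \<oplus>\<^bsub>sections F U\<^esub> t i),
       smult = (\<lambda>x s i. x \<odot>\<^bsub>sections F U\<^esub> s i)\<rparr>),
     restr = (\<lambda>U V s i. restr F U V (s i))\<rparr>"

definition locally_free :: "('k::field ^ 'n) set \<Rightarrow> ('k ^ 'n, 'k, 'm) mod_sheaf \<Rightarrow> bool" where
  "locally_free X F \<longleftrightarrow> module_sheaf X F \<and>
     (\<forall>v\<in>X. \<exists>U\<in>opens X. v \<in> U \<and> (\<exists>k f. sheaf_iso U F (sheaf_power structure_sheaf k) f))"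


section \<open>The dual sheaf\<close>

text \<open>
  A section over \<open>U\<close> of the dual of \<open>F\<close> is a morphism from \<open>F\<close> restricted to \<open>U\<close> to the structure
  sheaf of \<open>U\<close>. To make it determined by its relevant values, it is set to zero elsewhere.
\<close>

definition clip :: "('k::field ^ 'n) set \<Rightarrow> ('k ^ 'n, 'k, 'm) mod_sheaf \<Rightarrow>
    ('k ^ 'n, 'm, 'k ^ 'n \<Rightarrow> 'k) sheaf_map \<Rightarrow> ('k ^ 'n, 'm, 'k ^ 'n \<Rightarrow> 'k) sheaf_map" where
  "clip U F h = (\<lambda>V s. if V \<in> opens U \<and> s \<in> sect F V then h V s else (\<lambda>_. 0))"

definition dual :: "('k::field ^ 'n, 'k, 'm) mod_sheaf \<Rightarrow>
    ('k ^ 'n, 'k, ('k ^ 'n, 'm, 'k ^ 'n \<Rightarrow> 'k) sheaf_map) mod_sheaf" where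
  "dual F = \<lparr>
     sections = (\<lambda>U. \<lparr>
       carrier = {h. sheaf_mor U F structure_sheaf h \<and> clip U F h = h},
       mult = undefined, one = undefined,
       zero = (\<lambda>V s v. 0),
       add = (\<lambda>h h' V s v. h V s v + h' V s v),
       smult = (\<lambda>x h V s v. x v * h V s v)\<rparr>),
     restr = (\<lambda>U V h. clip V F h)\<rparr>"

text \<open>The transpose of \<open>f : F \<rightarrow> G\<close>, a morphism from the dual of \<open>G\<close> to the dual of \<open>F\<close>.\<close>

definition dual_mor :: "('k::field ^ 'n, 'k, 'm) mod_sheaf \<Rightarrow> ('k ^ 'n, 'm, 'm2) sheaf_map \<Rightarrow>
    ('k ^ 'n, ('k ^ 'n, 'm2, 'k ^ 'n \<Rightarrow> 'k) sheaf_map, ('k ^ 'n, 'm, 'k ^ 'n \<Rightarrow> 'k) sheaf_map) sheaf_map"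
  where "dual_mor F f = (\<lambda>U h. clip U F (\<lambda>V s. h V (f V s)))"

text \<open>The canonical morphism from \<open>F\<close> to its double dual.\<close>

definition bidual :: "('k::field ^ 'n, 'k, 'm) mod_sheaf \<Rightarrow>
    ('k ^ 'n, 'm, ('k ^ 'n, ('k ^ 'n, 'm, 'k ^ 'n \<Rightarrow> 'k) sheaf_map, 'k ^ 'n \<Rightarrow> 'k) sheaf_map) sheaf_map"
  where "bidual F = (\<lambda>U s. clip U (dual F) (\<lambda>V h. h V (restr F U V s)))"


section \<open>Restriction to a closed subvariety\<close>

text \<open>The direct image in projective space of a sheaf of modules on the closed subvariety \<open>Y\<close>.\<close>

definition direct_image :: "('k::field ^ 'n) set \<Rightarrow> ('k ^ 'n, 'k, 'm) mod_sheaf \<Rightarrow>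
    ('k ^ 'n, 'k, 'm) mod_sheaf" where
  "direct_image Y F = \<lparr>
     sections = (\<lambda>U. (sections F (U \<inter> Y))
       \<lparr>smult := (\<lambda>x s. cut (U \<inter> Y) x \<odot>\<^bsub>sections F (U \<inter> Y)\<^esub> s)\<rparr>),
     restr = (\<lambda>U V. restr F (U \<inter> Y) (V \<inter> Y))\<rparr>"

definition ideal_sections :: "('k::field ^ 'n) set \<Rightarrow> ('k ^ 'n) set \<Rightarrow> ('k ^ 'n \<Rightarrow> 'k) set" where
  "ideal_sections Y U = {x \<in> carrier (regular_ring U). \<forall>v\<in>U \<inter> Y. x v = 0}"

text \<open>
  The sections over \<open>U\<close> of the product of the ideal sheaf of \<open>Y\<close> with \<open>E\<close>, which is the image of the
  multiplication map from their tensor product to \<open>E\<close>.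
\<close>

definition ideal_times :: "('k::field ^ 'n) set \<Rightarrow> ('k ^ 'n, 'k, 'm) mod_sheaf \<Rightarrow>
    ('k ^ 'n) set \<Rightarrow> 'm set" where
  "ideal_times Y E U = {s \<in> sect E U. \<forall>v\<in>U. \<exists>V\<in>opens proj_space. v \<in> V \<and> V \<subseteq> U \<and>
     (\<exists>k::nat. \<exists>x\<in>{..<k} \<rightarrow> ideal_sections Y V. \<exists>t\<in>{..<k} \<rightarrow> sect E V.
        restr E U V s = (\<Oplus>\<^bsub>sections E V\<^esub>i\<in>{..<k}. x i \<odot>\<^bsub>sections E V\<^esub> t i))}"

text \<open>
  \<open>F\<close> is (isomorphic to) the restriction of \<open>E\<close> to \<open>Y\<close>: the sheaf \<open>F\<close> lives on \<open>Y\<close>, and its direct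
  image is the quotient of \<open>E\<close> by the product of the ideal sheaf of \<open>Y\<close> with \<open>E\<close>, that is, the
  tensor product of \<open>E\<close> with the structure sheaf of \<open>Y\<close>.
\<close>

definition is_restriction :: "('k::field ^ 'n) set \<Rightarrow> ('k ^ 'n, 'k, 'm) mod_sheaf \<Rightarrow>
    ('k ^ 'n, 'k, 'm2) mod_sheaf \<Rightarrow> bool" where
  "is_restriction Y E F \<longleftrightarrow> module_sheaf Y F \<and>
     (\<exists>\<rho>. sheaf_surj proj_space E (direct_image Y F) \<rho> \<and>
        (\<forall>U\<in>opens proj_space.
           {s \<in> sect E U. \<rho> U s = \<zero>\<^bsub>sections (direct_image Y F) U\<^esub>} = ideal_times Y E U))"

definition trivial_splitting_type :: "nat \<Rightarrow> ('k::field ^ 'n, 'k, 'm) mod_sheaf \<Rightarrow> bool" where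
  "trivial_splitting_type r E \<longleftrightarrow>
     (\<exists>L. vec.subspace L \<and> vec.dim L = 2 \<and>
        is_restriction (L - {0}) E (sheaf_power structure_sheaf r))"


section \<open>Instanton bundles\<close>

definition instanton_monad :: "nat \<Rightarrow> nat \<Rightarrow>
    ('k::field ^ 'n, nat \<Rightarrow> 'k ^ 'n \<Rightarrow> 'k, nat \<Rightarrow> 'k ^ 'n \<Rightarrow> 'k) sheaf_map \<Rightarrow>
    ('k ^ 'n, nat \<Rightarrow> 'k ^ 'n \<Rightarrow> 'k, nat \<Rightarrow> 'k ^ 'n \<Rightarrow> 'k) sheaf_map \<Rightarrow> bool" where
  "instanton_monad r c a b \<longleftrightarrow>
     sheaf_inj proj_space (sheaf_power (twist (- 1)) c) (sheaf_power (twist 0) (r + 2 * c)) a \<and>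
     sheaf_surj proj_space (sheaf_power (twist 0) (r + 2 * c)) (sheaf_power (twist 1) c) b \<and>
     (\<forall>U\<in>opens proj_space. \<forall>s\<in>sect (sheaf_power (twist (- 1)) c) U.
        b U (a U s) = \<zero>\<^bsub>sections (sheaf_power (twist 1) c) U\<^esub>)"

text \<open>
  \<open>E\<close> is (isomorphic to) the quotient of the kernel sheaf of \<open>b\<close> by the image sheaf of \<open>a\<close>: there is
  a surjection of sheaves from the former to \<open>E\<close> whose kernel is the latter.
\<close>

definition monad_cohomology :: "nat \<Rightarrow> nat \<Rightarrow>
    ('k::field ^ 'n, nat \<Rightarrow> 'k ^ 'n \<Rightarrow> 'k, nat \<Rightarrow> 'k ^ 'n \<Rightarrow> 'k) sheaf_map \<Rightarrow>
    ('k ^ 'n, nat \<Rightarrow> 'k ^ 'n \<Rightarrow> 'k, nat \<Rightarrow> 'k ^ 'n \<Rightarrow> 'k) sheaf_map \<Rightarrow>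
    ('k ^ 'n, 'k, 'm) mod_sheaf \<Rightarrow> bool" where
  "monad_cohomology r c a b E \<longleftrightarrow>
     (let K = kernel_sheaf (sheaf_power (twist 0) (r + 2 * c)) (sheaf_power (twist 1) c) b in
      \<exists>\<pi>. sheaf_surj proj_space K E \<pi> \<and>
        (\<forall>U\<in>opens proj_space.
           {s \<in> sect K U. \<pi> U s = \<zero>\<^bsub>sections E U\<^esub>} =
           image_sections proj_space (sheaf_power (twist (- 1)) c) K a U))"

definition instanton_sheaf :: "nat \<Rightarrow> nat \<Rightarrow> ('k::field ^ 'n, 'k, 'm) mod_sheaf \<Rightarrow> bool" where
  "instanton_sheaf r c E \<longleftrightarrow> c > 0 \<and> module_sheaf proj_space E \<and>
     (\<exists>a b. instanton_monad r c a b \<and> monad_cohomology r c a b E)"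

definition instanton_bundle :: "nat \<Rightarrow> nat \<Rightarrow> ('k::field ^ 'n, 'k, 'm) mod_sheaf \<Rightarrow> bool" where
  "instanton_bundle r c E \<longleftrightarrow> instanton_sheaf r c E \<and> locally_free proj_space E"

text \<open>
  The condition that \<open>\<phi>\<close> equals its own transpose is understood, as usual, after identifying \<open>E\<close>
  with its double dual by the canonical morphism.
\<close>

definition orthogonal_instanton_bundle :: "nat \<Rightarrow> nat \<Rightarrow> ('k::field ^ 'n, 'k, 'm) mod_sheaf \<Rightarrow>
    ('k ^ 'n, 'm, ('k ^ 'n, 'm, 'k ^ 'n \<Rightarrow> 'k) sheaf_map) sheaf_map \<Rightarrow> bool" where
  "orthogonal_instanton_bundle r c E \<phi> \<longleftrightarrow>
     instanton_bundle r c E \<and> sheaf_iso proj_space E (dual E) \<phi> \<and>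
     (\<forall>U\<in>opens proj_space. \<forall>s\<in>sect E U. dual_mor E \<phi> U (bidual E U s) = \<phi> U s)"

text \<open>
  The moduli space, as a set: the isomorphism classes of pairs \<open>(E, \<phi>)\<close>, where an isomorphism has to
  transport one form to the other. The sections of \<open>E\<close> are taken from an arbitrary type \<open>'m\<close>.
\<close>

definition orthogonal_iso ::
  "(('k::field ^ 'n, 'k, 'm) mod_sheaf \<times>
      ('k ^ 'n, 'm, ('k ^ 'n, 'm, 'k ^ 'n \<Rightarrow> 'k) sheaf_map) sheaf_map) rel" where
  "orthogonal_iso = {((E, \<phi>), (E', \<phi>')). \<exists>f. sheaf_iso proj_space E E' f \<and>
     (\<forall>U\<in>opens proj_space. \<forall>s\<in>sect E U. dual_mor E f U (\<phi>' U (f U s)) = \<phi> U s)}"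

definition orthogonal_moduli :: "nat \<Rightarrow> nat \<Rightarrow>
    (('k::field ^ 'n, 'k, 'm) mod_sheaf \<times>
      ('k ^ 'n, 'm, ('k ^ 'n, 'm, 'k ^ 'n \<Rightarrow> 'k) sheaf_map) sheaf_map) set set" where
  "orthogonal_moduli r c =
     (let A = {(E, \<phi>). orthogonal_instanton_bundle r c E \<phi> \<and> trivial_splitting_type r E}
      in A // (orthogonal_iso \<inter> A \<times> A))"

end

theory Submission
  imports Defs "HOL-Library.Function_Algebras" "Jordan_Normal_Form.Determinant"
begin

text \<open>
  The maps of the monad are matrices \<open>a(v)\<close>, \<open>b(v)\<close> of linear forms, and the orthogonal structure is a
  family of symmetric forms \<open>q\<^sub>v\<close> on \<open>ker b(v)\<close> with radical \<open>im a(v)\<close>. A vector killed by \<open>b\<close> at two points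
  is a constant section of the kernel along the line through them, and \<open>q\<^sub>v\<close> is constant on such vectors.
  Choose \<open>x, y\<close> on the line where \<open>E\<close> is trivial, so that \<open>Z = b(y) a(x)\<close> is invertible, and \<open>z\<close> off it. With
  \<open>S = Z\<^sup>-\<^sup>1 b(y) a(z)\<close>, \<open>T = Z\<^sup>-\<^sup>1 b(z) a(x)\<close>, \<open>W = ker b(x) \<inter> ker b(y)\<close>, \<open>I = Z\<^sup>-\<^sup>1 b(z)\<close> on \<open>W\<close> and \<open>D\<close>
  the component of \<open>a(z)\<close> in \<open>W\<close>, the equation \<open>b(z) a(z) = 0\<close> becomes \<open>[S, T] = I D\<close>. Transport along the
  triangle with vertices \<open>x\<close>, \<open>z + m x + n y\<close>, \<open>y\<close> is \<open>1 + D (S + m)\<^sup>-\<^sup>1 (T + n)\<^sup>-\<^sup>1 I\<close> and preserves the form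
  on \<open>W\<close>. Expanding in \<open>m\<close>, \<open>n\<close> and using the commutator relation, every word \<open>w\<close> in \<open>S\<close> and \<open>T\<close> with
  reversal \<open>w\<^sup>r\<close> satisfies \<open>q(D w I e, e') = - q(e, D w\<^sup>r I e')\<close>. Hence \<open>\<omega>(w I e, u) = q(e, D w\<^sup>r u)\<close> is a
  well-defined skew form on \<open>k\<^sup>c\<close>. It is defined everywhere because \<open>b(v)\<close> is onto and is nondegenerate because
  \<open>a(v)\<close> is injective, so \<open>c\<close> is even.
\<close>

section \<open>Linear maps on coordinate spaces\<close>

text \<open>The skew form is a cup product in disguise. On the plane through \<open>x\<close>,
  \<open>y\<close>, \<open>z\<close> the monad identifies \<open>k^c\<close> with H^1(E(-2)) and
  with H^1(E(-1)), and \<open>Z\<close> is, up to sign, multiplication by the equation of the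
  splitting line. It is bijective because E(-1) has no cohomology on that line. Serre duality pairs
  the two spaces, and the pairing is skew because classes of degree one anticommute while the form
  on \<open>E\<close> is symmetric. With matrices in place of cohomology the pairing has to be built
  by hand: only \<open>W\<close> carries a visible form, and the only source of relations is that a
  regular function on a projective line is constant. The minus sign comes from the inverse of
  transport, which is \<open>1 - D (T + n)^-1 (S + m)^-1 I\<close>. A separate obstacle is that
  injectivity of \<open>a\<close> as a sheaf map says nothing at a single point. Pointwise
  injectivity is obtained by counting dimensions: the fibre has dimension \<open>r\<close> on the
  splitting line, hence everywhere, because frames of \<open>E\<close> over any two points
  overlap.\<close>

no_notation vec_index (infixl \<open>$\<close> 100)

definition smul :: "'k::times \<Rightarrow> ('a \<Rightarrow> 'k) \<Rightarrow> 'a \<Rightarrow> 'k" (infixr \<open>\<star>\<close> 75) where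
  "x \<star> f = (\<lambda>i. x * f i)"

lemma smul_apply: "(x \<star> f) i = x * f i"
  by (simp add: smul_def)

lemmas fun_simps = smul_apply plus_fun_apply zero_fun_apply minus_apply uminus_apply

declare plus_fun_apply [simp del] zero_fun_apply [simp del] minus_apply [simp del] uminus_apply [simp del]

interpretation fv: vector_space "smul :: 'k::field \<Rightarrow> ('a \<Rightarrow> 'k) \<Rightarrow> 'a \<Rightarrow> 'k"
  by unfold_locales (auto simp: fun_eq_iff fun_simps algebra_simps)

interpretation fvp: vector_space_pair "smul :: 'k::field \<Rightarrow> ('a \<Rightarrow> 'k) \<Rightarrow> 'a \<Rightarrow> 'k"
    "smul :: 'k::field \<Rightarrow> ('b \<Rightarrow> 'k) \<Rightarrow> 'b \<Rightarrow> 'k"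
  by unfold_locales

interpretation fk: vector_space "(*) :: 'k::field \<Rightarrow> 'k \<Rightarrow> 'k"
  by unfold_locales (auto simp: algebra_simps)

interpretation fvk: vector_space_pair "smul :: 'k::field \<Rightarrow> ('a \<Rightarrow> 'k) \<Rightarrow> 'a \<Rightarrow> 'k"
    "(*) :: 'k::field \<Rightarrow> 'k \<Rightarrow> 'k"
  by unfold_locales

abbreviation lin :: "(('a \<Rightarrow> 'k::field) \<Rightarrow> 'b \<Rightarrow> 'k) \<Rightarrow> bool" where
  "lin \<equiv> Vector_Spaces.linear smul smul"

abbreviation linf :: "(('a \<Rightarrow> 'k::field) \<Rightarrow> 'k) \<Rightarrow> bool" where
  "linf \<equiv> Vector_Spaces.linear smul (*)"

lemma linI: "\<lbrakk>\<And>u v. f (u + v) = f u + f v; \<And>x u. f (x \<star> u) = x \<star> f u\<rbrakk> \<Longrightarrow> lin f"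
  unfolding Vector_Spaces.linear_iff using fvp.vector_space_pair_axioms by (simp add: vector_space_pair_def)

lemma linfI: "\<lbrakk>\<And>u v. f (u + v) = f u + f v; \<And>x u. f (x \<star> u) = x * f u\<rbrakk> \<Longrightarrow> linf f"
  unfolding Vector_Spaces.linear_iff using fvk.vector_space_pair_axioms by (simp add: vector_space_pair_def)

lemmas lin_add = fvp.linear_add
  and lin_scale = fvp.linear_scale
  and lin_diff = fvp.linear_diff
  and lin_0 = fvp.linear_0
  and lin_neg = fvp.linear_neg
  and lin_sum = fvp.linear_sum
  and linf_add = fvk.linear_add
  and linf_scale = fvk.linear_scale
  and linf_diff = fvk.linear_diff
  and linf_0 = fvk.linear_0
  and linf_sum = fvk.linear_sum

lemma lin_comp: "lin f \<Longrightarrow> lin g \<Longrightarrow> lin (\<lambda>u. g (f u))"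
  by (intro linI) (metis lin_add, metis lin_scale)

lemma linf_comp: "lin f \<Longrightarrow> linf g \<Longrightarrow> linf (\<lambda>u. g (f u))"
  by (intro linfI) (metis lin_add linf_add, metis lin_scale linf_scale)

lemma linf_plus: "linf f \<Longrightarrow> linf g \<Longrightarrow> linf (\<lambda>u. f u + g u)"
  by (intro linfI) (auto simp: fvk.linear_add fvk.linear_scale algebra_simps)

lemma linf_times: "linf f \<Longrightarrow> linf (\<lambda>u. x * f u)"
  by (intro linfI) (auto simp: fvk.linear_add fvk.linear_scale algebra_simps)

lemma sum_fun_apply: "(\<Sum>a\<in>A. f a) x = (\<Sum>a\<in>A. f a x)"
  by (induction A rule: infinite_finite_induct) (auto simp: fun_simps)

text \<open>Coordinate vectors of every length share one function type and are continued by zero.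
  The dimensions \<open>c\<close>, \<open>N\<close>, \<open>r\<close> and the ranks of frames are
  then plain numbers that can be compared and proved equal.\<close>

definition Kn :: "nat \<Rightarrow> (nat \<Rightarrow> 'k::zero) set" where
  "Kn n = {u. \<forall>i\<ge>n. u i = 0}"

definition unitv :: "nat \<Rightarrow> nat \<Rightarrow> 'k::zero_neq_one" where
  "unitv j = (\<lambda>i. if i = j then 1 else 0)"

lemma unitv_apply: "unitv j i = (if i = j then 1 else 0)"
  by (simp add: unitv_def)

lemma unitv_Kn [simp]: "j < n \<Longrightarrow> unitv j \<in> Kn n"
  by (auto simp: Kn_def unitv_def)

lemma Kn_add [simp, intro]: "u \<in> Kn n \<Longrightarrow> v \<in> Kn n \<Longrightarrow> (u :: nat \<Rightarrow> 'k::monoid_add) + v \<in> Kn n"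
  by (auto simp: Kn_def fun_simps)
lemma Kn_diff [simp, intro]: "u \<in> Kn n \<Longrightarrow> v \<in> Kn n \<Longrightarrow> (u :: nat \<Rightarrow> 'k::group_add) - v \<in> Kn n"
  by (auto simp: Kn_def fun_simps)
lemma Kn_scale [simp, intro]: "u \<in> Kn n \<Longrightarrow> (x :: 'k::field) \<star> u \<in> Kn n"
  by (auto simp: Kn_def fun_simps)
lemma Kn_0 [simp]: "0 \<in> Kn n"
  by (auto simp: Kn_def fun_simps)

lemma subspace_Kn: "fv.subspace (Kn n :: (nat \<Rightarrow> 'k::field) set)"
  unfolding fv.subspace_def by auto

lemma Kn_expand: "u \<in> Kn n \<Longrightarrow> u = (\<Sum>j<n. u j \<star> unitv j)"
  for u :: "nat \<Rightarrow> 'k::field"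
proof
  fix i assume u: "u \<in> Kn n"
  have "(\<Sum>j<n. u j * unitv j i) = (\<Sum>j<n. if i = j then u j else 0)"
    by (rule sum.cong) (auto simp: unitv_def)
  also have "\<dots> = u i"
    using u by (auto simp: Kn_def fun_simps)
  finally show "u i = (\<Sum>j<n. u j \<star> unitv j) i"
    by (simp add: sum_fun_apply fun_simps)
qed

lemma inj_unitv: "inj (unitv :: nat \<Rightarrow> nat \<Rightarrow> 'k::zero_neq_one)"
  by (rule injI) (metis unitv_apply zero_neq_one)

lemma span_unitv: "fv.span (unitv ` {..<n}) = (Kn n :: (nat \<Rightarrow> 'k::field) set)"
proof
  show "fv.span (unitv ` {..<n}) \<subseteq> (Kn n :: (nat \<Rightarrow> 'k) set)"
    by (rule fv.span_minimal) (auto simp: subspace_Kn)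
  show "(Kn n :: (nat \<Rightarrow> 'k) set) \<subseteq> fv.span (unitv ` {..<n})"
  proof
    fix u :: "nat \<Rightarrow> 'k" assume "u \<in> Kn n"
    then have "u = (\<Sum>j<n. u j \<star> unitv j)" by (rule Kn_expand)
    moreover have "(\<Sum>j<n. u j \<star> unitv j) \<in> fv.span (unitv ` {..<n})"
      by (intro fv.span_sum fv.span_scale fv.span_base) auto
    ultimately show "u \<in> fv.span (unitv ` {..<n})" by simp
  qed
qed

lemma independent_unitv: "fv.independent (unitv ` {..<n} :: (nat \<Rightarrow> 'k::field) set)"
proof (rule fv.independent_if_scalars_zero)
  fix f :: "(nat \<Rightarrow> 'k) \<Rightarrow> 'k" and x :: "nat \<Rightarrow> 'k"
  assume s: "(\<Sum>x\<in>unitv ` {..<n}. f x \<star> x) = 0" and x: "x \<in> unitv ` {..<n}"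
  from x obtain j where j: "j < n" "x = unitv j" by auto
  have "(\<Sum>x\<in>unitv ` {..<n}. f x \<star> x) = (\<Sum>i<n. f (unitv i) \<star> unitv i)"
    by (rule sum.reindex_cong[of unitv]) (auto intro: inj_on_subset[OF inj_unitv])
  then have "(\<Sum>i<n. f (unitv i) * unitv i j) = 0"
    using s by (metis (no_types, lifting) sum_fun_apply fun_simps(1) sum.cong fun_simps(3))
  moreover have "(\<Sum>i<n. f (unitv i) * unitv i j) = (\<Sum>i<n. if i = j then f (unitv i) else 0)"
    by (rule sum.cong) (auto simp: unitv_def)
  ultimately show "f x = 0" using j by simp
qed simp

lemma Kn_independent_bound:
  assumes "fv.independent B" "B \<subseteq> (Kn n :: (nat \<Rightarrow> 'k::field) set)"
  shows "finite B \<and> card B \<le> n"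
proof -
  have "finite B \<and> card B \<le> card (unitv ` {..<n} :: (nat \<Rightarrow> 'k) set)"
    using assms by (intro fv.independent_span_bound) (auto simp: span_unitv)
  moreover have "card (unitv ` {..<n} :: (nat \<Rightarrow> 'k) set) \<le> n"
    using card_image_le[of "{..<n}"] by simp
  ultimately show ?thesis by linarith
qed

lemma image_unitv_independent:
  fixes f :: "(nat \<Rightarrow> 'k::field) \<Rightarrow> nat \<Rightarrow> 'k"
  assumes f: "lin f" and inj: "\<And>u. u \<in> Kn n \<Longrightarrow> f u = 0 \<Longrightarrow> u = 0"
  shows "fv.independent (f ` unitv ` {..<n})" "card (f ` unitv ` {..<n}) = n"
proof -
  have "inj_on f (Kn n)"
  proof (rule inj_onI)
    fix u v assume "u \<in> Kn n" "v \<in> Kn n" "f u = f v"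
    then have "f (u - v) = 0" by (simp add: lin_diff[OF f])
    then show "u = v" using inj[of "u - v"] \<open>u \<in> Kn n\<close> \<open>v \<in> Kn n\<close> by simp
  qed
  then have i: "inj_on f (fv.span (unitv ` {..<n}))" by (simp add: span_unitv)
  show "fv.independent (f ` unitv ` {..<n})"
    by (rule fvp.linear_independent_injective_image[OF f independent_unitv i])
  have "inj_on f (unitv ` {..<n})" using i by (rule inj_on_subset) (rule fv.span_superset)
  then show "card (f ` unitv ` {..<n}) = n"
    by (simp add: card_image inj_on_subset[OF inj_unitv])
qed

lemma lin_inj_le:
  fixes f :: "(nat \<Rightarrow> 'k::field) \<Rightarrow> nat \<Rightarrow> 'k"
  assumes "lin f" "f ` Kn n \<subseteq> Kn m" "\<And>u. u \<in> Kn n \<Longrightarrow> f u = 0 \<Longrightarrow> u = 0"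
  shows "n \<le> m"
proof -
  have "f ` unitv ` {..<n} \<subseteq> Kn m" using assms(2) by (auto simp: image_subset_iff)
  from Kn_independent_bound[OF image_unitv_independent(1)[OF assms(1,3)] this]
  show ?thesis using image_unitv_independent(2)[OF assms(1,3)] by simp
qed

lemma lin_inj_surj:
  fixes f :: "(nat \<Rightarrow> 'k::field) \<Rightarrow> nat \<Rightarrow> 'k"
  assumes f: "lin f" and sub: "f ` Kn n \<subseteq> Kn n" and inj: "\<And>u. u \<in> Kn n \<Longrightarrow> f u = 0 \<Longrightarrow> u = 0"
  shows "f ` Kn n = Kn n"
proof
  let ?B = "f ` unitv ` {..<n}"
  note B = image_unitv_independent[OF f inj]
  have BK: "?B \<subseteq> Kn n" using sub by (auto simp: image_subset_iff)
  show "Kn n \<subseteq> f ` Kn n"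
  proof
    fix v :: "nat \<Rightarrow> 'k" assume v: "v \<in> Kn n"
    have "v \<in> fv.span ?B"
    proof (rule ccontr)
      assume nv: "v \<notin> fv.span ?B"
      then have "fv.independent (insert v ?B)" using B(1) by (simp add: fv.independent_insertI)
      then have "card (insert v ?B) \<le> n" using Kn_independent_bound[of "insert v ?B" n] BK v by auto
      moreover have "v \<notin> ?B" using nv fv.span_base by metis
      ultimately show False using B(2) by simp
    qed
    also have "fv.span ?B = f ` fv.span (unitv ` {..<n})" by (rule fvp.linear_span_image[OF f])
    finally show "v \<in> f ` Kn n" by (simp add: span_unitv)
  qed
qed (rule sub)

text \<open>A linear right inverse \<open>g\<close> of \<open>f\<close> is injective, hence onto by
  \<open>lin_inj_surj\<close>. So every vector is some \<open>g v\<close>, and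
  \<open>f (g v) = v\<close> detects whether it is zero.\<close>

lemma lin_surj_inj:
  fixes f :: "(nat \<Rightarrow> 'k::field) \<Rightarrow> nat \<Rightarrow> 'k"
  assumes f: "lin f" and surj: "f ` Kn n = Kn n" and u: "u \<in> Kn n" "f u = 0"
  shows "u = 0"
proof -
  obtain g where g: "range g \<subseteq> Kn n" "lin g" "\<forall>v\<in>f ` Kn n. f (g v) = v"
    using fvp.linear_exists_right_inverse_on[OF f subspace_Kn] by blast
  have "g ` Kn n = Kn n"
  proof (rule lin_inj_surj[OF g(2)])
    fix v assume "v \<in> Kn n" "g v = 0"
    then have "f 0 = v" using g(3) surj by (metis (full_types))
    then show "v = 0" by (simp add: lin_0[OF f])
  qed (use g(1) in auto)
  with u(1) obtain v where v: "v \<in> Kn n" "u = g v" by blast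
  then have "v = 0" using g(3) surj u(2) by simp
  then show ?thesis using v by (simp add: lin_0[OF g(2)])
qed

lemma lin_bij_inverse:
  fixes f :: "(nat \<Rightarrow> 'k::field) \<Rightarrow> nat \<Rightarrow> 'k"
  assumes f: "lin f" and sub: "f ` Kn n \<subseteq> Kn n" and inj: "\<And>u. u \<in> Kn n \<Longrightarrow> f u = 0 \<Longrightarrow> u = 0"
  obtains g where "lin g" "range g \<subseteq> Kn n" "\<And>u. u \<in> Kn n \<Longrightarrow> g (f u) = u" "\<And>u. u \<in> Kn n \<Longrightarrow> f (g u) = u"
proof -
  have s: "f ` Kn n = Kn n" by (rule lin_inj_surj[OF assms])
  obtain g where g: "range g \<subseteq> Kn n" "lin g" "\<forall>v\<in>f ` Kn n. f (g v) = v"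
    using fvp.linear_exists_right_inverse_on[OF f subspace_Kn] by blast
  have "g (f u) = u" if "u \<in> Kn n" for u
  proof -
    have "f (g (f u) - u) = 0" using g that by (simp add: lin_diff[OF f])
    moreover have "g (f u) - u \<in> Kn n" using g(1) that by auto
    ultimately show ?thesis using inj by fastforce
  qed
  moreover have "f (g u) = u" if "u \<in> Kn n" for u
    using g(3) s that by simp
  ultimately show ?thesis using that[OF g(2,1)] by blast
qed

lemma exists_annihilator:
  fixes B :: "(nat \<Rightarrow> 'k::field) set"
  assumes "u \<notin> fv.span B"
  obtains f where "linf f" "f u = 1" "\<And>v. v \<in> fv.span B \<Longrightarrow> f v = 0"
proof -
  obtain C where C: "C \<subseteq> B" "fv.independent C" "B \<subseteq> fv.span C"
    using fv.maximal_independent_subset[of B] by blast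
  have CB: "fv.span C = fv.span B"
    using C by (metis fv.span_mono fv.span_span subset_antisym)
  then have u: "u \<notin> fv.span C" using assms by simp
  then have "fv.independent (insert u C)" using C(2) by (simp add: fv.independent_insertI)
  then have "\<exists>f. linf f \<and> (\<forall>x\<in>insert u C. f x = (if x = u then 1 else 0))"
    by (rule fvk.linear_independent_extend)
  then obtain f where f: "linf f" "\<forall>x\<in>insert u C. f x = (if x = u then 1 else 0)"
    by (elim exE conjE)
  have fC: "f x = 0" if "x \<in> C" for x
  proof -
    have "u \<notin> C" using u fv.span_base by metis
    then show ?thesis using f(2) that by auto
  qed
  have "fv.subspace {v. f v = 0}"
    unfolding fv.subspace_def by (simp add: linf_0[OF f(1)] linf_add[OF f(1)] linf_scale[OF f(1)])
  then have "fv.span C \<subseteq> {v. f v = 0}" using fC by (intro fv.span_minimal) auto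
  then have "f v = 0" if "v \<in> fv.span B" for v
    using that CB by blast
  moreover have "f u = 1" using f(2) by simp
  ultimately show ?thesis using that[OF f(1)] by blast
qed

section \<open>Eigenvectors and resolvents\<close>

text \<open>\<open>kill S l\<close> is the product of the factors \<open>S - x\<close> over the
  entries \<open>x\<close> of \<open>l\<close>: an annihilating polynomial kept as the list of its
  roots, the form in which eigenvectors and resolvents need it.\<close>

primrec kill :: "(('a \<Rightarrow> 'k::field) \<Rightarrow> 'a \<Rightarrow> 'k) \<Rightarrow> 'k list \<Rightarrow> ('a \<Rightarrow> 'k) \<Rightarrow> 'a \<Rightarrow> 'k" where
  "kill S [] u = u"
| "kill S (x # l) u = kill S l (S u - x \<star> u)"

lemma kill_lin: "lin S \<Longrightarrow> lin (kill S l)"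
proof (induction l)
  case Nil
  show ?case by (intro linI) simp_all
next
  case (Cons x l)
  have "lin (\<lambda>u. S u - x \<star> u)"
    by (intro linI) (simp_all add: lin_add[OF Cons.prems] lin_scale[OF Cons.prems] fv.scale_right_diff_distrib
        fv.scale_right_distrib fv.scale_left_commute[of x] algebra_simps)
  from lin_comp[OF this Cons.IH[OF Cons.prems]] show ?case by simp
qed

lemma kill_append: "kill S (l @ l') u = kill S l' (kill S l u)"
  by (induction l arbitrary: u) auto

lemma kill_step: "lin S \<Longrightarrow> kill S l (S u - x \<star> u) = S (kill S l u) - x \<star> kill S l u"
proof (induction l arbitrary: u)
  case (Cons y l)
  have "S (S u - x \<star> u) - y \<star> (S u - x \<star> u) = S (S u - y \<star> u) - x \<star> (S u - y \<star> u)"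
    by (simp add: lin_diff[OF Cons.prems] lin_scale[OF Cons.prems] fv.scale_right_diff_distrib
        fv.scale_left_commute[of x y] algebra_simps)
  then show ?case using Cons.IH[OF Cons.prems, of "S u - y \<star> u"] by simp
qed simp

lemma kill_commute: "lin S \<Longrightarrow> kill S l (kill S l' u) = kill S l' (kill S l u)"
  by (induction l' arbitrary: u) (simp_all add: kill_step)

definition evp :: "(('a \<Rightarrow> 'k::field) \<Rightarrow> 'a \<Rightarrow> 'k) \<Rightarrow> 'k poly \<Rightarrow> ('a \<Rightarrow> 'k) \<Rightarrow> 'a \<Rightarrow> 'k" where
  "evp S p u = (\<Sum>i\<le>degree p. coeff p i \<star> (S ^^ i) u)"

lemma evp_bound: "degree p < n \<Longrightarrow> evp S p u = (\<Sum>i<n. coeff p i \<star> (S ^^ i) u)"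
  unfolding evp_def
  by (rule sum.mono_neutral_left) (auto simp: coeff_eq_0 not_le)

lemma evp_linear_factor:
  assumes S: "lin S"
  shows "evp S ([:- x, 1:] * q) u = evp S q (S u - x \<star> u)"
proof -
  let ?n = "degree q + 2"
  have it: "(S ^^ i) (S u - x \<star> u) = (S ^^ Suc i) u - x \<star> (S ^^ i) u" for i
    by (induction i) (simp_all add: lin_diff[OF S] lin_scale[OF S])
  have "degree ([:- x, 1:] * q) < ?n"
    using degree_mult_le[of "[:- x, 1:]" q] by simp
  then have "evp S ([:- x, 1:] * q) u = (\<Sum>i<?n. coeff ([:- x, 1:] * q) i \<star> (S ^^ i) u)"
    by (rule evp_bound)
  also have "\<dots> = (\<Sum>i<?n. coeff (pCons 0 q) i \<star> (S ^^ i) u) - (\<Sum>i<?n. x \<star> coeff q i \<star> (S ^^ i) u)"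
    unfolding sum_subtractf[symmetric] by (rule sum.cong) (auto simp: fun_eq_iff fun_simps algebra_simps)
  also have "(\<Sum>i<?n. coeff (pCons 0 q) i \<star> (S ^^ i) u) = (\<Sum>i<degree q + 1. coeff q i \<star> (S ^^ Suc i) u)"
    unfolding add_2_eq_Suc' add.right_neutral add_Suc_right One_nat_def
    by (subst sum.lessThan_Suc_shift) (simp del: sum.lessThan_Suc)
  also have "(\<Sum>i<?n. x \<star> coeff q i \<star> (S ^^ i) u) = (\<Sum>i<degree q + 1. x \<star> coeff q i \<star> (S ^^ i) u)"
    by (simp add: coeff_eq_0)
  also have "(\<Sum>i<degree q + 1. coeff q i \<star> (S ^^ Suc i) u) - \<dots> =
      (\<Sum>i<degree q + 1. coeff q i \<star> (S ^^ i) (S u - x \<star> u))"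
    unfolding sum_subtractf[symmetric] it by (rule sum.cong) (auto simp: fun_eq_iff fun_simps algebra_simps)
  also have "\<dots> = evp S q (S u - x \<star> u)"
    by (rule evp_bound[symmetric]) simp
  finally show ?thesis .
qed

lemma kill_of_poly:
  fixes p :: "'k::alg_closed_field poly"
  assumes S: "lin S"
  shows "p \<noteq> 0 \<Longrightarrow> evp S p u = 0 \<Longrightarrow> \<exists>l. kill S l u = 0"
proof (induction "degree p" arbitrary: p u)
  case 0
  then obtain y where p: "p = [:y:]" "y \<noteq> 0" by (metis degree_eq_zeroE pCons_0_0)
  with 0 have "y \<star> u = 0" by (simp add: evp_def)
  with p have "u = 0" by simp
  then show ?case by (intro exI[of _ "[]"]) simp
next
  case (Suc n)
  then obtain x where "poly p x = 0" using alg_closed_imp_poly_has_root[of p] by auto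
  then obtain q where p: "p = [:- x, 1:] * q" by (auto simp: poly_eq_0_iff_dvd)
  with Suc have q: "q \<noteq> 0" by auto
  then have "degree p = Suc (degree q)" using p degree_mult_eq[of "[:- x, 1:]" q] by simp
  with Suc(2) have "n = degree q" by simp
  moreover have "evp S q (S u - x \<star> u) = 0" using Suc(4) p evp_linear_factor[OF S] by metis
  ultimately obtain l where "kill S l (S u - x \<star> u) = 0" using Suc(1)[OF _ q] by blast
  then show ?case by (intro exI[of _ "x # l"]) simp
qed

text \<open>The \<open>c + 1\<close> vectors \<open>u, S u, ..., S^c u\<close> lie in a space of
  dimension \<open>c\<close>. A nontrivial relation among them is a polynomial that annihilates
  \<open>u\<close>, and it splits over an algebraically closed field.\<close>

lemma exists_kill_vector:
  fixes S :: "(nat \<Rightarrow> 'k::alg_closed_field) \<Rightarrow> nat \<Rightarrow> 'k"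
  assumes S: "lin S" "S ` Kn c \<subseteq> Kn c" and u: "u \<in> Kn c"
  shows "\<exists>l. kill S l u = 0"
proof -
  define f where "f w = (\<Sum>i<Suc c. w i \<star> (S ^^ i) u)" for w :: "nat \<Rightarrow> 'k"
  have pow: "(S ^^ i) u \<in> Kn c" for i
    using S(2) u by (induction i) auto
  have f: "lin f"
    unfolding f_def
    by (intro linI) (simp_all add: fun_eq_iff fun_simps sum_fun_apply algebra_simps sum.distrib sum_distrib_left)
  have "f ` Kn (Suc c) \<subseteq> Kn c"
    unfolding f_def by (intro image_subsetI fv.subspace_sum[OF subspace_Kn] Kn_scale pow)
  then obtain w where w: "w \<in> Kn (Suc c)" "f w = 0" "w \<noteq> 0"
    using lin_inj_le[OF f, of "Suc c" c] by force
  define p where "p = Poly (map w [0..<Suc c])"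
  have cp: "coeff p i = w i" for i
  proof (cases "i < Suc c")
    case True
    then have "map w [0..<Suc c] ! i = w i" by (subst nth_map) (auto simp del: upt_Suc)
    then show ?thesis using True by (simp add: p_def nth_default_def del: upt_Suc)
  next
    case False
    then show ?thesis using w(1) by (simp add: p_def nth_default_def Kn_def del: upt_Suc)
  qed
  have "p \<noteq> 0" using w(3) cp by (auto simp: fun_eq_iff fun_simps)
  moreover have "degree p < Suc c"
    using w(1) cp by (intro le_imp_less_Suc degree_le) (auto simp: Kn_def)
  then have "evp S p u = 0" using w(2) by (simp add: evp_bound f_def cp del: sum.lessThan_Suc)
  ultimately show ?thesis using kill_of_poly[OF S(1)] by blast
qed

text \<open>The lists that kill the single unit vectors can be concatenated because the factors
  commute: a vector once killed stays killed.\<close>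

lemma exists_kill:
  fixes S :: "(nat \<Rightarrow> 'k::alg_closed_field) \<Rightarrow> nat \<Rightarrow> 'k"
  assumes S: "lin S" "S ` Kn c \<subseteq> Kn c"
  obtains l where "\<And>u. u \<in> Kn c \<Longrightarrow> kill S l u = 0"
proof -
  have "\<exists>l. \<forall>j<n. kill S l (unitv j) = 0" if "n \<le> c" for n
    using that
  proof (induction n)
    case (Suc n)
    then obtain l where l: "\<forall>j<n. kill S l (unitv j) = 0" by auto
    obtain l' where l': "kill S l' (unitv n) = 0"
      using exists_kill_vector[OF S, of "unitv n"] Suc.prems by auto
    have "kill S (l @ l') (unitv j) = 0" if "j < Suc n" for j
    proof (cases "j = n")
      case True
      have "kill S (l @ l') (unitv j) = kill S l (kill S l' (unitv j))"
        unfolding kill_append by (rule kill_commute[OF S(1)])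
      then show ?thesis using True l' by (simp add: lin_0[OF kill_lin[OF S(1)]])
    next
      case False
      then show ?thesis using that l by (simp add: kill_append lin_0[OF kill_lin[OF S(1)]])
    qed
    then show ?case by blast
  qed auto
  then obtain l where l: "\<forall>j<c. kill S l (unitv j) = 0" by blast
  have "kill S l u = 0" if "u \<in> Kn c" for u
  proof -
    have "kill S l u = kill S l (\<Sum>j<c. u j \<star> unitv j)" using Kn_expand[OF that] by simp
    also have "\<dots> = (\<Sum>j<c. u j \<star> kill S l (unitv j))"
      by (simp add: lin_sum[OF kill_lin[OF S(1)]] lin_scale[OF kill_lin[OF S(1)]])
    finally show ?thesis using l by simp
  qed
  then show ?thesis using that by blast
qed

text \<open>When the factors are applied one at a time, the last nonzero vector is an eigenvector,
  and it has not left \<open>R\<close>. The index type is arbitrary, so the lemma also serves for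
  spaces of functionals.\<close>

lemma eigenvector_of_kill:
  assumes R: "fv.subspace R" "\<And>v. v \<in> R \<Longrightarrow> S v \<in> R"
  shows "kill S l u = 0 \<Longrightarrow> u \<in> R \<Longrightarrow> u \<noteq> 0 \<Longrightarrow> \<exists>v\<in>R. v \<noteq> 0 \<and> (\<exists>x. S v = x \<star> v)"
proof (induction l arbitrary: u)
  case (Cons x l)
  show ?case
  proof (cases "S u - x \<star> u = 0")
    case True
    then have "S u = x \<star> u" by (simp only: right_minus_eq)
    then show ?thesis using Cons.prems by blast
  next
    case False
    moreover have "S u - x \<star> u \<in> R"
      using R Cons.prems(2) by (intro fv.subspace_diff fv.subspace_scale) auto
    ultimately show ?thesis using Cons by auto
  qed
qed auto

text \<open>\<open>T\<close> preserves the eigenspaces of \<open>S\<close> in \<open>R\<close>.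
  Commutation is asked for on \<open>R\<close> only, since the maps \<open>S\<close> and
  \<open>T\<close> of ADHM data commute up to \<open>I D\<close> and strictly just on special
  subspaces.\<close>

lemma common_eigenvector:
  assumes R: "fv.subspace R" and S: "\<And>v. v \<in> R \<Longrightarrow> S v \<in> R" and T: "\<And>v. v \<in> R \<Longrightarrow> T v \<in> R"
    and lin: "lin S" "lin T" and comm: "\<And>v. v \<in> R \<Longrightarrow> S (T v) = T (S v)"
    and kill: "\<And>v. v \<in> R \<Longrightarrow> kill S l v = 0" "\<And>v. v \<in> R \<Longrightarrow> kill T l' v = 0"
    and u: "u \<in> R" "u \<noteq> 0"
  obtains v x y where "v \<in> R" "v \<noteq> 0" "S v = x \<star> v" "T v = y \<star> v"
proof -
  obtain w x where w: "w \<in> R" "w \<noteq> 0" "S w = x \<star> w"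
    using eigenvector_of_kill[OF R S kill(1)[OF u(1)] u] by blast
  let ?R = "{v \<in> R. S v = x \<star> v}"
  have sub: "fv.subspace ?R"
    using R unfolding fv.subspace_def
    by (auto simp: lin_0[OF lin(1)] lin_add[OF lin(1)] lin_scale[OF lin(1)] fun_eq_iff fun_simps algebra_simps)
  have "\<exists>v\<in>?R. v \<noteq> 0 \<and> (\<exists>y. T v = y \<star> v)"
  proof (rule eigenvector_of_kill[OF sub])
    fix v assume "v \<in> ?R"
    then show "T v \<in> ?R" using T comm by (auto simp: lin_scale[OF lin(2)])
  next
    show "kill T l' w = 0" "w \<in> ?R" "w \<noteq> 0" using w kill(2) by auto
  qed
  then show ?thesis using that by blast
qed

section \<open>Resolvents as rational functions of their parameter\<close>

lemma resolvent_prod: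
  "(\<Prod>x\<leftarrow>l. [:x, 1:]) \<noteq> (0 :: 'k::field poly) \<and> degree (\<Prod>x\<leftarrow>l. [:x, 1:] :: 'k poly) = length l"
  by (induction l) (auto simp: degree_mult_eq simp del: mult_pCons_left)

text \<open>The identity \<open>R m (S u - x \<star> u) = u - (m + x) \<star> R m u\<close> trades
  one factor of \<open>kill\<close> for one factor \<open>m + x\<close> of the denominator. The
  degree bound on the numerator expresses vanishing at infinity.\<close>

lemma resolvent_rational:
  assumes S: "lin S" and f: "linf f"
    and sub: "\<And>u. u \<in> U \<Longrightarrow> S u \<in> U" "fv.subspace U"
    and R: "\<And>m u. m \<notin> F \<Longrightarrow> u \<in> U \<Longrightarrow> R m (S u + m \<star> u) = u" "\<And>m. m \<notin> F \<Longrightarrow> lin (R m)"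
  shows "kill S l u = 0 \<Longrightarrow> u \<in> U \<Longrightarrow> \<exists>p. (p = 0 \<or> degree p < length l) \<and>
     (\<forall>m. m \<notin> F \<longrightarrow> f (R m u) * poly (\<Prod>x\<leftarrow>l. [:x, 1:]) m = poly p m)"
proof (induction l arbitrary: u)
  case Nil
  then have "u = 0" by simp
  then show ?case by (intro exI[of _ 0]) (auto simp: lin_0[OF R(2)] linf_0[OF f])
next
  case (Cons x l)
  let ?P = "\<lambda>l. \<Prod>x\<leftarrow>l. [:x, 1:]"
  let ?v = "S u - x \<star> u"
  have v: "?v \<in> U" using sub Cons.prems(2) by (intro fv.subspace_diff fv.subspace_scale) auto
  from Cons obtain p where p: "p = 0 \<or> degree p < length l"
    "\<forall>m. m \<notin> F \<longrightarrow> f (R m ?v) * poly (?P l) m = poly p m"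
    using v by auto
  let ?q = "Polynomial.smult (f u) (?P l) - p"
  have "f (R m u) * poly (?P (x # l)) m = poly ?q m" if m: "m \<notin> F" for m
  proof -
    have e: "?v = (S u + m \<star> u) - (m + x) \<star> u" by (simp add: fun_eq_iff fun_simps algebra_simps)
    have "R m ?v = u - (m + x) \<star> R m u"
      by (simp only: e lin_diff[OF R(2)[OF m]] lin_scale[OF R(2)[OF m]] R(1)[OF m Cons.prems(2)])
    then have "f (R m ?v) = f u - (m + x) * f (R m u)"
      by (simp add: linf_diff[OF f] linf_scale[OF f])
    then have "(f u - (m + x) * f (R m u)) * poly (?P l) m = poly p m" using p(2) m by metis
    then show ?thesis by (simp add: algebra_simps)
  qed
  moreover have "degree ?q < length (x # l)"
    using p(1) resolvent_prod[of l]
    by (auto intro!: le_imp_less_Suc degree_diff_le order_trans[OF degree_smult_le])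
  ultimately show ?case by blast
qed

lemma poly_eq_cofinite:
  fixes p q :: "'k::field_char_0 poly"
  assumes "finite F" "\<And>m. m \<notin> F \<Longrightarrow> poly p m = poly q m"
  shows "p = q"
proof (rule ccontr)
  assume "p \<noteq> q"
  then have "finite {m. poly (p - q) m = 0}" by (intro poly_roots_finite) simp
  then have "finite (F \<union> {m. poly (p - q) m = 0})" using assms by simp
  moreover have "UNIV \<subseteq> F \<union> {m. poly (p - q) m = 0}" using assms(2) by auto
  ultimately show False using infinite_UNIV_char_0 finite_subset by blast
qed

text \<open>A resolvent vanishes at infinity, so a combination that is constant in the parameter is zero;
  applying \<open>S\<close> to the vectors then preserves the hypothesis.\<close>

lemma resolvent_powers:
  fixes S :: "(nat \<Rightarrow> 'k::field_char_0) \<Rightarrow> nat \<Rightarrow> 'k"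
  assumes S: "lin S" and f: "linf f" "linf g" and sub: "\<And>u. u \<in> U \<Longrightarrow> S u \<in> U" "fv.subspace U"
    and R: "\<And>m u. m \<notin> F \<Longrightarrow> u \<in> U \<Longrightarrow> R m (S u + m \<star> u) = u" "\<And>m. m \<notin> F \<Longrightarrow> lin (R m)"
    and F: "finite F" and kill: "\<And>u. u \<in> U \<Longrightarrow> kill S l u = 0"
  shows "u \<in> U \<Longrightarrow> v \<in> U \<Longrightarrow> (\<And>m. m \<notin> F \<Longrightarrow> f (R m u) + g (R m v) = 0) \<Longrightarrow>
    f ((S ^^ i) u) + g ((S ^^ i) v) = 0"
proof (induction i arbitrary: u v)
  have const: "C = 0" if u: "u \<in> U" "v \<in> U" and eq: "\<And>m. m \<notin> F \<Longrightarrow> f (R m u) + g (R m v) = C" for u v C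
  proof -
    let ?P = "\<Prod>x\<leftarrow>l. [:x, 1:]"
    obtain p where p: "p = 0 \<or> degree p < length l" "\<forall>m. m \<notin> F \<longrightarrow> f (R m u) * poly ?P m = poly p m"
      using resolvent_rational[OF S f(1) sub R, where u = u and l = l] kill u by blast
    obtain q where q: "q = 0 \<or> degree q < length l" "\<forall>m. m \<notin> F \<longrightarrow> g (R m v) * poly ?P m = poly q m"
      using resolvent_rational[OF S f(2) sub R, where u = v and l = l] kill u by blast
    have "poly (p + q) m = poly (Polynomial.smult C ?P) m" if "m \<notin> F" for m
      using p(2) q(2) eq[OF that] that by (auto simp: algebra_simps simp flip: distrib_right)
    then have e: "p + q = Polynomial.smult C ?P" by (rule poly_eq_cofinite[OF F])
    show "C = 0"
    proof (rule ccontr)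
      assume C: "C \<noteq> 0"
      with e resolvent_prod[of l] have "degree (p + q) = length l" "p + q \<noteq> 0" by auto
      then show False using p(1) q(1) degree_add_le_max[of p q] by auto
    qed
  qed
  have step: "f u + g v = 0 \<and> (\<forall>m. m \<notin> F \<longrightarrow> f (R m (S u)) + g (R m (S v)) = 0)"
    if u: "u \<in> U" "v \<in> U" and eq: "\<And>m. m \<notin> F \<Longrightarrow> f (R m u) + g (R m v) = 0" for u v
  proof -
    have RS: "R m (S w) = w - m \<star> R m w" if "m \<notin> F" "w \<in> U" for m w
    proof -
      have "R m (S w) + m \<star> R m w = w"
        using R(1)[OF that] by (simp add: lin_add[OF R(2)[OF that(1)]] lin_scale[OF R(2)[OF that(1)]])
      then show ?thesis by (simp add: eq_diff_eq)
    qed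
    have e: "f (R m (S u)) + g (R m (S v)) = f u + g v" if m: "m \<notin> F" for m
    proof -
      have "f (R m (S u)) + g (R m (S v)) = f u + g v - m * (f (R m u) + g (R m v))"
        unfolding RS[OF m u(1)] RS[OF m u(2)]
        by (simp add: linf_diff[OF f(1)] linf_diff[OF f(2)] linf_scale[OF f(1)] linf_scale[OF f(2)] algebra_simps)
      then show ?thesis using eq[OF m] by simp
    qed
    have "f u + g v = 0"
      using const[of "S u" "S v"] sub(1) u e by blast
    then show ?thesis using e by simp
  qed
  {
    case 0
    then show ?case using step[of u v] by simp
  next
    case (Suc i)
    have "f ((S ^^ i) (S u)) + g ((S ^^ i) (S v)) = 0"
      using step[OF Suc.prems] sub(1) Suc.prems by (intro Suc.IH) auto
    then show ?case by (simp only: funpow_Suc_right o_apply)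
  }
qed

section \<open>ADHM data with an orthogonal structure\<close>

text \<open>Transposing a skew matrix multiplies its determinant by \<open>(-1)^c\<close>. For odd
  \<open>c\<close> the determinant equals its own negative, hence is zero in characteristic zero,
  against nondegeneracy.\<close>

lemma even_if_skew_nondegenerate:
  fixes \<Omega> :: "nat \<Rightarrow> nat \<Rightarrow> 'k::field_char_0"
  assumes skew: "\<And>i j. i < c \<Longrightarrow> j < c \<Longrightarrow> \<Omega> i j = - \<Omega> j i"
    and nondeg: "\<And>v. v \<in> Kn c \<Longrightarrow> (\<And>i. i < c \<Longrightarrow> (\<Sum>j<c. \<Omega> i j * v j) = 0) \<Longrightarrow> v = 0"
  shows "even c"
proof (rule ccontr)
  assume "odd c"
  define M where "M = mat c c (\<lambda>(i, j). \<Omega> i j)"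
  have M: "M \<in> carrier_mat c c" by (simp add: M_def)
  have "det M \<noteq> 0"
  proof
    assume "det M = 0"
    then obtain v where v: "v \<in> carrier_vec c" "v \<noteq> 0\<^sub>v c" "M *\<^sub>v v = 0\<^sub>v c"
      using det_0_iff_vec_prod_zero[OF M] by blast
    let ?v = "\<lambda>i. if i < c then vec_index v i else 0"
    have "?v = 0"
    proof (rule nondeg)
      fix i assume i: "i < c"
      have "vec_index (M *\<^sub>v v) i = (\<Sum>j<c. \<Omega> i j * ?v j)"
        using i v(1) by (auto simp: M_def scalar_prod_def lessThan_atLeast0 intro!: sum.cong)
      then show "(\<Sum>j<c. \<Omega> i j * ?v j) = 0" using v(3) i by simp
    qed (simp add: Kn_def)
    then have "v = 0\<^sub>v c"
      using v(1) by (intro eq_vecI) (auto simp: fun_eq_iff zero_fun_apply split: if_splits)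
    with v(2) show False by simp
  qed
  moreover have "transpose_mat M = (-1) \<cdot>\<^sub>m M"
    by (rule eq_matI) (auto simp: M_def intro: skew)
  then have "det M = (-1) ^ c * det M"
    using det_transpose[OF M] det_smult[of "-1" M] M by simp
  with \<open>odd c\<close> have "2 * det M = 0" by simp
  ultimately show False by simp
qed

text \<open>\<open>RS m\<close> and \<open>RT m\<close> are the resolvents \<open>(S + m)\<^sup>-\<^sup>1\<close> and \<open>(T + m)\<^sup>-\<^sup>1\<close> for \<open>m\<close> outside the finite set \<open>F\<close>;
  \<open>hol\<close> says that \<open>1 + D RS RT I\<close> preserves the form.\<close>

locale adhm =
  fixes c :: nat
    and S T :: "(nat \<Rightarrow> 'k::{alg_closed_field, field_char_0}) \<Rightarrow> nat \<Rightarrow> 'k"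
    and D :: "(nat \<Rightarrow> 'k) \<Rightarrow> 'a \<Rightarrow> 'k" and I :: "('a \<Rightarrow> 'k) \<Rightarrow> nat \<Rightarrow> 'k"
    and E :: "('a \<Rightarrow> 'k) set" and q :: "('a \<Rightarrow> 'k) \<Rightarrow> ('a \<Rightarrow> 'k) \<Rightarrow> 'k"
    and F :: "'k set" and RS RT :: "'k \<Rightarrow> (nat \<Rightarrow> 'k) \<Rightarrow> nat \<Rightarrow> 'k"
  assumes lin: "lin S" "lin T" "lin D" "lin I"
    and closed: "\<And>u. u \<in> Kn c \<Longrightarrow> S u \<in> Kn c" "\<And>u. u \<in> Kn c \<Longrightarrow> T u \<in> Kn c"
      "\<And>u. u \<in> Kn c \<Longrightarrow> D u \<in> E" "\<And>e. e \<in> E \<Longrightarrow> I e \<in> Kn c"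
    and q_lin: "\<And>e. linf (q e)" "\<And>e. linf (\<lambda>e'. q e' e)"
    and q_sym: "\<And>e e'. e \<in> E \<Longrightarrow> e' \<in> E \<Longrightarrow> q e e' = q e' e"
    and q_nondeg: "\<And>e. e \<in> E \<Longrightarrow> (\<And>e'. e' \<in> E \<Longrightarrow> q e' e = 0) \<Longrightarrow> e = 0"
    and comm: "\<And>u. u \<in> Kn c \<Longrightarrow> S (T u) = T (S u) + I (D u)"
    and F: "finite F"
    and RS: "\<And>m u. m \<notin> F \<Longrightarrow> u \<in> Kn c \<Longrightarrow> RS m (S u + m \<star> u) = u" "\<And>m. m \<notin> F \<Longrightarrow> lin (RS m)"
    and RT: "\<And>m u. m \<notin> F \<Longrightarrow> u \<in> Kn c \<Longrightarrow> RT m (T u + m \<star> u) = u" "\<And>m. m \<notin> F \<Longrightarrow> lin (RT m)"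
      "\<And>m u. m \<notin> F \<Longrightarrow> u \<in> Kn c \<Longrightarrow> RT m u \<in> Kn c"
    and hol: "\<And>m n e e'. m \<notin> F \<Longrightarrow> n \<notin> F \<Longrightarrow> e \<in> E \<Longrightarrow> e' \<in> E \<Longrightarrow>
      q (D (RS m (RT n (I e)))) e' + q e (D (RT n (RS m (I e')))) = 0"
    and costable: "\<And>u x y. u \<in> Kn c \<Longrightarrow> D u = 0 \<Longrightarrow> S u = x \<star> u \<Longrightarrow> T u = y \<star> u \<Longrightarrow> u = 0"
    and stable: "\<And>\<xi> x y u. linf \<xi> \<Longrightarrow> (\<And>e. e \<in> E \<Longrightarrow> \<xi> (I e) = 0) \<Longrightarrow>
      (\<And>u. u \<in> Kn c \<Longrightarrow> \<xi> (S u) = x * \<xi> u) \<Longrightarrow> (\<And>u. u \<in> Kn c \<Longrightarrow> \<xi> (T u) = y * \<xi> u) \<Longrightarrow>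
      u \<in> Kn c \<Longrightarrow> \<xi> u = 0"
begin

section \<open>Words in \<open>S\<close> and \<open>T\<close> and their adjoints\<close>

lemma q_adds:
  "q (e + e') f = q e f + q e' f" "q f (e + e') = q f e + q f e'"
  using linf_add[OF q_lin(1), of f e e'] linf_add[OF q_lin(2)[of f], of e e'] by auto

text \<open>\<open>True\<close> stands for \<open>S\<close> and \<open>False\<close> for
  \<open>T\<close>; the head of the list is the outermost map.\<close>

primrec word :: "bool list \<Rightarrow> (nat \<Rightarrow> 'k) \<Rightarrow> nat \<Rightarrow> 'k" where
  "word [] u = u"
| "word (b # w) u = (if b then S else T) (word w u)"

lemma word_append: "word (w @ w') u = word w (word w' u)"
  by (induction w) auto

lemma word_lin: "lin (word w)"
proof (induction w)
  case Nil
  show ?case by (intro linI) simp_all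
next
  case (Cons b w)
  from lin_comp[OF Cons lin(1)] lin_comp[OF Cons lin(2)] show ?case by (cases b) simp_all
qed

lemma word_closed: "u \<in> Kn c \<Longrightarrow> word w u \<in> Kn c"
  by (induction w) (auto simp: closed)

lemma word_swap:
  assumes "u \<in> Kn c"
  shows "word (w @ True # False # w') u = word (w @ False # True # w') u + word w (I (D (word w' u)))"
  using comm[OF word_closed[OF assms, of w']] by (simp add: word_append lin_add[OF word_lin])

text \<open>On \<open>E\<close> the adjoint of \<open>D w I\<close> is minus the same expression in
  the reversed word. Only words enclosed by \<open>D\<close> and \<open>I\<close> can have adjoints
  at this stage, as \<open>Kn c\<close> carries no form yet.\<close>

definition wadj :: "bool list \<Rightarrow> bool" where
  "wadj w \<longleftrightarrow> (\<forall>e\<in>E. \<forall>e'\<in>E. q (D (word w (I e))) e' + q e (D (word (rev w) (I e'))) = 0)"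

text \<open>\<open>hol\<close> is a generating function for the words \<open>S^i T^j\<close>. Its
  coefficients at infinity are extracted by \<open>resolvent_powers\<close>, in the parameter of
  \<open>RT\<close> and, with that one fixed, in the parameter of \<open>RS\<close>.\<close>

lemma wadj_sorted: "wadj (replicate i True @ replicate j False)"
proof -
  obtain l where l: "\<And>u. u \<in> Kn c \<Longrightarrow> kill S l u = 0"
    using exists_kill[OF lin(1), of c] closed(1) by blast
  obtain l' where l': "\<And>u. u \<in> Kn c \<Longrightarrow> kill T l' u = 0"
    using exists_kill[OF lin(2), of c] closed(2) by blast
  have pow: "word (replicate i True) u = (S ^^ i) u" "word (replicate j False) u = (T ^^ j) u" for u i j
    by (induction i) (simp_all, induction j, simp_all)
  have "word (replicate i True) = S ^^ i" by (rule ext) (rule pow)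
  then have powlin: "lin (S ^^ i)" using word_lin[of "replicate i True"] by simp
  have "q (D ((S ^^ i) ((T ^^ j) (I e)))) e' + q e (D ((T ^^ j) ((S ^^ i) (I e')))) = 0"
    if e: "e \<in> E" "e' \<in> E" for e e'
  proof (rule resolvent_powers[OF lin(2) _ _ closed(2) subspace_Kn RT(1,2) F l'])
    show "linf (\<lambda>u. q (D ((S ^^ i) u)) e')"
      by (rule linf_comp[OF powlin linf_comp[OF lin(3) q_lin(2)]])
    show "linf (\<lambda>u. q e (D u))" by (rule linf_comp[OF lin(3) q_lin(1)])
    show "I e \<in> Kn c" "(S ^^ i) (I e') \<in> Kn c"
      using closed(4) e word_closed[of "I e'" "replicate i True"] by (auto simp: pow)
    fix n assume n: "n \<notin> F"
    show "q (D ((S ^^ i) (RT n (I e)))) e' + q e (D (RT n ((S ^^ i) (I e')))) = 0"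
    proof (rule resolvent_powers[OF lin(1) _ _ closed(1) subspace_Kn RS F l])
      show "linf (\<lambda>u. q (D u) e')" by (rule linf_comp[OF lin(3) q_lin(2)])
      show "linf (\<lambda>u. q e (D (RT n u)))" by (rule linf_comp[OF RT(2)[OF n] linf_comp[OF lin(3) q_lin(1)]])
      show "RT n (I e) \<in> Kn c" "I e' \<in> Kn c" using closed(4) e RT(3) n by auto
      show "q (D (RS m (RT n (I e)))) e' + q e (D (RT n (RS m (I e')))) = 0" if "m \<notin> F" for m
        by (rule hol[OF that n e])
    qed
  qed
  then show ?thesis by (simp add: wadj_def word_append pow)
qed

text \<open>Exchanging \<open>S\<close> and \<open>T\<close> costs the word with \<open>I D\<close>
  put between \<open>w\<close> and \<open>w'\<close>. In the left argument of \<open>q\<close> this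
  correction passes through \<open>?f\<close>, in the right one through \<open>?g\<close>; by
  \<open>wadj w\<close> and \<open>wadj w'\<close> both corrections equal \<open>- q ?f ?g\<close>,
  so they cancel.\<close>

lemma wadj_swap:
  assumes "wadj w" "wadj w'"
  shows "wadj (w @ True # False # w') \<longleftrightarrow> wadj (w @ False # True # w')"
proof -
  have "q (D (word (w @ True # False # w') (I e))) e' + q e (D (word (rev (w @ True # False # w')) (I e'))) =
      q (D (word (w @ False # True # w') (I e))) e' + q e (D (word (rev (w @ False # True # w')) (I e')))"
    if e: "e \<in> E" "e' \<in> E" for e e'
  proof -
    let ?f = "D (word w' (I e))" and ?g = "D (word (rev w) (I e'))"
    have fg: "?f \<in> E" "?g \<in> E" using closed word_closed e by auto
    have "q (D (word w (I ?f))) e' + q ?f ?g = 0" "q ?f ?g + q e (D (word (rev w') (I ?g))) = 0"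
      using assms e fg by (auto simp: wadj_def)
    then have "q (D (word w (I ?f))) e' = q e (D (word (rev w') (I ?g)))"
      by (simp add: add_eq_0_iff2)
    moreover have "q (D (word (w @ True # False # w') (I e))) e' =
        q (D (word (w @ False # True # w') (I e))) e' + q (D (word w (I ?f))) e'"
      using word_swap[OF closed(4)[OF e(1)], of w w'] by (simp add: lin_add[OF lin(3)] q_adds)
    moreover have "q e (D (word (rev (w @ False # True # w')) (I e'))) =
        q e (D (word (rev (w @ True # False # w')) (I e'))) + q e (D (word (rev w') (I ?g)))"
      using word_swap[OF closed(4)[OF e(2)], of "rev w'" "rev w"] by (simp add: lin_add[OF lin(3)] q_adds)
    ultimately show ?thesis by simp
  qed
  then show ?thesis by (simp add: wadj_def)
qed

text \<open>Each step moves the letter \<open>T\<close> past one letter of \<open>w\<close>. A swap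
  in a word of length \<open>n\<close> calls for \<open>wadj\<close> only of the two outer pieces,
  whose lengths add up to \<open>n - 2\<close>.\<close>

lemma wadj_move:
  assumes IH: "\<And>w. length w < n \<Longrightarrow> wadj w"
  shows "length (w1 @ False # w @ w2) = n \<Longrightarrow> wadj (w1 @ False # w @ w2) \<longleftrightarrow> wadj (w1 @ w @ False # w2)"
proof (induction w arbitrary: w1)
  case (Cons b w)
  have m: "wadj ((w1 @ [b]) @ False # w @ w2) \<longleftrightarrow> wadj ((w1 @ [b]) @ w @ False # w2)"
    using Cons.prems by (intro Cons.IH) simp
  show ?case
  proof (cases b)
    case True
    have "wadj (w1 @ True # False # w @ w2) \<longleftrightarrow> wadj (w1 @ False # True # w @ w2)"
      using Cons.prems by (intro wadj_swap IH) auto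
    then show ?thesis using m True by simp
  qed (use m in simp)
qed simp

text \<open>Induction on the length and, inside it, sorting: a letter \<open>S\<close> joins the
  prefix, a letter \<open>T\<close> is moved to the suffix, until the sorted case is
  reached.\<close>

lemma wadj_all: "wadj w"
proof (induction "length w" arbitrary: w rule: less_induct)
  case less
  have "wadj (replicate i True @ w' @ replicate j False)" if "i + length w' + j = length w" for i j w'
    using that
  proof (induction w' arbitrary: i j)
    case Nil
    show ?case using wadj_sorted by simp
  next
    case (Cons b w')
    show ?case
    proof (cases b)
      case True
      then show ?thesis using Cons.IH[of "Suc i" j] Cons.prems by (simp add: replicate_app_Cons_same)
    next
      case False
      have "wadj (replicate i True @ False # w' @ replicate j False) \<longleftrightarrow>
          wadj (replicate i True @ w' @ False # replicate j False)"
        by (rule wadj_move[OF less]) (use Cons.prems in auto)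
      then show ?thesis using False Cons.IH[of i "Suc j"] Cons.prems by simp
    qed
  qed
  from this[of 0 w 0] show ?case by simp
qed

text \<open>On the invariant subspace of vectors killed by every \<open>D w\<close> the map
  \<open>D\<close> is zero, so \<open>S\<close> and \<open>T\<close> commute there by
  \<open>comm\<close>. A common eigenvector in it contradicts \<open>costable\<close>.\<close>

lemma word_D_injective:
  assumes u: "u \<in> Kn c" "\<And>w. D (word w u) = 0"
  shows "u = 0"
proof (rule ccontr)
  assume "u \<noteq> 0"
  let ?R = "{u \<in> Kn c. \<forall>w. D (word w u) = 0}"
  obtain l where l: "\<And>u. u \<in> Kn c \<Longrightarrow> kill S l u = 0"
    using exists_kill[OF lin(1), of c] closed(1) by blast
  obtain l' where l': "\<And>u. u \<in> Kn c \<Longrightarrow> kill T l' u = 0"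
    using exists_kill[OF lin(2), of c] closed(2) by blast
  have D0: "D v = 0" if "v \<in> ?R" for v
    using that by (auto dest!: spec[where x = "[]"])
  have sub: "fv.subspace ?R"
    unfolding fv.subspace_def
    by (auto simp: lin_0[OF word_lin] lin_0[OF lin(3)] lin_add[OF word_lin] lin_add[OF lin(3)]
        lin_scale[OF word_lin] lin_scale[OF lin(3)])
  have inv: "S v \<in> ?R" "T v \<in> ?R" if "v \<in> ?R" for v
  proof -
    \<comment> \<open>A letter appended to the list acts first, so a word applied to
      \<open>S v\<close> or \<open>T v\<close> is again a word applied to \<open>v\<close>.\<close>
    have "D (word (w @ [b]) v) = 0" for w b using that by blast
    from this[of _ True] this[of _ False] show "S v \<in> ?R" "T v \<in> ?R"
      using that closed by (auto simp: word_append)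
  qed
  have comm': "S (T v) = T (S v)" if "v \<in> ?R" for v
    using comm[of v] D0[OF that] that by (simp add: lin_0[OF lin(4)])
  show False
  proof (rule common_eigenvector[OF sub inv lin(1,2) comm', of l l' u])
    fix v x y assume "v \<in> ?R" "v \<noteq> 0" "S v = x \<star> v" "T v = y \<star> v"
    then show False using costable[of v x y] D0 by blast
  qed (use u l l' \<open>u \<noteq> 0\<close> in auto)
qed

definition gens :: "(nat \<Rightarrow> 'k) set" where
  "gens = {word w (I e) | w e. e \<in> E}"

text \<open>Dual to \<open>word_D_injective\<close>: the functionals that vanish on
  \<open>gens\<close> are invariant under the transposes of \<open>S\<close> and \<open>T\<close>,
  which commute on them. If one of them is nonzero on \<open>Kn c\<close>, a common eigenfunctional
  exists and contradicts \<open>stable\<close>.\<close>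

lemma span_gens: "Kn c \<subseteq> fv.span gens"
proof
  fix u :: "nat \<Rightarrow> 'k" assume u: "u \<in> Kn c"
  show "u \<in> fv.span gens"
  proof (rule ccontr)
    assume "u \<notin> fv.span gens"
    then obtain f where f: "linf f" "f u = 1" "\<And>v. v \<in> fv.span gens \<Longrightarrow> f v = 0"
      using exists_annihilator by blast
    \<comment> \<open>The functionals are cut off outside \<open>Kn c\<close>. As functions on all
      vectors they form a space to which \<open>common_eigenvector\<close> applies, and to be zero
      in it means to vanish on \<open>Kn c\<close>.\<close>
    define R where "R = {\<xi>. \<exists>g. linf g \<and> (\<forall>v\<in>gens. g v = 0) \<and> \<xi> = (\<lambda>v. if v \<in> Kn c then g v else 0)}"
    define tr :: "((nat \<Rightarrow> 'k) \<Rightarrow> nat \<Rightarrow> 'k) \<Rightarrow> ((nat \<Rightarrow> 'k) \<Rightarrow> 'k) \<Rightarrow> (nat \<Rightarrow> 'k) \<Rightarrow> 'k"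
      where "tr A \<xi> = (\<lambda>v. if v \<in> Kn c then \<xi> (A v) else 0)" for A \<xi>
    have lin_tr: "lin (tr A)" for A
      by (intro linI) (auto simp: tr_def fun_eq_iff fun_simps)
    have RI: "(\<lambda>v. if v \<in> Kn c then g v else 0) \<in> R" if "linf g" "\<And>v. v \<in> gens \<Longrightarrow> g v = 0" for g
      unfolding R_def using that by blast
    have sub: "fv.subspace R"
      unfolding fv.subspace_def
    proof (intro conjI ballI allI)
      have "linf (\<lambda>_ :: nat \<Rightarrow> 'k. 0)" by (rule linfI) simp_all
      then show "0 \<in> R" using RI[of "\<lambda>_. 0"] by (simp add: zero_fun_def)
    next
      fix x y assume "x \<in> R" "y \<in> R"
      then obtain g h where "linf g" "\<forall>v\<in>gens. g v = 0" "x = (\<lambda>v. if v \<in> Kn c then g v else 0)"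
        "linf h" "\<forall>v\<in>gens. h v = 0" "y = (\<lambda>v. if v \<in> Kn c then h v else 0)" unfolding R_def by blast
      moreover have "x + y = (\<lambda>v. if v \<in> Kn c then g v + h v else 0)"
        using calculation by (auto simp: fun_eq_iff fun_simps)
      ultimately show "x + y \<in> R" using RI[of "\<lambda>v. g v + h v"]
        by (simp add: linf_plus)
    next
      fix a x assume "x \<in> R"
      then obtain g where g: "linf g" "\<forall>v\<in>gens. g v = 0" "x = (\<lambda>v. if v \<in> Kn c then g v else 0)"
        unfolding R_def by blast
      then have "a \<star> x = (\<lambda>v. if v \<in> Kn c then a * g v else 0)"
        by (auto simp: fun_eq_iff fun_simps)
      then show "a \<star> x \<in> R" using g RI[of "\<lambda>v. a * g v"]
        by (simp add: linf_times)
    qed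
    have inv: "tr (if b then S else T) \<xi> \<in> R" if \<xi>: "\<xi> \<in> R" for \<xi> b
    proof -
      obtain g where g: "linf g" "\<forall>v\<in>gens. g v = 0" "\<xi> = (\<lambda>v. if v \<in> Kn c then g v else 0)"
        using \<xi> unfolding R_def by blast
      have 1: "linf (\<lambda>v. g ((if b then S else T) v))"
        using linf_comp[OF lin(1) g(1)] linf_comp[OF lin(2) g(1)] by (cases b) auto
      have 2: "g ((if b then S else T) v) = 0" if "v \<in> gens" for v
      proof -
        from that obtain w e where "v = word w (I e)" "e \<in> E" unfolding gens_def by blast
        then have "(if b then S else T) v = word (b # w) (I e)" by simp
        then have "(if b then S else T) v \<in> gens" using \<open>e \<in> E\<close> unfolding gens_def by blast
        then show ?thesis using g(2) by blast
      qed
      have "tr (if b then S else T) \<xi> = (\<lambda>v. if v \<in> Kn c then g ((if b then S else T) v) else 0)"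
        using closed(1,2) by (auto simp: tr_def g(3) fun_eq_iff)
      then show ?thesis using RI[OF 1 2] by simp
    qed
    \<comment> \<open>Transposition turns a product of factors of \<open>S\<close> into the product
      of the same factors of the transpose, so the root lists of \<open>S\<close> and
      \<open>T\<close> serve for the transposes as well.\<close>
    have tr_kill: "kill (tr (if b then S else T)) l \<xi> v = \<xi> (kill (if b then S else T) l v)"
      if "\<xi> \<in> R" "v \<in> Kn c" for \<xi> l v b
      using that
    proof (induction l arbitrary: \<xi>)
      case (Cons x l)
      let ?S = "if b then S else T"
      have linS: "lin ?S" using lin by (cases b) auto
      have cS: "?S v \<in> Kn c" if "v \<in> Kn c" for v using closed that by (cases b) auto
      obtain g where g: "linf g" "\<xi> = (\<lambda>v. if v \<in> Kn c then g v else 0)"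
        using Cons.prems(1) unfolding R_def by blast
      have k: "kill ?S l v \<in> Kn c" using Cons.prems(2)
      proof (induction l arbitrary: v)
        case (Cons y l)
        then show ?case using cS by auto
      qed simp
      have "tr ?S \<xi> - x \<star> \<xi> \<in> R"
        using inv[OF Cons.prems(1)] sub Cons.prems(1) by (intro fv.subspace_diff fv.subspace_scale)
      then have "kill (tr ?S) (x # l) \<xi> v = (tr ?S \<xi> - x \<star> \<xi>) (kill ?S l v)"
        using Cons by simp
      also have "\<dots> = g (?S (kill ?S l v) - x \<star> kill ?S l v)"
        using k cS by (simp add: fun_simps tr_def g(2) linf_diff[OF g(1)] linf_scale[OF g(1)])
      also have "\<dots> = \<xi> (kill ?S (x # l) v)"
        using k cS by (simp add: kill_step[OF linS] g(2) Kn_diff Kn_scale)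
      finally show ?case .
    qed simp
    have zero_off: "\<xi> v = 0" if "\<xi> \<in> R" "v \<notin> Kn c" for \<xi> v using that unfolding R_def by auto
    have kill_R: "kill (tr (if b then S else T)) l \<xi> \<in> R" if "\<xi> \<in> R" for b l \<xi>
      using that
    proof (induction l arbitrary: \<xi>)
      case (Cons x l)
      have "tr (if b then S else T) \<xi> - x \<star> \<xi> \<in> R"
        using inv[OF Cons.prems] sub Cons.prems by (intro fv.subspace_diff fv.subspace_scale)
      then show ?case using Cons.IH by simp
    qed simp
    obtain l where l: "\<And>u. u \<in> Kn c \<Longrightarrow> kill S l u = 0"
      using exists_kill[OF lin(1), of c] closed(1) by blast
    obtain l' where l': "\<And>u. u \<in> Kn c \<Longrightarrow> kill T l' u = 0"
      using exists_kill[OF lin(2), of c] closed(2) by blast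
    have at0: "\<xi> 0 = 0" if "\<xi> \<in> R" for \<xi>
      using that unfolding R_def by (auto simp: linf_0)
    have killS: "kill (tr S) l \<xi> = 0" if "\<xi> \<in> R" for \<xi>
      using tr_kill[OF that, of _ True l] zero_off[OF kill_R[OF that, of True l]] l at0[OF that]
      by (auto simp: fun_eq_iff zero_fun_apply)
    have killT: "kill (tr T) l' \<xi> = 0" if "\<xi> \<in> R" for \<xi>
      using tr_kill[OF that, of _ False l'] zero_off[OF kill_R[OF that, of False l']] l' at0[OF that]
      by (auto simp: fun_eq_iff zero_fun_apply)
    \<comment> \<open>The commutator of the transposes is composition with \<open>I D\<close>, and
      \<open>I (D v)\<close> is the generator with the empty word.\<close>
    have commR: "tr S (tr T \<xi>) = tr T (tr S \<xi>)" if xi: "\<xi> \<in> R" for \<xi>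
    proof
      fix v
      obtain g where g: "linf g" "\<forall>v\<in>gens. g v = 0" "\<xi> = (\<lambda>v. if v \<in> Kn c then g v else 0)"
        using xi unfolding R_def by blast
      have "g (I (D v)) = 0" if "v \<in> Kn c"
      proof -
        have "I (D v) = word [] (I (D v))" by simp
        then have "I (D v) \<in> gens" using closed(3)[OF that] unfolding gens_def by blast
        then show ?thesis using g(2) by blast
      qed
      then show "tr S (tr T \<xi>) v = tr T (tr S \<xi>) v"
        using closed comm[of v] by (auto simp: tr_def g(3) linf_add[OF g(1)])
    qed
    let ?f = "\<lambda>v. if v \<in> Kn c then f v else 0"
    have "?f \<in> R" using f(1,3) fv.span_base[of _ gens] by (intro RI) blast+
    moreover have "?f \<noteq> 0"
      using u f(2) by (auto simp: fun_eq_iff zero_fun_apply intro!: exI[of _ u])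
    ultimately obtain \<xi> x y where \<xi>: "\<xi> \<in> R" "\<xi> \<noteq> 0" "tr S \<xi> = x \<star> \<xi>" "tr T \<xi> = y \<star> \<xi>"
      using common_eigenvector[of R "tr S" "tr T" l l' ?f thesis] sub lin_tr commR killS killT
        inv[where b = True] inv[where b = False] by simp
    obtain g where g: "linf g" "\<forall>v\<in>gens. g v = 0" "\<xi> = (\<lambda>v. if v \<in> Kn c then g v else 0)"
      using \<xi>(1) unfolding R_def by blast
    have "g v = 0" if "v \<in> Kn c" for v
    proof (rule stable[OF g(1) _ _ _ that])
      fix e assume "e \<in> E"
      then have "word [] (I e) \<in> gens" unfolding gens_def by blast
      then show "g (I e) = 0" using g(2) by simp
    next
      fix u :: "nat \<Rightarrow> 'k" assume u: "u \<in> Kn c"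
      show "g (S u) = x * g u"
        using fun_cong[OF \<xi>(3), of u] u closed by (simp add: tr_def g(3) fun_simps)
      show "g (T u) = y * g u"
        using fun_cong[OF \<xi>(4), of u] u closed by (simp add: tr_def g(3) fun_simps)
    qed
    then have "\<xi> = 0" using g(3) by (auto simp: fun_eq_iff zero_fun_apply)
    with \<xi>(2) show False by simp
  qed
qed

text \<open>The functional \<open>\<omega>(u, \<cdot>)\<close> of the skew form \<open>\<omega>(w I e, u) = q(e, D w\<^sup>r u)\<close>, where \<open>w\<^sup>r\<close> is the
  reversed word, is characterised by its values on the generators.\<close>

definition rep :: "(nat \<Rightarrow> 'k) \<Rightarrow> ((nat \<Rightarrow> 'k) \<Rightarrow> 'k) \<Rightarrow> bool" where
  "rep u \<psi> \<longleftrightarrow> linf \<psi> \<and> (\<forall>w. \<forall>e\<in>E. \<psi> (word w (I e)) = - q e (D (word (rev w) u)))"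

text \<open>By adjointness of the concatenation \<open>rev w' @ w\<close>, whose reversal is
  \<open>rev w @ w'\<close>. Such concatenations are the reason why \<open>wadj\<close> is wanted
  for all words and not only for sorted ones.\<close>

lemma rep_gen:
  assumes "e' \<in> E"
  shows "rep (word w' (I e')) (\<lambda>v. q e' (D (word (rev w') v)))"
  unfolding rep_def
proof (intro conjI allI ballI)
  show "linf (\<lambda>v. q e' (D (word (rev w') v)))"
    using linf_comp[OF lin_comp[OF word_lin lin(3)] q_lin(1)] .
  fix w e assume e: "e \<in> E"
  have "D (word (rev w' @ w) (I e)) \<in> E" by (intro closed word_closed e)
  then show "q e' (D (word (rev w') (word w (I e)))) = - q e (D (word (rev w) (word w' (I e'))))"
    using wadj_all[of "rev w' @ w"] e assms q_sym[of e' "D (word (rev w' @ w) (I e))"]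
    by (simp add: wadj_def word_append add_eq_0_iff2)
qed

lemma rep_0: "rep 0 (\<lambda>_. 0)"
proof -
  have "linf (\<lambda>_ :: nat \<Rightarrow> 'k. 0)" by (rule linfI) simp_all
  moreover have "q e (D (word w 0)) = 0" for e w
    by (simp only: lin_0[OF word_lin] lin_0[OF lin(3)] linf_0[OF q_lin(1)])
  ultimately show ?thesis unfolding rep_def by simp
qed

lemma rep_add: "rep u \<psi> \<Longrightarrow> rep v \<theta> \<Longrightarrow> rep (u + v) (\<lambda>x. \<psi> x + \<theta> x)"
  unfolding rep_def
  by (auto intro!: linf_plus simp: lin_add[OF word_lin] lin_add[OF lin(3)] q_adds)

lemma rep_scale: "rep u \<psi> \<Longrightarrow> rep (a \<star> u) (\<lambda>x. a * \<psi> x)"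
  unfolding rep_def
  by (auto intro!: linf_times simp: lin_scale[OF word_lin] lin_scale[OF lin(3)]
      linf_scale[OF q_lin(1)])

lemma rep_unique:
  assumes "rep u \<psi>" "rep u \<theta>" "v \<in> fv.span gens"
  shows "\<psi> v = \<theta> v"
proof -
  have l: "linf \<psi>" "linf \<theta>" using assms(1,2) by (auto simp: rep_def)
  have "fv.subspace {v. \<psi> v = \<theta> v}"
    unfolding fv.subspace_def by (simp add: linf_0[OF l(1)] linf_0[OF l(2)] linf_add[OF l(1)] linf_add[OF l(2)]
      linf_scale[OF l(1)] linf_scale[OF l(2)])
  moreover have "gens \<subseteq> {v. \<psi> v = \<theta> v}" using assms(1,2) by (auto simp: rep_def gens_def)
  ultimately have "fv.span gens \<subseteq> {v. \<psi> v = \<theta> v}" by (intro fv.span_minimal)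
  with assms(3) show ?thesis by blast
qed

text \<open>For a generator \<open>v\<close> the functional of \<open>rep_gen\<close>, taken at
  \<open>u\<close>, is the negative of \<open>\<psi> v\<close> by the definition of
  \<open>rep u \<psi>\<close>. The vectors \<open>v\<close> admitting some suitable functional form
  a subspace, and \<open>rep_unique\<close> exchanges the one found for the given
  \<open>\<theta>\<close>.\<close>

lemma rep_skew:
  assumes "rep u \<psi>" "rep v \<theta>" "u \<in> fv.span gens" "v \<in> fv.span gens"
  shows "\<psi> v + \<theta> u = 0"
proof -
  have l: "linf \<psi>" using assms(1) by (auto simp: rep_def)
  let ?V = "{v. \<exists>\<theta>. rep v \<theta> \<and> \<psi> v + \<theta> u = 0}"
  have "fv.subspace ?V"
    unfolding fv.subspace_def
  proof (intro conjI ballI allI)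
    show "0 \<in> ?V" using rep_0 by (auto simp: linf_0[OF l])
  next
    fix x y assume "x \<in> ?V" "y \<in> ?V"
    then obtain f g where "rep x f" "\<psi> x + f u = 0" "rep y g" "\<psi> y + g u = 0" by blast
    then have "rep (x + y) (\<lambda>v. f v + g v)" "\<psi> (x + y) + (f u + g u) = 0"
      using rep_add by (auto simp: linf_add[OF l] add_eq_0_iff2 algebra_simps)
    then show "x + y \<in> ?V" by blast
  next
    fix a x assume "x \<in> ?V"
    then obtain f where "rep x f" "\<psi> x + f u = 0" by blast
    then have "rep (a \<star> x) (\<lambda>v. a * f v)" "\<psi> (a \<star> x) + a * f u = 0"
      using rep_scale by (auto simp: linf_scale[OF l] simp flip: distrib_left)
    then show "a \<star> x \<in> ?V" by blast
  qed
  moreover have "gens \<subseteq> ?V"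
  proof
    fix b assume "b \<in> gens"
    then obtain w e where b: "b = word w (I e)" "e \<in> E" unfolding gens_def by blast
    then have "\<psi> b + q e (D (word (rev w) u)) = 0" using assms(1) by (simp add: rep_def)
    then show "b \<in> ?V" using rep_gen[OF b(2), of w] b(1) by blast
  qed
  ultimately have "v \<in> ?V" using assms(4) fv.span_minimal by blast
  then obtain \<theta>' where "rep v \<theta>'" "\<psi> v + \<theta>' u = 0" by blast
  then show ?thesis using rep_unique[OF assms(2) _ assms(3)] by metis
qed

text \<open>\<open>rep\<close> is closed under linear combinations, so generators suffice. Linear
  relations among generators need no inspection, because \<open>rep_unique\<close> already makes the
  form well defined.\<close>

lemma rep_exists: "u \<in> Kn c \<Longrightarrow> \<exists>\<psi>. rep u \<psi>"
proof -
  have "fv.subspace {u. \<exists>\<psi>. rep u \<psi>}"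
    unfolding fv.subspace_def using rep_0 rep_add rep_scale by blast
  moreover have "gens \<subseteq> {u. \<exists>\<psi>. rep u \<psi>}" unfolding gens_def using rep_gen by blast
  ultimately have "fv.span gens \<subseteq> {u. \<exists>\<psi>. rep u \<psi>}" by (intro fv.span_minimal)
  then show "u \<in> Kn c \<Longrightarrow> \<exists>\<psi>. rep u \<psi>" using span_gens by blast
qed

theorem even_charge: "even c"
proof -
  have "\<exists>\<psi>. i < c \<longrightarrow> rep (unitv i) \<psi>" for i using rep_exists[of "unitv i"] by auto
  then obtain \<Psi> where \<Psi>: "\<And>i. i < c \<Longrightarrow> rep (unitv i) (\<Psi> i)" by metis
  have l: "linf (\<Psi> i)" if "i < c" for i using \<Psi>[OF that] by (simp add: rep_def)
  have gen: "unitv i \<in> fv.span gens" if "i < c" for i using span_gens that by auto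
  have eval: "\<Psi> i v = (\<Sum>j<c. \<Psi> i (unitv j) * v j)" if "i < c" "v \<in> Kn c" for i v
  proof -
    have "\<Psi> i v = \<Psi> i (\<Sum>j<c. v j \<star> unitv j)" using Kn_expand[OF that(2)] by (rule arg_cong)
    also have "\<dots> = (\<Sum>j<c. v j * \<Psi> i (unitv j))"
      by (simp only: linf_sum[OF l[OF that(1)]] linf_scale[OF l[OF that(1)]])
    finally show ?thesis by (simp only: mult.commute)
  qed
  show ?thesis
  proof (rule even_if_skew_nondegenerate[of c "\<lambda>i j. \<Psi> i (unitv j)"])
    fix i j assume ij: "i < c" "j < c"
    show "\<Psi> i (unitv j) = - \<Psi> j (unitv i)"
      using rep_skew[OF \<Psi>[OF ij(1)] \<Psi>[OF ij(2)] gen[OF ij(1)] gen[OF ij(2)]] by (simp only: add_eq_0_iff2)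
  next
    fix v :: "nat \<Rightarrow> 'k" assume v: "v \<in> Kn c" "\<And>i. i < c \<Longrightarrow> (\<Sum>j<c. \<Psi> i (unitv j) * v j) = 0"
    have vg: "v \<in> fv.span gens" using span_gens v(1) by auto
    obtain \<psi> where \<psi>: "rep v \<psi>" using rep_exists[OF v(1)] by blast
    have unit: "\<psi> (unitv i) = 0" if "i < c" for i
      using rep_skew[OF \<psi> \<Psi>[OF that] vg gen[OF that]] eval[OF that v(1)] v(2)[OF that] by (simp only: add_0_right)
    have linpsi: "linf \<psi>" using \<psi> by (simp add: rep_def)
    have psi0: "\<psi> u = 0" if "u \<in> Kn c" for u
    proof -
      have "\<psi> u = \<psi> (\<Sum>j<c. u j \<star> unitv j)" by (rule arg_cong[OF Kn_expand[OF that]])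
      also have "\<dots> = (\<Sum>j<c. u j * \<psi> (unitv j))"
        by (simp only: linf_sum[OF linpsi] linf_scale[OF linpsi])
      finally show ?thesis using unit by simp
    qed
    \<comment> \<open>For \<open>v\<close> in the radical, \<open>\<psi>\<close> vanishes on all
      generators. Hence every \<open>D w v\<close> is orthogonal to \<open>E\<close>, where
      \<open>q\<close> is nondegenerate.\<close>
    have "D (word w v) = 0" for w
    proof -
      have "q e (D (word w v)) = 0" if "e \<in> E" for e
      proof -
        have "\<psi> (word (rev w) (I e)) = - q e (D (word (rev (rev w)) v))"
          using \<psi> that unfolding rep_def by blast
        then show ?thesis using psi0[OF word_closed[OF closed(4)[OF that]], of "rev w"] by simp
      qed
      then show ?thesis using q_nondeg[OF closed(3)[OF word_closed[OF v(1)]], of w] by blast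
    qed
    then show "v = 0" by (rule word_D_injective[OF v(1)])
  qed
qed

end

section \<open>From the monad to ADHM data\<close>

lemma kill_eigenvalue:
  assumes S: "lin S"
  shows "kill S l u = 0 \<Longrightarrow> S u + m \<star> u = 0 \<Longrightarrow> - m \<notin> set l \<Longrightarrow> u = 0"
proof (induction l)
  case (Cons x l)
  have "S u - x \<star> u = (S u + m \<star> u) + (- m - x) \<star> u"
    by (simp add: fv.scale_left_diff_distrib)
  then have "kill S (x # l) u = (- m - x) \<star> kill S l u"
    using Cons.prems(2) by (simp add: lin_scale[OF kill_lin[OF S]])
  moreover have "- m - x \<noteq> 0" using Cons.prems(3) by auto
  ultimately have "kill S l u = 0" using Cons.prems(1) by simp
  then show ?case using Cons by simp
qed simp

text \<open>\<open>S + m\<close> is invertible on \<open>Kn c\<close> unless \<open>- m\<close>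
  occurs in the finite root list that \<open>exists_kill\<close> provides.\<close>

lemma resolvents_exist:
  fixes S :: "(nat \<Rightarrow> 'k::alg_closed_field) \<Rightarrow> nat \<Rightarrow> 'k"
  assumes S: "lin S" "\<And>u. u \<in> Kn c \<Longrightarrow> S u \<in> Kn c"
  obtains F R where "finite F" "\<And>m. m \<notin> F \<Longrightarrow> lin (R m)" "\<And>m u. m \<notin> F \<Longrightarrow> R m u \<in> Kn c"
    "\<And>m u. m \<notin> F \<Longrightarrow> u \<in> Kn c \<Longrightarrow> R m (S u + m \<star> u) = u"
    "\<And>m u. m \<notin> F \<Longrightarrow> u \<in> Kn c \<Longrightarrow> S (R m u) + m \<star> R m u = u"
proof -
  obtain l where l: "\<And>u. u \<in> Kn c \<Longrightarrow> kill S l u = 0"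
    using exists_kill[OF S(1), of c] S(2) by blast
  let ?F = "uminus ` set l"
  have "\<exists>g. lin g \<and> range g \<subseteq> Kn c \<and> (\<forall>u\<in>Kn c. g (S u + m \<star> u) = u) \<and>
      (\<forall>u\<in>Kn c. S (g u) + m \<star> g u = u)" if m: "m \<notin> ?F" for m
  proof -
    have f: "lin (\<lambda>u. S u + m \<star> u)"
      by (intro linI) (simp_all add: lin_add[OF S(1)] lin_scale[OF S(1)] fv.scale_right_distrib
          fv.scale_left_commute[of m] algebra_simps)
    have nm: "- m \<notin> set l" using m by (metis image_eqI minus_minus)
    show ?thesis
    proof (rule lin_bij_inverse[OF f, of c])
      fix u assume "u \<in> Kn c" "S u + m \<star> u = 0"
      then show "u = 0" using kill_eigenvalue[OF S(1) l _ nm] by blast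
    next
      fix g assume g: "lin g" "range g \<subseteq> Kn c" "\<And>u. u \<in> Kn c \<Longrightarrow> g (S u + m \<star> u) = u"
        "\<And>u. u \<in> Kn c \<Longrightarrow> S (g u) + m \<star> g u = u"
      show ?thesis using g by (intro exI[of _ g]) simp
    qed (auto simp: S(2))
  qed
  then obtain R where "\<And>m. m \<notin> ?F \<Longrightarrow> lin (R m) \<and> range (R m) \<subseteq> Kn c \<and>
      (\<forall>u\<in>Kn c. R m (S u + m \<star> u) = u) \<and> (\<forall>u\<in>Kn c. S (R m u) + m \<star> R m u = u)"
    by metis
  note R = this
  show ?thesis
  proof (rule that[of ?F R])
    show "R m u \<in> Kn c" if "m \<notin> ?F" for m u using R[OF that] by blast
  qed (use R in auto)
qed

definition independent_points :: "'k::field ^ 'n \<Rightarrow> 'k ^ 'n \<Rightarrow> bool" where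
  "independent_points v w \<longleftrightarrow> (\<forall>s t. s *s v + t *s w = 0 \<longrightarrow> s = 0 \<and> t = 0)"

text \<open>The pointwise data of a self-dual monad: \<open>q v\<close> is the form that the orthogonal structure
  induces on the kernel of \<open>b v\<close>, with radical the image of \<open>a v\<close>.\<close>

locale orthogonal_monad =
  fixes c N :: nat
    and a b :: "'k::{alg_closed_field, field_char_0} ^ 'n \<Rightarrow> (nat \<Rightarrow> 'k) \<Rightarrow> nat \<Rightarrow> 'k"
    and q :: "'k ^ 'n \<Rightarrow> (nat \<Rightarrow> 'k) \<Rightarrow> (nat \<Rightarrow> 'k) \<Rightarrow> 'k"
  assumes a_lin: "\<And>v. lin (a v)" and b_lin: "\<And>v. lin (b v)"
    and a_add: "\<And>v w u. a (v + w) u = a v u + a w u" and a_scale: "\<And>x v u. a (x *s v) u = x \<star> a v u"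
    and b_add: "\<And>v w u. b (v + w) u = b v u + b w u" and b_scale: "\<And>x v u. b (x *s v) u = x \<star> b v u"
    and a_Kn: "\<And>v u. a v u \<in> Kn N" and b_Kn: "\<And>v u. b v u \<in> Kn c"
    and ba: "\<And>v u. u \<in> Kn c \<Longrightarrow> b v (a v u) = 0"
    and b_surj: "\<And>v p. v \<noteq> 0 \<Longrightarrow> p \<in> Kn c \<Longrightarrow> \<exists>w\<in>Kn N. b v w = p"
    and a_inj: "\<And>v u. v \<noteq> 0 \<Longrightarrow> u \<in> Kn c \<Longrightarrow> a v u = 0 \<Longrightarrow> u = 0"
    and q_lin: "\<And>v w. linf (q v w)" "\<And>v w. linf (\<lambda>w'. q v w' w)"
    and q_sym: "\<And>v w w'. \<lbrakk>v \<noteq> 0; w \<in> Kn N; w' \<in> Kn N; b v w = 0; b v w' = 0\<rbrakk> \<Longrightarrow> q v w w' = q v w' w"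
    and q_rad: "\<And>v u w. \<lbrakk>v \<noteq> 0; u \<in> Kn c; w \<in> Kn N; b v w = 0\<rbrakk> \<Longrightarrow> q v (a v u) w = 0"
    and q_nondeg: "\<And>v w. \<lbrakk>v \<noteq> 0; w \<in> Kn N; b v w = 0;
      \<And>w'. w' \<in> Kn N \<Longrightarrow> b v w' = 0 \<Longrightarrow> q v w' w = 0\<rbrakk> \<Longrightarrow> \<exists>u\<in>Kn c. w = a v u"
    and q_const: "\<And>v v' w w'. \<lbrakk>independent_points v v'; w \<in> Kn N; w' \<in> Kn N;
      b v w = 0; b v' w = 0; b v w' = 0; b v' w' = 0\<rbrakk> \<Longrightarrow> q v w w' = q v' w w'"
begin

text \<open>Polarisation of \<open>b v (a v u) = 0\<close>, which is quadratic in the point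
  \<open>v\<close>.\<close>

lemma b_a_swap: "u \<in> Kn c \<Longrightarrow> b v (a w u) = - b w (a v u)"
  using ba[of u "v + w"] ba[of u v] ba[of u w]
  by (simp add: a_add b_add lin_add[OF b_lin] add_eq_0_iff2)

lemma q_adds:
  "q v (e + e') f = q v e f + q v e' f" "q v f (e + e') = q v f e + q v f e'"
  using linf_add[OF q_lin(1), of v f e e'] linf_add[OF q_lin(2)[of v f], of e e'] by auto

lemma q_shift:
  assumes "v \<noteq> 0" "w \<in> Kn N" "w' \<in> Kn N" "b v w = 0" "b v w' = 0" "u \<in> Kn c" "u' \<in> Kn c"
  shows "q v (w + a v u) (w' + a v u') = q v w w'"
proof -
  have "q v (w + a v u) (a v u') = 0"
    using assms q_rad[of v u' "w + a v u"] q_sym[of v "w + a v u" "a v u'"]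
    by (simp add: a_Kn ba lin_add[OF b_lin])
  then show ?thesis using q_rad[of v u w'] assms by (simp add: q_adds)
qed

lemma even_charge:
  assumes indep: "\<And>r s t. r *s x + s *s y + t *s z = 0 \<Longrightarrow> r = 0 \<and> s = 0 \<and> t = 0"
    and xy: "\<And>u. u \<in> Kn c \<Longrightarrow> b y (a x u) = 0 \<Longrightarrow> u = 0"
  shows "even c"
proof -
  note bs = lin_add[OF b_lin] lin_diff[OF b_lin] lin_scale[OF b_lin] lin_neg[OF b_lin] lin_0[OF b_lin]
  note as = lin_add[OF a_lin] lin_diff[OF a_lin] lin_scale[OF a_lin] lin_neg[OF a_lin] lin_0[OF a_lin]
  define Z where "Z u = b y (a x u)" for u
  have Zlin: "lin Z" unfolding Z_def by (intro linI) (simp_all add: as bs)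
  obtain Zi where Zi: "lin Zi" "range Zi \<subseteq> Kn c" "\<And>u. u \<in> Kn c \<Longrightarrow> Zi (Z u) = u"
    "\<And>u. u \<in> Kn c \<Longrightarrow> Z (Zi u) = u"
    using lin_bij_inverse[OF Zlin, of c] xy b_Kn unfolding Z_def by blast
  have ZiK: "Zi u \<in> Kn c" for u using Zi(2) by auto
  note Zs = lin_add[OF Zi(1)] lin_diff[OF Zi(1)] lin_scale[OF Zi(1)] lin_neg[OF Zi(1)] lin_0[OF Zi(1)]
  note Zs' = lin_add[OF Zlin] lin_diff[OF Zlin] lin_scale[OF Zlin] lin_neg[OF Zlin] lin_0[OF Zlin]
  define S where "S u = Zi (b y (a z u))" for u
  define T where "T u = Zi (b z (a x u))" for u
  define I where "I e = Zi (b z e)" for e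
  \<comment> \<open>\<open>pr\<close> projects onto \<open>E\<close> by removing a component along
    \<open>a x\<close> and one along \<open>a y\<close>. The signs differ because
    \<open>b y (a x u) = Z u\<close> while \<open>b x (a y u) = - Z u\<close>.\<close>
  define pr where "pr w = w - a x (Zi (b y w)) + a y (Zi (b x w))" for w
  define D where "D u = pr (a z u)" for u
  define E where "E = {w \<in> Kn N. b x w = 0 \<and> b y w = 0}"
  have lin_S: "lin S" unfolding S_def by (intro linI) (simp_all add: as bs Zs)
  have lin_T: "lin T" unfolding T_def by (intro linI) (simp_all add: as bs Zs)
  have lin_I: "lin I" unfolding I_def by (intro linI) (simp_all add: as bs Zs)
  have lin_D: "lin D" unfolding D_def pr_def
    by (intro linI) (simp_all add: as bs Zs fv.scale_right_distrib fv.scale_right_diff_distrib)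
  note Ss = lin_add[OF lin_S] lin_diff[OF lin_S] lin_scale[OF lin_S]
  note Ts = lin_add[OF lin_T] lin_diff[OF lin_T] lin_scale[OF lin_T]
  note Is = lin_add[OF lin_I] lin_diff[OF lin_I] lin_scale[OF lin_I]
  note Ds = lin_add[OF lin_D] lin_diff[OF lin_D] lin_scale[OF lin_D]
  have SK: "S u \<in> Kn c" and TK: "T u \<in> Kn c" and IK: "I u \<in> Kn c" for u
    by (simp_all add: S_def T_def I_def ZiK)
  have ZS: "b y (a z u) = Z (S u)" and ZT: "b z (a x u) = Z (T u)" and ZI: "b z u = Z (I u)" for u
    by (simp_all add: S_def T_def I_def Zi(4) b_Kn)
  have prE: "pr w \<in> E" if "w \<in> Kn N" for w
  proof -
    have "b x (pr w) = b x w + b x (a y (Zi (b x w)))"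
      by (simp add: pr_def bs ba ZiK)
    also have "b x (a y (Zi (b x w))) = - Z (Zi (b x w))"
      unfolding Z_def by (rule b_a_swap[OF ZiK])
    finally have "b x (pr w) = 0" by (simp add: Zi(4) b_Kn)
    moreover have "b y (pr w) = b y w - Z (Zi (b y w))"
      by (simp add: pr_def bs ba ZiK Z_def)
    then have "b y (pr w) = 0" by (simp add: Zi(4) b_Kn)
    ultimately show ?thesis using that by (simp add: E_def pr_def a_Kn Kn_add Kn_diff)
  qed
  have DE: "D u \<in> E" for u unfolding D_def by (rule prE[OF a_Kn])
  have az: "a z u = D u + a x (S u) + a y (T u)" if "u \<in> Kn c" for u
  proof -
    have "b x (a z u) = - Z (T u)" unfolding ZT[symmetric] by (rule b_a_swap[OF that])
    then have "Zi (b x (a z u)) = - T u" by (simp add: Zs Zi(3) TK)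
    then show ?thesis unfolding D_def pr_def S_def[symmetric] by (simp add: as)
  qed
  have comm: "S (T u) = T (S u) + I (D u)" if "u \<in> Kn c" for u
  proof -
    have "0 = b z (a z u)" using ba[OF that] by simp
    also have "\<dots> = b z (D u) + b z (a x (S u)) + b z (a y (T u))"
      unfolding az[OF that] by (simp add: bs)
    also have "b z (a y (T u)) = - Z (S (T u))"
      unfolding ZS[symmetric] by (rule b_a_swap[OF TK])
    finally have "Z (S (T u)) = Z (T (S u) + I (D u))"
      by (simp add: ZT ZI[of "D u"] Zs' add.commute)
    then have "Zi (Z (S (T u))) = Zi (Z (T (S u) + I (D u)))" by simp
    then show ?thesis by (simp only: Zi(3) SK TK IK Kn_add)
  qed
  have x0: "x \<noteq> 0" using indep[of 1 0 0] by auto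
  have y0: "y \<noteq> 0" using indep[of 0 1 0] by auto
  have xy_indep: "independent_points x y"
    unfolding independent_points_def using indep[of _ _ 0] by auto
  obtain F1 RS where F1: "finite F1" and RS: "\<And>m. m \<notin> F1 \<Longrightarrow> lin (RS m)" "\<And>m u. m \<notin> F1 \<Longrightarrow> RS m u \<in> Kn c"
    "\<And>m u. m \<notin> F1 \<Longrightarrow> u \<in> Kn c \<Longrightarrow> RS m (S u + m \<star> u) = u"
    "\<And>m u. m \<notin> F1 \<Longrightarrow> u \<in> Kn c \<Longrightarrow> S (RS m u) + m \<star> RS m u = u"
    by (rule resolvents_exist[OF lin_S, of c]) (auto simp: SK)
  obtain F2 RT where F2: "finite F2" and RT: "\<And>m. m \<notin> F2 \<Longrightarrow> lin (RT m)" "\<And>m u. m \<notin> F2 \<Longrightarrow> RT m u \<in> Kn c"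
    "\<And>m u. m \<notin> F2 \<Longrightarrow> u \<in> Kn c \<Longrightarrow> RT m (T u + m \<star> u) = u"
    "\<And>m u. m \<notin> F2 \<Longrightarrow> u \<in> Kn c \<Longrightarrow> T (RT m u) + m \<star> RT m u = u"
    by (rule resolvents_exist[OF lin_T, of c]) (auto simp: TK)
  \<comment> \<open>transport around the triangle with vertices \<open>x\<close>, \<open>z + m x + n y\<close>, \<open>y\<close> preserves the form\<close>
  have iso: "q x (e + D (RS m (RT n (I e)))) (e' + D (RS m (RT n (I e')))) = q x e e'"
    if mn: "m \<notin> F1" "n \<notin> F2" and e: "e \<in> E" "e' \<in> E" for m n e e'
  proof -
    \<comment> \<open>The role that \<open>Z\<close> has on the line through \<open>x\<close> and
      \<open>y\<close> is taken by \<open>Z (T + n)\<close> on the side from \<open>x\<close> to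
      \<open>z'\<close> and by \<open>Z (S + m)\<close> on the side from \<open>z'\<close> to
      \<open>y\<close>. This is how the resolvents enter.\<close>
    define z' where "z' = z + m *s x + n *s y"
    have z'x: "independent_points x z'" "independent_points z' y"
      unfolding independent_points_def z'_def
    proof (safe)
      fix s t assume "s *s x + t *s (z + m *s x + n *s y) = 0"
      then have "(s + t * m) *s x + (t * n) *s y + t *s z = 0"
        by (simp add: vec_eq_iff algebra_simps)
      from indep[OF this] show "s = 0" "t = 0" by auto
    next
      fix s t assume "s *s (z + m *s x + n *s y) + t *s y = 0"
      then have "(s * m) *s x + (t + s * n) *s y + s *s z = 0"
        by (simp add: vec_eq_iff algebra_simps)
      from indep[OF this] show "s = 0" "t = 0" by auto
    qed
    have z'0: "z' \<noteq> 0" using z'x(1) unfolding independent_points_def by (metis add.right_neutral vector_smult_lzero vector_smult_rzero zero_neq_one add_0)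
    have by_az': "b y (a z' u) = Z (S u + m \<star> u)" if "u \<in> Kn c" for u
      by (simp add: z'_def a_add a_scale bs ZS Zs' ba that flip: Z_def)
    have bz'_ax: "b z' (a x u) = Z (T u + n \<star> u)" if "u \<in> Kn c" for u
      by (simp add: z'_def b_add b_scale ZT Zs' ba that flip: Z_def)
    \<comment> \<open>To carry a vector along a side, it is changed within the radical at the
      current vertex until the \<open>b\<close> of the next vertex kills it too. The correction
      \<open>r e\<close> does this from \<open>x\<close> to \<open>z'\<close>, and
      \<open>\<rho> e\<close> from \<open>z'\<close> to \<open>y\<close>.\<close>
    define r where "r e = RT n (I e)" for e
    define s where "s e = e - a x (r e)" for e
    define \<rho> where "\<rho> e = RS m (r e)" for e
    have rK: "r e \<in> Kn c" "\<rho> e \<in> Kn c" for e using RT(2) RS(2) mn by (auto simp: r_def \<rho>_def)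
    have s: "s e \<in> Kn N" "b x (s e) = 0" "b z' (s e) = 0" "b y (s e) = - Z (r e)" if "e \<in> E" for e
    proof -
      have e: "e \<in> Kn N" "b x e = 0" "b y e = 0" using that by (auto simp: E_def)
      have "T (r e) + n \<star> r e = I e" unfolding r_def by (rule RT(4)[OF mn(2) IK])
      then have "b z' (a x (r e)) = b z e" using bz'_ax[OF rK(1)] ZI by simp
      moreover have "b z' e = b z e" using e by (simp add: z'_def b_add b_scale)
      ultimately show "b z' (s e) = 0" by (simp add: s_def bs)
      show "s e \<in> Kn N" "b x (s e) = 0" "b y (s e) = - Z (r e)"
        using e by (simp_all add: s_def a_Kn Kn_diff bs ba rK Z_def)
    qed
    have s2: "b z' (s e + a z' (\<rho> e)) = 0" "b y (s e + a z' (\<rho> e)) = 0"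
      "s e + a z' (\<rho> e) = (e + D (\<rho> e)) + a y (T (\<rho> e) + n \<star> \<rho> e)" if "e \<in> E" for e
    proof -
      have r: "S (\<rho> e) + m \<star> \<rho> e = r e" unfolding \<rho>_def by (rule RS(4)[OF mn(1) rK(1)])
      show "b z' (s e + a z' (\<rho> e)) = 0" using s[OF that] by (simp add: bs ba rK)
      show "b y (s e + a z' (\<rho> e)) = 0" using s[OF that] by (simp add: bs by_az' rK r)
      have "a z' (\<rho> e) = D (\<rho> e) + a x (S (\<rho> e) + m \<star> \<rho> e) + a y (T (\<rho> e) + n \<star> \<rho> e)"
        by (simp add: z'_def a_add a_scale az rK as algebra_simps)
      then show "s e + a z' (\<rho> e) = (e + D (\<rho> e)) + a y (T (\<rho> e) + n \<star> \<rho> e)"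
        unfolding r s_def by simp
    qed
    have HE: "e + D (\<rho> e) \<in> Kn N" "b x (e + D (\<rho> e)) = 0" "b y (e + D (\<rho> e)) = 0" if "e \<in> E" for e
      using that DE[of "\<rho> e"] by (auto simp: E_def bs)
    have neg: "s e = e + a x (- r e)" for e by (simp add: s_def as)
    have mrK: "- r e \<in> Kn c" for e using rK(1)[of e] by (auto simp: Kn_def fun_simps)
    have TK': "T (\<rho> e) + n \<star> \<rho> e \<in> Kn c" for e using TK rK by blast
    have "q x e e' = q x (s e) (s e')"
      unfolding neg using e by (intro q_shift[OF x0, symmetric] mrK) (auto simp: E_def)
    also have "\<dots> = q z' (s e) (s e')"
      using s[OF e(1)] s[OF e(2)] by (intro q_const z'x) auto
    also have "\<dots> = q z' (s e + a z' (\<rho> e)) (s e' + a z' (\<rho> e'))"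
      using s[OF e(1)] s[OF e(2)] rK by (intro q_shift[OF z'0, symmetric]) auto
    also have "\<dots> = q y (s e + a z' (\<rho> e)) (s e' + a z' (\<rho> e'))"
      using s2(1,2)[OF e(1)] s2(1,2)[OF e(2)] s(1) e
      by (intro q_const z'x Kn_add a_Kn) auto
    also have "\<dots> = q y (e + D (\<rho> e)) (e' + D (\<rho> e'))"
      unfolding s2(3)[OF e(1)] s2(3)[OF e(2)]
      using HE[OF e(1)] HE[OF e(2)] by (intro q_shift[OF y0] TK') auto
    also have "\<dots> = q x (e + D (\<rho> e)) (e' + D (\<rho> e'))"
      using HE[OF e(1)] HE[OF e(2)] by (intro q_const[OF xy_indep, symmetric]) auto
    finally show ?thesis by (simp add: \<rho>_def r_def)
  qed
  have hol: "q x (D (RS m (RT n (I e)))) e' + q x e (D (RT n (RS m (I e')))) = 0"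
    if mn: "m \<notin> F1" "n \<notin> F2" and e: "e \<in> E" "e' \<in> E" for m n e e'
  proof -
    define \<sigma> where "\<sigma> = RS m (I e')"
    define \<tau> where "\<tau> = RT n \<sigma>"
    \<comment> \<open>\<open>g\<close> is the preimage of \<open>e'\<close> under transport: since
      \<open>(S + m) (T + n) = (T + n) (S + m) + I D\<close>, the inverse of
      \<open>1 + D RS RT I\<close> is \<open>1 - D RT RS I\<close>. Applied to \<open>e\<close> and
      \<open>g\<close>, \<open>iso\<close> becomes the claim.\<close>
    define g where "g = e' - D \<tau>"
    have K: "\<sigma> \<in> Kn c" "\<tau> \<in> Kn c" using RS(2) RT(2) mn by (auto simp: \<sigma>_def \<tau>_def)
    have st: "S \<sigma> + m \<star> \<sigma> = I e'" "T \<tau> + n \<star> \<tau> = \<sigma>"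
      unfolding \<sigma>_def \<tau>_def using RS(4) RT(4) mn IK K by (auto simp: \<sigma>_def)
    have gE: "g \<in> E" using e(2) DE[of \<tau>] by (auto simp: g_def E_def bs)
    let ?w = "S \<tau> + m \<star> \<tau>"
    have "I e' = S (T \<tau> + n \<star> \<tau>) + m \<star> (T \<tau> + n \<star> \<tau>)" unfolding st ..
    then have "I g = T ?w + n \<star> ?w"
      using comm[OF K(2)]
      by (simp add: g_def Is Ss Ts fv.scale_right_distrib fv.scale_left_commute[of m n] algebra_simps)
    then have "RT n (I g) = ?w" using RT(3)[OF mn(2), of ?w] SK K by auto
    then have "RS m (RT n (I g)) = \<tau>" using RS(3)[OF mn(1) K(2)] by simp
    then have "g + D (RS m (RT n (I g))) = e'" by (simp add: g_def)
    with iso[OF mn e(1) gE] have "q x (e + D (RS m (RT n (I e)))) e' = q x e g" by simp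
    moreover have "q x e g = q x e e' - q x e (D \<tau>)" unfolding g_def by (rule linf_diff[OF q_lin(1)])
    ultimately show ?thesis by (simp add: q_adds \<tau>_def \<sigma>_def)
  qed
  have nz: "z - s *s x - t *s y \<noteq> 0" for s t
  proof
    assume "z - s *s x - t *s y = 0"
    then have "(- s) *s x + (- t) *s y + 1 *s z = 0" by (simp add: vec_eq_iff algebra_simps)
    from indep[OF this] show False by simp
  qed
  have minus: "z - s *s x - t *s y = z + (- s) *s x + (- t) *s y" for s t
    by (simp add: vec_eq_iff)
  have "adhm c S T D I E (q x) (F1 \<union> F2) RS RT"
  proof (rule adhm.intro)
    fix u :: "nat \<Rightarrow> 'k" and s t assume u: "u \<in> Kn c" "D u = 0" "S u = s \<star> u" "T u = t \<star> u"
    \<comment> \<open>A common eigenvector killed by \<open>D\<close> is killed by \<open>a\<close>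
      at the point \<open>z - s x - t y\<close>, where \<open>a\<close> is injective.\<close>
    then have "a z u = s \<star> a x u + t \<star> a y u" using az[OF u(1)] by (simp add: as)
    then have "a (z - s *s x - t *s y) u = 0"
      by (simp only: minus a_add a_scale) simp
    then show "u = 0" using a_inj[OF nz u(1)] by blast
  next
    fix \<xi> :: "(nat \<Rightarrow> 'k) \<Rightarrow> 'k" and s t and u :: "nat \<Rightarrow> 'k"
    assume \<xi>: "linf \<xi>" "\<And>e. e \<in> E \<Longrightarrow> \<xi> (I e) = 0" "\<And>u. u \<in> Kn c \<Longrightarrow> \<xi> (S u) = s * \<xi> u"
      "\<And>u. u \<in> Kn c \<Longrightarrow> \<xi> (T u) = t * \<xi> u" and u: "u \<in> Kn c"
    note xs = linf_add[OF \<xi>(1)] linf_diff[OF \<xi>(1)] linf_scale[OF \<xi>(1)] fvk.linear_neg[OF \<xi>(1)] linf_0[OF \<xi>(1)]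
    let ?v = "z - s *s x - t *s y"
    \<comment> \<open>The functional \<open>\<xi>\<close>, composed with \<open>Zi\<close>, vanishes
      on the image of \<open>b\<close> at \<open>?v\<close>. It suffices to check the components of
      \<open>w\<close> in \<open>E\<close>, along \<open>a x\<close> and along \<open>a y\<close>.
      As \<open>b\<close> is onto at \<open>?v\<close>, \<open>\<xi>\<close> vanishes on
      \<open>Kn c\<close>.\<close>
    have zero: "\<xi> (Zi (b ?v w)) = 0" if w: "w \<in> Kn N" for w
    proof -
      have bv: "b ?v w = b z w - s \<star> b x w - t \<star> b y w" for w
        by (simp only: minus b_add b_scale) simp
      have "b z (a y r) = - Z (S r)" if "r \<in> Kn c" for r
        unfolding ZS[symmetric] by (rule b_a_swap[OF that])
      moreover have "b x (a y r) = - Z r" if "r \<in> Kn c" for r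
        unfolding Z_def by (rule b_a_swap[OF that])
      ultimately have 2: "\<xi> (Zi (b ?v (a y r))) = 0" if "r \<in> Kn c" for r
        using that by (simp add: bv ba Zs xs Zi(3) SK \<xi>(3))
      have 1: "\<xi> (Zi (b ?v (a x r))) = 0" if "r \<in> Kn c" for r
        using that by (simp add: bv ba Zs xs Zi(3) TK \<xi>(4) ZT flip: Z_def)
      have "pr w \<in> E" by (rule prE[OF w])
      then have 3: "\<xi> (Zi (b ?v (pr w))) = 0"
        using \<xi>(2)[of "pr w"] by (simp add: bv E_def I_def)
      have "w = pr w + a x (Zi (b y w)) - a y (Zi (b x w))" by (simp add: pr_def)
      then have "b ?v w = b ?v (pr w + a x (Zi (b y w)) - a y (Zi (b x w)))" by (rule arg_cong)
      then show ?thesis using 1[OF ZiK] 2[OF ZiK] 3 by (simp only: bs Zs xs) simp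
    qed
    have "Z u \<in> Kn c" by (simp add: Z_def b_Kn)
    then obtain w where "w \<in> Kn N" "b ?v w = Z u" using b_surj[OF nz] by blast
    then show "\<xi> u = 0" using zero[of w] by (simp add: Zi(3)[OF u])
  next
    fix e assume e: "e \<in> E" "\<And>e'. e' \<in> E \<Longrightarrow> q x e' e = 0"
    have eK: "e \<in> Kn N" "b x e = 0" "b y e = 0" using e(1) by (auto simp: E_def)
    \<comment> \<open>The kernel of \<open>b x\<close> is \<open>E\<close> plus the image of
      \<open>a x\<close>, so being orthogonal to \<open>E\<close> is being orthogonal to the whole
      kernel. The image of \<open>a x\<close> then contains \<open>e\<close>, but it meets
      \<open>E\<close> only in zero because \<open>Z\<close> is injective.\<close>
    have "\<exists>u\<in>Kn c. e = a x u"
    proof (rule q_nondeg[OF x0 eK(1,2)])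
      fix w assume w: "w \<in> Kn N" "b x w = 0"
      have "w = pr w + a x (Zi (b y w))" using w(2) by (simp add: pr_def Zs as)
      then have "q x w e = q x (pr w + a x (Zi (b y w))) e" by (rule arg_cong)
      also have "\<dots> = q x (pr w) e + q x (a x (Zi (b y w))) e" by (rule q_adds)
      also have "\<dots> = 0" using q_rad[OF x0 ZiK eK(1,2)] e(2)[OF prE[OF w(1)]] by simp
      finally show "q x w e = 0" .
    qed
    then obtain u where u: "u \<in> Kn c" "e = a x u" by blast
    then have "u = 0" using xy[OF u(1)] eK(3) by simp
    then show "e = 0" using u(2) by (simp only: as)
  next
    fix m n e e' assume "m \<notin> F1 \<union> F2" "n \<notin> F1 \<union> F2" "e \<in> E" "e' \<in> E"
    then show "q x (D (RS m (RT n (I e)))) e' + q x e (D (RT n (RS m (I e')))) = 0"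
      using hol by blast
  next
    fix e e' assume "e \<in> E" "e' \<in> E"
    then show "q x e e' = q x e' e" using q_sym[OF x0, of e e'] by (simp add: E_def)
  next
    fix u :: "nat \<Rightarrow> 'k" assume "u \<in> Kn c"
    then show "S (T u) = T (S u) + I (D u)" by (rule comm)
  qed (simp_all add: lin_S lin_T lin_D lin_I SK TK DE IK q_lin F1 F2 RS RT)
  then show ?thesis by (rule adhm.even_charge)
qed

end

section \<open>Sections of line bundles on projective space\<close>

text \<open>\<open>F\<close> is the rational function \<open>G / H\<close> up to finitely many
  parameters; the equation is multiplied out so that roots of \<open>H\<close> need no separate
  treatment.\<close>

definition locally_fraction :: "('k::field \<Rightarrow> 'k) \<Rightarrow> 'k poly \<Rightarrow> 'k poly \<Rightarrow> bool" where
  "locally_fraction F G H \<longleftrightarrow> H \<noteq> 0 \<and> finite {t. F t * poly H t \<noteq> poly G t}"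

lemma locally_fraction_unique:
  fixes F :: "'k::field_char_0 \<Rightarrow> 'k"
  assumes "locally_fraction F G H" "locally_fraction F G' H'"
  shows "G * H' = G' * H"
proof (rule poly_eq_cofinite)
  show "finite ({t. F t * poly H t \<noteq> poly G t} \<union> {t. F t * poly H' t \<noteq> poly G' t})"
    using assms by (simp add: locally_fraction_def)
  fix t assume "t \<notin> {t. F t * poly H t \<noteq> poly G t} \<union> {t. F t * poly H' t \<noteq> poly G' t}"
  then have "poly G t = F t * poly H t" "poly G' t = F t * poly H' t" by auto
  then show "poly (G * H') t = poly (G' * H) t" by simp
qed

text \<open>A denominator of least degree has no root: at a root the numerator vanishes as well.\<close>

lemma polynomial_if_locally_rational:
  fixes F :: "'k::{alg_closed_field, field_char_0} \<Rightarrow> 'k"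
  assumes loc: "\<And>t. \<exists>G H. locally_fraction F G H \<and> poly H t \<noteq> 0 \<and> F t * poly H t = poly G t"
  shows "\<exists>p. \<forall>t. F t = poly p t"
proof -
  let ?P = "\<lambda>n. \<exists>G H. locally_fraction F G H \<and> degree H = n"
  have "\<exists>n. ?P n" using loc[of 0] by blast
  then obtain n where n: "?P n" "\<And>m. m < n \<Longrightarrow> \<not> ?P m" using exists_least_iff[of ?P] by metis
  then obtain G H where GH: "locally_fraction F G H" "degree H = n" by blast
  have "n = 0"
  proof (rule ccontr)
    assume "n \<noteq> 0"
    then obtain t where t: "poly H t = 0" using alg_closed_imp_poly_has_root[of H] GH by auto
    obtain G' H' where G': "locally_fraction F G' H'" "poly H' t \<noteq> 0" using loc by blast
    have "poly (G * H') t = poly (G' * H) t" using locally_fraction_unique[OF GH(1) G'(1)] by simp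
    then have "poly G t = 0" using t G'(2) by simp
    then obtain G1 H1 where 1: "G = [:- t, 1:] * G1" "H = [:- t, 1:] * H1"
      using t unfolding poly_eq_0_iff_dvd by (auto elim!: dvdE)
    have H1: "H1 \<noteq> 0" using GH(1) 1 by (auto simp: locally_fraction_def)
    have "{s. F s * poly H1 s \<noteq> poly G1 s} \<subseteq> insert t {s. F s * poly H s \<noteq> poly G s}"
    proof
      fix s assume "s \<in> {s. F s * poly H1 s \<noteq> poly G1 s}"
      moreover have "poly G s = (s - t) * poly G1 s" "poly H s = (s - t) * poly H1 s"
        by (simp_all add: 1 algebra_simps)
      ultimately show "s \<in> insert t {s. F s * poly H s \<noteq> poly G s}" by auto
    qed
    then have "locally_fraction F G1 H1"
      using GH(1) H1 unfolding locally_fraction_def by (auto intro: finite_subset)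
    moreover have "degree H = Suc (degree H1)"
      using 1 H1 degree_mult_eq[of "[:- t, 1:]" H1] by simp
    then have "degree H1 < n" using GH(2) by simp
    ultimately show False using n(2) by blast
  qed
  then obtain h where h: "H = [:h:]" using GH(2) degree_eq_zeroE by blast
  have h0: "h \<noteq> 0" using GH(1) h by (auto simp: locally_fraction_def)
  \<comment> \<open>\<open>locally_fraction\<close> controls \<open>F\<close> only off a finite set.
    The fraction that is valid at \<open>t\<close> itself extends the equation to every
    \<open>t\<close>.\<close>
  have "F t = poly (Polynomial.smult (inverse h) G) t" for t
  proof -
    obtain G' H' where G': "locally_fraction F G' H'" "poly H' t \<noteq> 0" "F t * poly H' t = poly G' t"
      using loc by blast
    have "poly (G * H') t = poly (G' * H) t" using locally_fraction_unique[OF GH(1) G'(1)] by simp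
    then have "poly G t * poly H' t = F t * poly H' t * h" using h G'(3) by simp
    then have "poly G t = F t * h" using G'(2) by simp
    then show ?thesis using h0 by simp
  qed
  then show ?thesis by blast
qed

section \<open>Homogeneous polynomials\<close>

lemma finite_monomials: "finite {m :: 'n::finite \<Rightarrow> nat. (\<Sum>i\<in>UNIV. m i) = d}"
proof (rule finite_subset)
  show "{m :: 'n \<Rightarrow> nat. (\<Sum>i\<in>UNIV. m i) = d} \<subseteq>
      {m. \<forall>x. (x \<in> UNIV \<longrightarrow> m x \<in> {..d}) \<and> (x \<notin> UNIV \<longrightarrow> m x = 0)}"
    by (auto intro!: member_le_sum)
  show "finite {m :: 'n \<Rightarrow> nat. \<forall>x. (x \<in> UNIV \<longrightarrow> m x \<in> {..d}) \<and> (x \<notin> UNIV \<longrightarrow> m x = 0)}"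
    by (intro finite_set_of_finite_funs) auto
qed

lemma hom_polyI:
  "(\<And>v. f v = (\<Sum>m | (\<Sum>i\<in>UNIV. m i) = d. c m * (\<Prod>i\<in>UNIV. (v $ i) ^ m i))) \<Longrightarrow> f \<in> hom_poly d"
  unfolding hom_poly_def by blast

lemma hom_polyE:
  assumes "f \<in> hom_poly d"
  obtains c where "\<And>v. f v = (\<Sum>m | (\<Sum>i\<in>UNIV. m i) = d. c m * (\<Prod>i\<in>UNIV. (v $ i) ^ m i))"
  using assms unfolding hom_poly_def by blast

lemma hom_poly_scale:
  fixes f :: "'k::field ^ 'n::finite \<Rightarrow> 'k"
  assumes "f \<in> hom_poly d"
  shows "f (x *s v) = x ^ d * f v"
proof -
  obtain c where c: "\<And>v. f v = (\<Sum>m | (\<Sum>i\<in>UNIV. m i) = d. c m * (\<Prod>i\<in>UNIV. (v $ i) ^ m i))"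
    using assms by (rule hom_polyE) blast
  show ?thesis
    unfolding c sum_distrib_left
    by (rule sum.cong) (auto simp: power_mult_distrib prod.distrib simp flip: power_sum)
qed

lemma hom_poly_add:
  assumes "f \<in> hom_poly d" "g \<in> hom_poly d"
  shows "(\<lambda>v. f v + g v) \<in> hom_poly d"
proof -
  obtain c where c: "\<And>v. f v = (\<Sum>m | (\<Sum>i\<in>UNIV. m i) = d. c m * (\<Prod>i\<in>UNIV. (v $ i) ^ m i))"
    using assms(1) by (rule hom_polyE) blast
  obtain c' where c': "\<And>v. g v = (\<Sum>m | (\<Sum>i\<in>UNIV. m i) = d. c' m * (\<Prod>i\<in>UNIV. (v $ i) ^ m i))"
    using assms(2) by (rule hom_polyE) blast
  show ?thesis
    by (rule hom_polyI[where c = "\<lambda>m. c m + c' m"])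
      (simp add: c c' sum.distrib algebra_simps)
qed

lemma hom_poly_mult:
  fixes f g :: "'k::field ^ 'n::finite \<Rightarrow> 'k"
  assumes "f \<in> hom_poly d" "g \<in> hom_poly e"
  shows "(\<lambda>v. f v * g v) \<in> hom_poly (d + e)"
proof -
  let ?M = "\<lambda>d. {m :: 'n \<Rightarrow> nat. (\<Sum>i\<in>UNIV. m i) = d}"
  obtain c where c: "\<And>v. f v = (\<Sum>m | (\<Sum>i\<in>UNIV. m i) = d. c m * (\<Prod>i\<in>UNIV. (v $ i) ^ m i))"
    using assms(1) by (rule hom_polyE) blast
  obtain c' where c': "\<And>v. g v = (\<Sum>m | (\<Sum>i\<in>UNIV. m i) = e. c' m * (\<Prod>i\<in>UNIV. (v $ i) ^ m i))"
    using assms(2) by (rule hom_polyE) blast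
  let ?S = "?M d \<times> ?M e" and ?p = "\<lambda>(m, m') i. m i + m' i :: nat"
  show ?thesis
  proof (rule hom_polyI[where c = "\<lambda>k. \<Sum>x | x \<in> ?S \<and> ?p x = k. c (fst x) * c' (snd x)"])
    fix v :: "'k ^ 'n"
    let ?X = "\<lambda>m. \<Prod>i\<in>UNIV. (v $ i) ^ m i"
    have "f v * g v = (\<Sum>x\<in>?S. c (fst x) * c' (snd x) * ?X (?p x))"
      unfolding c c' sum_product sum.cartesian_product
      by (rule sum.cong) (auto simp: power_add prod.distrib algebra_simps)
    also have "\<dots> = (\<Sum>k\<in>?M (d + e). \<Sum>x | x \<in> ?S \<and> ?p x = k. c (fst x) * c' (snd x) * ?X (?p x))"
      by (rule sum.group[symmetric]) (auto simp: finite_monomials sum.distrib)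
    also have "\<dots> = (\<Sum>k\<in>?M (d + e). (\<Sum>x | x \<in> ?S \<and> ?p x = k. c (fst x) * c' (snd x)) * ?X k)"
      by (simp add: sum_distrib_right)
    finally show "f v * g v = \<dots>" .
  qed
qed

lemma hom_poly_const: "(\<lambda>v :: 'k::field ^ 'n::finite. x) \<in> hom_poly 0"
proof (rule hom_polyI[where c = "\<lambda>_. x"])
  have "{m :: 'n \<Rightarrow> nat. (\<Sum>i\<in>UNIV. m i) = 0} = {\<lambda>_. 0}" by auto
  then show "x = (\<Sum>m | (\<Sum>i\<in>UNIV. m i) = 0. x * (\<Prod>i\<in>UNIV. (v $ i) ^ m i))" for v :: "'k ^ 'n" by simp
qed

lemma hom_poly_coord: "(\<lambda>v :: 'k::field ^ 'n::finite. v $ i) \<in> hom_poly 1"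
proof (rule hom_polyI[where c = "\<lambda>m. if m = (\<lambda>j. if j = i then 1 else 0) then 1 else 0"])
  fix v :: "'k ^ 'n"
  let ?e = "\<lambda>j. if j = i then 1 else 0 :: nat"
  have "(\<Prod>j\<in>UNIV. (v $ j) ^ ?e j) = (\<Prod>j\<in>UNIV. if j = i then v $ j else 1)"
    by (rule prod.cong) auto
  then have "(\<Prod>j\<in>UNIV. (v $ j) ^ ?e j) = v $ i" by simp
  moreover have "(\<Sum>m | (\<Sum>i\<in>UNIV. m i) = 1. (if m = ?e then 1 else 0) * (\<Prod>i\<in>UNIV. (v $ i) ^ m i)) =
      (\<Sum>m\<in>{?e}. \<Prod>j\<in>UNIV. (v $ j) ^ m j)"
    by (rule sum.mono_neutral_cong_right) (auto simp: finite_monomials)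
  ultimately show "v $ i = (\<Sum>m | (\<Sum>i\<in>UNIV. m i) = 1. (if m = ?e then 1 else 0) * (\<Prod>i\<in>UNIV. (v $ i) ^ m i))"
    by simp
qed

lemma hom_poly_line:
  fixes f :: "'k::field ^ 'n::finite \<Rightarrow> 'k"
  assumes "f \<in> hom_poly d"
  obtains p where "\<And>t. f (v + t *s w) = poly p t"
proof -
  obtain c where c: "\<And>v. f v = (\<Sum>m | (\<Sum>i\<in>UNIV. m i) = d. c m * (\<Prod>i\<in>UNIV. (v $ i) ^ m i))"
    using assms by (rule hom_polyE) blast
  have "f (v + t *s w) = poly (\<Sum>m | (\<Sum>i\<in>UNIV. m i) = d.
      Polynomial.smult (c m) (\<Prod>i\<in>UNIV. [:v $ i, w $ i:] ^ m i)) t" for t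
    by (simp add: c poly_sum poly_prod)
  then show ?thesis by (rule that)
qed

section \<open>The Zariski topology on the punctured cone\<close>

definition basic_open :: "('k::field ^ 'n \<Rightarrow> 'k) \<Rightarrow> ('k ^ 'n) set" where
  "basic_open f = {v \<in> proj_space. f v \<noteq> 0}"

lemma zariski_open_basic:
  assumes "f \<in> hom_poly d"
  shows "zariski_open (basic_open f)"
  unfolding zariski_open_def basic_open_def using assms by (intro exI[of _ "{f}"]) auto

lemma zariski_open_basis:
  assumes "zariski_open W" "v \<in> W"
  obtains d f where "f \<in> hom_poly d" "f v \<noteq> 0" "basic_open f \<subseteq> W"
  using assms unfolding zariski_open_def basic_open_def by blast

lemma zariski_open_proj: "zariski_open (proj_space :: ('k::field ^ 'n::finite) set)"
  using zariski_open_basic[OF hom_poly_const[of 1]] by (simp add: basic_open_def)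

lemma zariski_open_subset: "zariski_open W \<Longrightarrow> W \<subseteq> proj_space"
  unfolding zariski_open_def by blast

lemma zariski_open_Int:
  fixes V W :: "('k::field ^ 'n::finite) set"
  assumes "zariski_open V" "zariski_open W"
  shows "zariski_open (V \<inter> W)"
proof -
  obtain S where S: "S \<subseteq> (\<Union>d. hom_poly d)" "V = {v \<in> proj_space. \<exists>f\<in>S. f v \<noteq> 0}"
    using assms(1) unfolding zariski_open_def by blast
  obtain T where T: "T \<subseteq> (\<Union>d. hom_poly d)" "W = {v \<in> proj_space. \<exists>f\<in>T. f v \<noteq> 0}"
    using assms(2) unfolding zariski_open_def by blast
  let ?ST = "(\<lambda>p v. fst p v * snd p v) ` (S \<times> T)"
  have "?ST \<subseteq> (\<Union>d. hom_poly d)"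
  proof (rule image_subsetI)
    fix p assume "p \<in> S \<times> T"
    then have "fst p \<in> S" "snd p \<in> T" by auto
    then have "fst p \<in> (\<Union>d. hom_poly d)" "snd p \<in> (\<Union>d. hom_poly d)" using S(1) T(1) by (auto del: UN_iff)
    then obtain d e where "fst p \<in> hom_poly d" "snd p \<in> hom_poly e" by (elim UN_E)
    then have "(\<lambda>v. fst p v * snd p v) \<in> hom_poly (d + e)" by (rule hom_poly_mult)
    then show "(\<lambda>v. fst p v * snd p v) \<in> (\<Union>d. hom_poly d)" by (rule UN_I[OF UNIV_I])
  qed
  moreover have "(\<exists>f\<in>?ST. f v \<noteq> 0) \<longleftrightarrow> (\<exists>f\<in>S. f v \<noteq> 0) \<and> (\<exists>f\<in>T. f v \<noteq> 0)" for v
    by (auto simp: bex_simps(7))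
  then have "V \<inter> W = {v \<in> proj_space. \<exists>f\<in>?ST. f v \<noteq> 0}"
    using S(2) T(2) by (simp only:) blast
  ultimately show ?thesis unfolding zariski_open_def by (intro exI[of _ ?ST] conjI)
qed

lemma opens_proj: "opens (proj_space :: ('k::field ^ 'n) set) = Collect zariski_open"
proof -
  have "proj_space \<inter> W = W" if "zariski_open W" for W :: "('k ^ 'n) set"
    using zariski_open_subset[OF that] by blast
  then show ?thesis unfolding opens_def by (auto intro: exI[where x = W for W])
qed

lemma opens_open:
  fixes U :: "('k::field ^ 'n::finite) set"
  assumes "zariski_open U"
  shows "V \<in> opens U \<longleftrightarrow> zariski_open V \<and> V \<subseteq> U"
  unfolding opens_def using assms zariski_open_Int by auto

lemma zariski_open_conic:
  fixes v :: "'k::field ^ 'n::finite"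
  assumes "zariski_open W" "v \<in> W" "x \<noteq> 0"
  shows "x *s v \<in> W"
proof -
  obtain d f where f: "f \<in> hom_poly d" "f v \<noteq> 0" "basic_open f \<subseteq> W"
    using zariski_open_basis assms by blast
  then have "f (x *s v) \<noteq> 0" using hom_poly_scale[OF f(1)] assms(3) by simp
  moreover have "x *s v \<noteq> 0"
    using zariski_open_subset[OF assms(1)] assms(2,3) by (auto simp: proj_space_def)
  ultimately show ?thesis using f(3) by (auto simp: basic_open_def proj_space_def)
qed

lemma zariski_open_line:
  fixes v w :: "'k::field ^ 'n::finite"
  assumes W: "zariski_open W" "v \<in> W" and nz: "\<And>t. v + t *s w \<noteq> 0"
  obtains p where "poly p 0 \<noteq> 0" "\<And>t. poly p t \<noteq> 0 \<Longrightarrow> v + t *s w \<in> W"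
proof -
  obtain d f where f: "f \<in> hom_poly d" "f v \<noteq> 0" "basic_open f \<subseteq> W"
    using zariski_open_basis W by blast
  obtain p where p: "\<And>t. f (v + t *s w) = poly p t"
    using hom_poly_line[OF f(1)] by blast
  have "poly p 0 \<noteq> 0" using p[of 0] f(2) by simp
  moreover have "v + t *s w \<in> W" if "poly p t \<noteq> 0" for t
    using that p[of t] f(3) nz by (auto simp: basic_open_def proj_space_def)
  ultimately show ?thesis using that by blast
qed

section \<open>Sections of the twists of the structure sheaf\<close>

lemma tw_off: "s \<in> twist_sections d U \<Longrightarrow> v \<notin> U \<Longrightarrow> s v = 0"
  by (simp add: twist_sections_def)

lemma twE:
  assumes "s \<in> twist_sections d U" "v \<in> U"
  obtains W e e' g h where "g \<in> hom_poly e" "h \<in> hom_poly e'" "zariski_open W" "v \<in> W" "int e - int e' = d"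
    "\<And>w. w \<in> U \<inter> W \<Longrightarrow> h w \<noteq> 0" "\<And>w. w \<in> U \<inter> W \<Longrightarrow> s w = g w / h w"
  using assms unfolding twist_sections_def by blast

lemma twI:
  assumes "\<And>v. v \<notin> U \<Longrightarrow> s v = 0"
    and "\<And>v. v \<in> U \<Longrightarrow> \<exists>W e e' g h. g \<in> hom_poly e \<and> h \<in> hom_poly e' \<and> zariski_open W \<and> v \<in> W \<and>
      int e - int e' = d \<and> (\<forall>w\<in>U \<inter> W. h w \<noteq> 0 \<and> s w = g w / h w)"
  shows "s \<in> twist_sections d U"
  using assms unfolding twist_sections_def by blast

lemma tw_witness:
  "\<lbrakk>g \<in> hom_poly e; h \<in> hom_poly e'; zariski_open W; v \<in> W; int e - int e' = d;
    \<And>w. w \<in> U \<inter> W \<Longrightarrow> h w \<noteq> 0; \<And>w. w \<in> U \<inter> W \<Longrightarrow> s w = g w / h w\<rbrakk> \<Longrightarrow>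
    \<exists>W e e' g h. g \<in> hom_poly e \<and> h \<in> hom_poly e' \<and> zariski_open W \<and> v \<in> W \<and>
      int e - int e' = d \<and> (\<forall>w\<in>U \<inter> W. h w \<noteq> 0 \<and> s w = g w / h w)"
  by blast

lemma tw_local:
  fixes U :: "('k::field ^ 'n::finite) set"
  assumes "\<And>v. v \<notin> U \<Longrightarrow> s v = 0"
    and loc: "\<And>v. v \<in> U \<Longrightarrow> \<exists>W t. zariski_open W \<and> v \<in> W \<and> t \<in> twist_sections d (U \<inter> W) \<and>
      (\<forall>w\<in>U \<inter> W. s w = t w)"
  shows "s \<in> twist_sections d U"
proof (rule twI)
  fix v assume v: "v \<in> U"
  obtain W t where W: "zariski_open W" "v \<in> W" "t \<in> twist_sections d (U \<inter> W)" "\<forall>w\<in>U \<inter> W. s w = t w"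
    using loc[OF v] by blast
  have vW: "v \<in> U \<inter> W" using v W(2) by blast
  obtain W' e e' g h where W': "g \<in> hom_poly e" "h \<in> hom_poly e'" "zariski_open W'" "v \<in> W'" "int e - int e' = d"
    "\<And>w. w \<in> (U \<inter> W) \<inter> W' \<Longrightarrow> h w \<noteq> 0" "\<And>w. w \<in> (U \<inter> W) \<inter> W' \<Longrightarrow> t w = g w / h w"
    by (rule twE[OF W(3) vW]) (rule that)
  show "\<exists>W e e' g h. g \<in> hom_poly e \<and> h \<in> hom_poly e' \<and> zariski_open W \<and> v \<in> W \<and>
      int e - int e' = d \<and> (\<forall>w\<in>U \<inter> W. h w \<noteq> 0 \<and> s w = g w / h w)"
    by (rule tw_witness[OF W'(1,2) zariski_open_Int[OF W(1) W'(3)] _ W'(5)]) (use W W' in auto)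
qed (use assms(1) in auto)

lemma tw_cut:
  assumes "s \<in> twist_sections d U" "V \<subseteq> U"
  shows "cut V s \<in> twist_sections d V"
proof (rule twI)
  fix v assume "v \<in> V"
  then have vU: "v \<in> U" using assms(2) by blast
  obtain W e e' g h where *: "g \<in> hom_poly e" "h \<in> hom_poly e'" "zariski_open W" "v \<in> W"
    "int e - int e' = d" "\<And>w. w \<in> U \<inter> W \<Longrightarrow> h w \<noteq> 0" "\<And>w. w \<in> U \<inter> W \<Longrightarrow> s w = g w / h w"
    by (rule twE[OF assms(1) vU]) (rule that)
  show "\<exists>W e e' g h. g \<in> hom_poly e \<and> h \<in> hom_poly e' \<and> zariski_open W \<and> v \<in> W \<and>
      int e - int e' = d \<and> (\<forall>w\<in>V \<inter> W. h w \<noteq> 0 \<and> cut V s w = g w / h w)"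
    by (rule tw_witness[OF *(1-5)]) (use *(6,7) assms(2) in \<open>auto simp: cut_def\<close>)
qed (simp add: cut_def)

lemma tw_hom:
  fixes U :: "('k::field ^ 'n::finite) set"
  assumes "f \<in> hom_poly e" "U \<subseteq> proj_space"
  shows "cut U f \<in> twist_sections (int e) U"
proof (rule twI)
  fix v assume "v \<in> U"
  then show "\<exists>W e' e'' g h. g \<in> hom_poly e' \<and> h \<in> hom_poly e'' \<and> zariski_open W \<and> v \<in> W \<and>
      int e' - int e'' = int e \<and> (\<forall>w\<in>U \<inter> W. h w \<noteq> 0 \<and> cut U f w = g w / h w)"
    by (intro tw_witness[OF assms(1) hom_poly_const[of 1] zariski_open_proj]) (use assms(2) in \<open>auto simp: cut_def\<close>)
qed (simp add: cut_def)

lemma tw_const: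
  "U \<subseteq> proj_space \<Longrightarrow> cut U (\<lambda>_ :: 'k::field ^ 'n::finite. x) \<in> twist_sections 0 U"
  using tw_hom[OF hom_poly_const] by simp

lemma tw_zero:
  "U \<subseteq> proj_space \<Longrightarrow> (\<lambda>_ :: 'k::field ^ 'n::finite. 0) \<in> twist_sections d U"
proof (rule twI)
  fix v :: "'k ^ 'n" assume v: "U \<subseteq> proj_space" "v \<in> U"
  then have "v \<noteq> 0" by (auto simp: proj_space_def)
  then obtain i where i: "v $ i \<noteq> 0" by (auto simp: Finite_Cartesian_Product.vec_eq_iff)
  have pw: "(\<lambda>v :: 'k ^ 'n. (v $ i) ^ k) \<in> hom_poly k" for k
  proof (induction k)
    case 0
    show ?case using hom_poly_const[of 1] by simp
  next
    case (Suc k)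
    then show ?case using hom_poly_mult[OF hom_poly_coord[of i] Suc] by simp
  qed
  have z: "(\<lambda>v :: 'k ^ 'n. 0) \<in> hom_poly k" for k
    by (rule hom_polyI[where c = "\<lambda>_. 0"]) simp
  show "\<exists>W e e' g h. g \<in> hom_poly e \<and> h \<in> hom_poly e' \<and> zariski_open W \<and> v \<in> W \<and>
      int e - int e' = d \<and> (\<forall>w\<in>U \<inter> W. h w \<noteq> 0 \<and> 0 = g w / h w)"
    \<comment> \<open>Even the zero section has to be displayed as a fraction of degree
      \<open>d\<close>. One of \<open>nat d\<close> and \<open>nat (- d)\<close> is zero, so these
      two exponents cover both signs.\<close>
    by (rule tw_witness[OF z[of "nat d"] pw[of "nat (- d)"] zariski_open_basic[OF hom_poly_coord[of i]]])
      (use i v in \<open>auto simp: basic_open_def\<close>)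
qed simp

lemma tw_add:
  fixes U :: "('k::field ^ 'n::finite) set"
  assumes "s \<in> twist_sections d U" "t \<in> twist_sections d U"
  shows "(\<lambda>v. s v + t v) \<in> twist_sections d U"
proof (rule twI)
  fix v assume v: "v \<in> U"
  obtain W e e' g h where 1: "g \<in> hom_poly e" "h \<in> hom_poly e'" "zariski_open W" "v \<in> W" "int e - int e' = d"
    "\<And>w. w \<in> U \<inter> W \<Longrightarrow> h w \<noteq> 0" "\<And>w. w \<in> U \<inter> W \<Longrightarrow> s w = g w / h w"
    by (rule twE[OF assms(1) v]) (rule that)
  obtain W2 f f' g2 h2 where 2: "g2 \<in> hom_poly f" "h2 \<in> hom_poly f'" "zariski_open W2" "v \<in> W2" "int f - int f' = d"
    "\<And>w. w \<in> U \<inter> W2 \<Longrightarrow> h2 w \<noteq> 0" "\<And>w. w \<in> U \<inter> W2 \<Longrightarrow> t w = g2 w / h2 w"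
    by (rule twE[OF assms(2) v]) (rule that)
  have ef: "e + f' = f + e'" using 1(5) 2(5) by linarith
  have "(\<lambda>v. g v * h2 v + g2 v * h v) \<in> hom_poly (e + f')"
    using hom_poly_add[OF hom_poly_mult[OF 1(1) 2(2)]] hom_poly_mult[OF 2(1) 1(2)] ef by metis
  moreover have "(\<lambda>v. h v * h2 v) \<in> hom_poly (e' + f')" by (rule hom_poly_mult[OF 1(2) 2(2)])
  moreover have "zariski_open (W \<inter> W2)" by (rule zariski_open_Int[OF 1(3) 2(3)])
  ultimately show "\<exists>W e e' g h. g \<in> hom_poly e \<and> h \<in> hom_poly e' \<and> zariski_open W \<and> v \<in> W \<and>
      int e - int e' = d \<and> (\<forall>w\<in>U \<inter> W. h w \<noteq> 0 \<and> s w + t w = g w / h w)"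
    by (rule tw_witness) (use 1(4-7) 2(4-7) in \<open>auto simp: add_frac_eq\<close>)
qed (use assms in \<open>auto simp: tw_off\<close>)

lemma tw_mult:
  fixes U :: "('k::field ^ 'n::finite) set"
  assumes "s \<in> twist_sections d U" "t \<in> twist_sections d' U"
  shows "(\<lambda>v. s v * t v) \<in> twist_sections (d + d') U"
proof (rule twI)
  fix v assume v: "v \<in> U"
  obtain W e e' g h where 1: "g \<in> hom_poly e" "h \<in> hom_poly e'" "zariski_open W" "v \<in> W" "int e - int e' = d"
    "\<And>w. w \<in> U \<inter> W \<Longrightarrow> h w \<noteq> 0" "\<And>w. w \<in> U \<inter> W \<Longrightarrow> s w = g w / h w"
    by (rule twE[OF assms(1) v]) (rule that)
  obtain W2 f f' g2 h2 where 2: "g2 \<in> hom_poly f" "h2 \<in> hom_poly f'" "zariski_open W2" "v \<in> W2" "int f - int f' = d'"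
    "\<And>w. w \<in> U \<inter> W2 \<Longrightarrow> h2 w \<noteq> 0" "\<And>w. w \<in> U \<inter> W2 \<Longrightarrow> t w = g2 w / h2 w"
    by (rule twE[OF assms(2) v]) (rule that)
  show "\<exists>W e e' g h. g \<in> hom_poly e \<and> h \<in> hom_poly e' \<and> zariski_open W \<and> v \<in> W \<and>
      int e - int e' = d + d' \<and> (\<forall>w\<in>U \<inter> W. h w \<noteq> 0 \<and> s w * t w = g w / h w)"
    by (rule tw_witness[OF hom_poly_mult[OF 1(1) 2(1)] hom_poly_mult[OF 1(2) 2(2)] zariski_open_Int[OF 1(3) 2(3)]])
      (use 1(4-7) 2(4-7) in auto)
qed (use assms in \<open>auto simp: tw_off\<close>)

lemma tw_inverse:
  fixes U :: "('k::field ^ 'n::finite) set"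
  assumes "s \<in> twist_sections d U" "\<And>v. v \<in> U \<Longrightarrow> s v \<noteq> 0"
  shows "(\<lambda>v. inverse (s v)) \<in> twist_sections (- d) U"
proof (rule twI)
  fix v assume v: "v \<in> U"
  obtain W e e' g h where 1: "g \<in> hom_poly e" "h \<in> hom_poly e'" "zariski_open W" "v \<in> W" "int e - int e' = d"
    "\<And>w. w \<in> U \<inter> W \<Longrightarrow> h w \<noteq> 0" "\<And>w. w \<in> U \<inter> W \<Longrightarrow> s w = g w / h w"
    by (rule twE[OF assms(1) v]) (rule that)
  have "\<And>w. w \<in> U \<inter> W \<Longrightarrow> g w \<noteq> 0" using 1(6,7) assms(2) by fastforce
  then show "\<exists>W e e' g h. g \<in> hom_poly e \<and> h \<in> hom_poly e' \<and> zariski_open W \<and> v \<in> W \<and>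
      int e - int e' = - d \<and> (\<forall>w\<in>U \<inter> W. h w \<noteq> 0 \<and> inverse (s w) = g w / h w)"
    by (intro tw_witness[OF 1(2,1,3,4)]) (use 1(5,7) in auto)
qed (use assms in \<open>auto simp: tw_off\<close>)

text \<open>Writing the twist as a difference of natural numbers \<open>k\<close> and
  \<open>l\<close> keeps the homogeneity law free of negative powers.\<close>

lemma tw_scale:
  fixes U :: "('k::field ^ 'n::finite) set"
  assumes s: "s \<in> twist_sections (int k - int l) U" and v: "v \<in> U" "x *s v \<in> U" and x: "x \<noteq> 0"
  shows "x ^ l * s (x *s v) = x ^ k * s v"
proof -
  obtain W e e' g h where 1: "g \<in> hom_poly e" "h \<in> hom_poly e'" "zariski_open W" "v \<in> W" "int e - int e' = int k - int l"
    "\<And>w. w \<in> U \<inter> W \<Longrightarrow> h w \<noteq> 0" "\<And>w. w \<in> U \<inter> W \<Longrightarrow> s w = g w / h w"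
    by (rule twE[OF s v(1)]) (rule that)
  have xv: "x *s v \<in> U \<inter> W" using zariski_open_conic[OF 1(3,4) x] v(2) by blast
  have "s (x *s v) = x ^ e * g v / (x ^ e' * h v)"
    using 1(7)[OF xv] by (simp add: hom_poly_scale[OF 1(1)] hom_poly_scale[OF 1(2)])
  moreover have "l + e = k + e'" using 1(5) by linarith
  then have "x ^ l * x ^ e = x ^ k * x ^ e'" by (metis power_add)
  then have "x ^ l * (x ^ e * g v / (x ^ e' * h v)) = x ^ k * (g v / h v)"
    using x by (simp add: field_simps)
  moreover have "s v = g v / h v" using 1(4,7) v(1) by blast
  ultimately show ?thesis by simp
qed

section \<open>Sections along a projective line\<close>

lemma tw_line_polynomial:
  fixes v w :: "'k::{alg_closed_field, field_char_0} ^ 'n::finite"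
  assumes s: "s \<in> twist_sections d U" and U: "\<And>t. v + t *s w \<in> U" and nz: "\<And>t. v + t *s w \<noteq> 0"
  shows "\<exists>p. \<forall>t. s (v + t *s w) = poly p t"
proof (rule polynomial_if_locally_rational)
  fix t
  obtain W e e' g h where 1: "g \<in> hom_poly e" "h \<in> hom_poly e'" "zariski_open W" "v + t *s w \<in> W" "int e - int e' = d"
    "\<And>w. w \<in> U \<inter> W \<Longrightarrow> h w \<noteq> 0" "\<And>w. w \<in> U \<inter> W \<Longrightarrow> s w = g w / h w"
    by (rule twE[OF s U[of t]]) (rule that)
  obtain G where G: "\<And>t. g (v + t *s w) = poly G t" using hom_poly_line[OF 1(1)] by blast
  obtain H where H: "\<And>t. h (v + t *s w) = poly H t" using hom_poly_line[OF 1(2)] by blast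
  obtain d f where f: "f \<in> hom_poly d" "f (v + t *s w) \<noteq> 0" "basic_open f \<subseteq> W"
    using zariski_open_basis[OF 1(3,4)] by blast
  obtain P where P: "\<And>t. f (v + t *s w) = poly P t" using hom_poly_line[OF f(1)] by blast
  have "poly P t \<noteq> 0" using f(2) P by simp
  then have "P \<noteq> 0" by auto
  have eq: "poly H r \<noteq> 0 \<and> s (v + r *s w) * poly H r = poly G r" if "poly P r \<noteq> 0" for r
  proof -
    have "v + r *s w \<in> U \<inter> W"
      using that P[of r] f(3) nz[of r] U[of r] by (auto simp: basic_open_def proj_space_def)
    from 1(6)[OF this] 1(7)[OF this] show ?thesis using G[of r] H[of r] by simp
  qed
  have "{r. s (v + r *s w) * poly H r \<noteq> poly G r} \<subseteq> {r. poly P r = 0}" using eq by blast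
  then have "finite {r. s (v + r *s w) * poly H r \<noteq> poly G r}"
    using poly_roots_finite[OF \<open>P \<noteq> 0\<close>] finite_subset by blast
  moreover have "H \<noteq> 0" using eq[of t] \<open>poly P t \<noteq> 0\<close> by auto
  ultimately show "\<exists>G H. locally_fraction (\<lambda>t. s (v + t *s w)) G H \<and> poly H t \<noteq> 0 \<and>
      s (v + t *s w) * poly H t = poly G t"
    using eq[of t] \<open>poly P t \<noteq> 0\<close> unfolding locally_fraction_def by blast
qed

text \<open>Exchanging the two charts of the line bounds the degree.\<close>

lemma tw_line_degree:
  fixes v w :: "'k::{alg_closed_field, field_char_0} ^ 'n::finite"
  assumes s: "s \<in> twist_sections (int k - int l) U"
    and U: "\<And>x y. x *s v + y *s w \<noteq> 0 \<Longrightarrow> x *s v + y *s w \<in> U" and ind: "independent_points v w"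
  obtains p where "\<And>t. s (v + t *s w) = poly p t" "p = 0 \<or> degree p + l \<le> k"
proof -
  have nz: "v + t *s w \<noteq> 0" "w + t *s v \<noteq> 0" for t
  proof -
    have "1 *s v + t *s w \<noteq> 0" using ind unfolding independent_points_def by (metis zero_neq_one)
    moreover have "t *s v + 1 *s w \<noteq> 0" using ind unfolding independent_points_def by (metis zero_neq_one)
    ultimately show "v + t *s w \<noteq> 0" "w + t *s v \<noteq> 0" by (simp_all add: add.commute)
  qed
  have inU: "v + t *s w \<in> U" "w + t *s v \<in> U" for t
    using U[of 1 t] U[of t 1] nz[of t] by (simp_all add: add.commute)
  obtain p where p: "\<And>t. s (v + t *s w) = poly p t"
    using tw_line_polynomial[OF s inU(1) nz(1)] by blast
  obtain q where q: "\<And>t. s (w + t *s v) = poly q t"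
    using tw_line_polynomial[OF s inU(2) nz(2)] by blast
  \<comment> \<open>The two charts give \<open>t^l p(t) = t^k q(1/t)\<close>. Multiplication by
    \<open>t^(degree q)\<close> makes the right side a polynomial, whose degree bounds that of
    \<open>p\<close>.\<close>
  have "monom 1 (l + degree q) * p = monom 1 k * reflect_poly q"
  proof (rule poly_eq_cofinite[of "{0}"])
    fix t :: 'k assume t: "t \<notin> {0}"
    have e: "v + t *s w = t *s (w + inverse t *s v)" using t by (simp add: Finite_Cartesian_Product.vec_eq_iff field_simps)
    have "t ^ l * s (v + t *s w) = t ^ k * s (w + inverse t *s v)"
      unfolding e by (rule tw_scale[OF s]) (use t inU(2) inU(1)[of t] e in auto)
    then have "t ^ l * poly p t = t ^ k * poly q (inverse t)" by (simp add: p q)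
    then show "poly (monom 1 (l + degree q) * p) t = poly (monom 1 k * reflect_poly q) t"
      using t by (simp add: poly_monom power_add poly_reflect_poly_nz)
  qed simp
  moreover have "degree (monom 1 k * reflect_poly q) \<le> k + degree q"
    using degree_mult_le[of "monom 1 k" "reflect_poly q"] degree_reflect_poly_le[of q] by (simp add: degree_monom_eq)
  ultimately have "p \<noteq> 0 \<Longrightarrow> l + degree q + degree p \<le> k + degree q"
    by (metis degree_monom_eq degree_mult_eq monom_eq_0_iff zero_neq_one)
  then show ?thesis using that[OF p] by fastforce
qed

text \<open>In both charts the section is a constant polynomial, and the charts share the value at
  \<open>v + w\<close>. The set \<open>U\<close> need only contain the line, so functions on a
  closed line are covered too.\<close>

lemma tw0_line:
  fixes v w :: "'k::{alg_closed_field, field_char_0} ^ 'n::finite"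
  assumes s: "s \<in> twist_sections 0 U"
    and U: "\<And>x y. x *s v + y *s w \<noteq> 0 \<Longrightarrow> x *s v + y *s w \<in> U" and ind: "independent_points v w"
  shows "s v = s w"
proof -
  have ind': "independent_points w v" using ind unfolding independent_points_def by (metis add.commute)
  have U': "x *s w + y *s v \<in> U" if "x *s w + y *s v \<noteq> 0" for x y
    using U[of y x] that by (simp add: add.commute)
  obtain p where p: "\<And>t. s (v + t *s w) = poly p t" "p = 0 \<or> degree p + 0 \<le> 0"
    by (rule tw_line_degree[OF _ U ind, of s 0 0]) (use s in auto)
  obtain q where q: "\<And>t. s (w + t *s v) = poly q t" "q = 0 \<or> degree q + 0 \<le> 0"
    by (rule tw_line_degree[OF _ _ ind', of s 0 0 U]) (use s U' in auto)
  have "degree p = 0" "degree q = 0" using p(2) q(2) by auto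
  then obtain x y where "p = [:x:]" "q = [:y:]" by (meson degree_eq_zeroE)
  then show ?thesis using p(1)[of 0] p(1)[of 1] q(1)[of 0] q(1)[of 1] by (simp add: add.commute)
qed

text \<open>In \<open>p(t) = t q(1/t)\<close> with degrees at most one the coefficients change
  places, so the slope of \<open>p\<close> is \<open>s w\<close>.\<close>

lemma tw1_line:
  fixes v w :: "'k::{alg_closed_field, field_char_0} ^ 'n::finite"
  assumes s: "s \<in> twist_sections 1 U"
    and U: "\<And>x y. x *s v + y *s w \<noteq> 0 \<Longrightarrow> x *s v + y *s w \<in> U" and ind: "independent_points v w"
  shows "s (v + w) = s v + s w"
proof -
  have ind': "independent_points w v" using ind unfolding independent_points_def by (metis add.commute)
  have U': "x *s w + y *s v \<in> U" if "x *s w + y *s v \<noteq> 0" for x y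
    using U[of y x] that by (simp add: add.commute)
  obtain p where p: "\<And>t. s (v + t *s w) = poly p t" "p = 0 \<or> degree p + 0 \<le> 1"
    by (rule tw_line_degree[OF _ U ind, of s 1 0]) (use s in auto)
  obtain q where q: "\<And>t. s (w + t *s v) = poly q t" "q = 0 \<or> degree q + 0 \<le> 1"
    by (rule tw_line_degree[OF _ _ ind', of s 1 0 U]) (use s U' in auto)
  have lin: "\<exists>x y. r = [:x, y:]" if "degree r \<le> 1" for r :: "'k poly"
    using that by (cases r rule: pCons_cases) (auto elim!: degree_eq_zeroE split: if_splits)
  obtain p0 p1 where p': "p = [:p0, p1:]" using lin[of p] p(2) by fastforce
  obtain q0 q1 where q': "q = [:q0, q1:]" using lin[of q] q(2) by fastforce
  have "[:p0, p1:] = [:q1, q0:]"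
  proof (rule poly_eq_cofinite[of "{0}"])
    fix t :: 'k assume t: "t \<notin> {0}"
    have "v + t *s w = t *s (w + inverse t *s v)" using t by (simp add: Finite_Cartesian_Product.vec_eq_iff field_simps)
    moreover have inU: "1 *s v + t *s w \<in> U" "inverse t *s v + 1 *s w \<in> U"
      using ind unfolding independent_points_def by (intro U, metis zero_neq_one)+
    ultimately have "s (v + t *s w) = t * s (w + inverse t *s v)"
      using tw_scale[of s 1 0 U "w + inverse t *s v" t] s t by (simp add: add.commute)
    then show "poly [:p0, p1:] t = poly [:q1, q0:] t"
      using t by (simp add: p q p' q' field_simps)
  qed simp
  then show ?thesis using p(1)[of 0] p(1)[of 1] q(1)[of 0] by (simp add: p' q')
qed

lemma tw_neg_line:
  fixes v w :: "'k::{alg_closed_field, field_char_0} ^ 'n::finite"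
  assumes s: "s \<in> twist_sections (- 1) U"
    and U: "\<And>x y. x *s v + y *s w \<noteq> 0 \<Longrightarrow> x *s v + y *s w \<in> U" and ind: "independent_points v w"
  shows "s v = 0"
proof -
  obtain p where p: "\<And>t. s (v + t *s w) = poly p t" "p = 0 \<or> degree p + 1 \<le> 0"
    by (rule tw_line_degree[OF _ U ind, of s 0 1]) (use s in auto)
  then show ?thesis using p(1)[of 0] by simp
qed

lemma dependent_points:
  assumes "\<not> independent_points v w" "v \<noteq> 0"
  obtains x where "w = x *s v"
proof -
  obtain s t where st: "s *s v + t *s w = 0" "s \<noteq> 0 \<or> t \<noteq> 0"
    using assms(1) unfolding independent_points_def by blast
  have "t \<noteq> 0" using st assms(2) by auto
  then have "w = (- s / t) *s v" using st(1) by (simp add: Finite_Cartesian_Product.vec_eq_iff field_simps eq_neg_iff_add_eq_0)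
  then show ?thesis by (rule that)
qed

lemma tw1_global:
  fixes v w :: "'k::{alg_closed_field, field_char_0} ^ 'n::finite"
  assumes s: "s \<in> twist_sections 1 proj_space"
  shows "s (x *s v) = x * s v" and "s (v + w) = s v + s w"
proof -
  have s0: "s 0 = 0" using tw_off[OF s] by (simp add: proj_space_def)
  show sc: "s (x *s v) = x * s v" for x v
  proof (cases "x = 0 \<or> v = 0")
    case False
    then show ?thesis using tw_scale[of s 1 0 proj_space v x] s by (simp add: proj_space_def)
  qed (auto simp: s0)
  show "s (v + w) = s v + s w"
  proof (cases "v = 0 \<or> independent_points v w")
    case True
    then show ?thesis
    proof
      assume "independent_points v w"
      then show ?thesis by (intro tw1_line[OF s]) (auto simp: proj_space_def)
    qed (simp add: s0)
  next
    case False
    then obtain x where x: "w = x *s v" using dependent_points by blast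
    then have "v + w = (1 + x) *s v" by (simp add: Finite_Cartesian_Product.vec_eq_iff algebra_simps)
    then show ?thesis by (simp only: sc x) (simp add: algebra_simps)
  qed
qed

section \<open>Morphisms between sums of line bundles\<close>

lemma sheaf_mor_closed: "\<lbrakk>sheaf_mor X F G f; U \<in> opens X; s \<in> sect F U\<rbrakk> \<Longrightarrow> f U s \<in> sect G U"
  unfolding sheaf_mor_def by blast

lemma sheaf_mor_add: "\<lbrakk>sheaf_mor X F G f; U \<in> opens X; s \<in> sect F U; t \<in> sect F U\<rbrakk> \<Longrightarrow>
    f U (s \<oplus>\<^bsub>sections F U\<^esub> t) = f U s \<oplus>\<^bsub>sections G U\<^esub> f U t"
  unfolding sheaf_mor_def by blast

lemma sheaf_mor_smult: "\<lbrakk>sheaf_mor X F G f; U \<in> opens X; x \<in> carrier (regular_ring U); s \<in> sect F U\<rbrakk> \<Longrightarrow>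
    f U (x \<odot>\<^bsub>sections F U\<^esub> s) = x \<odot>\<^bsub>sections G U\<^esub> f U s"
  unfolding sheaf_mor_def by blast

lemma sheaf_mor_restr: "\<lbrakk>sheaf_mor X F G f; U \<in> opens X; V \<in> opens X; V \<subseteq> U; s \<in> sect F U\<rbrakk> \<Longrightarrow>
    f V (restr F U V s) = restr G U V (f U s)"
  unfolding sheaf_mor_def by blast

lemma carrier_regular_ring [simp]: "carrier (regular_ring U) = twist_sections 0 U"
  by (simp add: regular_ring_def)

section \<open>Sums of line bundles and their values at points\<close>

abbreviation twist_power :: "int \<Rightarrow> nat \<Rightarrow> ('k::field ^ 'n, 'k, nat \<Rightarrow> 'k ^ 'n \<Rightarrow> 'k) mod_sheaf" where
  "twist_power d m \<equiv> sheaf_power (twist d) m"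

lemma twist_simps:
  "sect (twist d) U = twist_sections d U"
  "s \<oplus>\<^bsub>sections (twist d) U\<^esub> t = (\<lambda>v. s v + t v)"
  "x \<odot>\<^bsub>sections (twist d) U\<^esub> s = (\<lambda>v. x v * s v)"
  "\<zero>\<^bsub>sections (twist d) U\<^esub> = (\<lambda>v. 0)"
  "restr (twist d) U V s = cut V s"
  by (simp_all add: twist_def)

lemma twist_power_simps:
  "s \<oplus>\<^bsub>sections (twist_power d m) U\<^esub> t = (\<lambda>i v. s i v + t i v)"
  "x \<odot>\<^bsub>sections (twist_power d m) U\<^esub> s = (\<lambda>i v. x v * s i v)"
  "\<zero>\<^bsub>sections (twist_power d m) U\<^esub> = (\<lambda>i v. 0)"
  "restr (twist_power d m) U V s = (\<lambda>i. cut V (s i))"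
  by (simp_all add: sheaf_power_def twist_simps)

lemma sect_twist_power:
  "s \<in> sect (twist_power d m) U \<longleftrightarrow> (\<forall>i<m. s i \<in> twist_sections d U) \<and> (\<forall>i\<ge>m. s i = (\<lambda>_. 0))"
  by (simp add: sheaf_power_def twist_simps)

lemma sect_twist_power_off: "s \<in> sect (twist_power d m) U \<Longrightarrow> v \<notin> U \<Longrightarrow> s i v = 0"
  by (cases "i < m") (auto simp: sect_twist_power tw_off)

lemma cut_apply [simp]: "v \<in> V \<Longrightarrow> cut V s v = s v"
  by (simp add: cut_def)

lemma cut_cut: "V \<subseteq> U \<Longrightarrow> cut V (cut U s) = cut V s"
  by (auto simp: cut_def fun_eq_iff)

definition ev :: "(nat \<Rightarrow> 'p \<Rightarrow> 'k) \<Rightarrow> 'p \<Rightarrow> nat \<Rightarrow> 'k" where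
  "ev s v = (\<lambda>i. s i v)"

lemma ev_Kn: "s \<in> sect (twist_power d m) U \<Longrightarrow> ev s v \<in> Kn m"
  by (auto simp: Kn_def ev_def sect_twist_power)

lemma ev_cut: "v \<in> V \<Longrightarrow> ev (\<lambda>i. cut V (s i)) v = ev s v"
  by (simp add: ev_def)

lemma twist_power_eqI:
  assumes "s \<in> sect (twist_power d m) U" "t \<in> sect (twist_power d m) U" "\<And>v. v \<in> U \<Longrightarrow> ev s v = ev t v"
  shows "s = t"
proof (intro ext)
  fix i v show "s i v = t i v"
    using assms(3)[of v] sect_twist_power_off[OF assms(1)] sect_twist_power_off[OF assms(2)]
    by (cases "v \<in> U") (auto simp: ev_def fun_eq_iff)
qed

lemma twist_power_cut:
  "s \<in> sect (twist_power d m) U \<Longrightarrow> V \<subseteq> U \<Longrightarrow> (\<lambda>i. cut V (s i)) \<in> sect (twist_power d m) V"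
  unfolding sect_twist_power by (auto simp: tw_cut) (auto simp: cut_def)

definition lin_comb :: "nat \<Rightarrow> (nat \<Rightarrow> 'p \<Rightarrow> 'k::field) \<Rightarrow> (nat \<Rightarrow> nat \<Rightarrow> 'p \<Rightarrow> 'k) \<Rightarrow> nat \<Rightarrow> 'p \<Rightarrow> 'k" where
  "lin_comb m x \<kappa> = (\<lambda>i v. \<Sum>j<m. x j v * \<kappa> j i v)"

lemma lin_comb_induct:
  fixes x :: "nat \<Rightarrow> 'p \<Rightarrow> 'k::field"
  assumes zero: "(\<lambda>i v. 0) \<in> A"
    and add: "\<And>s t. s \<in> A \<Longrightarrow> t \<in> A \<Longrightarrow> (\<lambda>i v. s i v + t i v) \<in> A"
    and smult: "\<And>x s. x \<in> X \<Longrightarrow> s \<in> A \<Longrightarrow> (\<lambda>i v. x v * s i v) \<in> A"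
    and x: "\<And>j. j < m \<Longrightarrow> x j \<in> X" and \<kappa>: "\<And>j. j < m \<Longrightarrow> \<kappa> j \<in> A"
  shows "lin_comb m x \<kappa> \<in> A"
  using x \<kappa>
proof (induction m)
  case (Suc m)
  have "(\<lambda>i v. lin_comb m x \<kappa> i v + x m v * \<kappa> m i v) \<in> A"
    using Suc by (intro add smult) auto
  then show ?case by (simp add: lin_comb_def)
qed (simp add: lin_comb_def zero)

text \<open>A map that is additive and turns multiplication by a function into multiplication by its
  value at \<open>v0\<close> is determined by the \<open>\<kappa> j\<close>. \<open>A\<close> and
  \<open>X\<close> stay abstract so as to serve sums of line bundles and the kernel sheaf
  alike.\<close>

lemma lin_comb_functional:
  fixes \<theta> :: "(nat \<Rightarrow> 'p \<Rightarrow> 'k::field) \<Rightarrow> 'k"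
  assumes zero: "(\<lambda>i v. 0) \<in> A"
    and add: "\<And>s t. s \<in> A \<Longrightarrow> t \<in> A \<Longrightarrow> (\<lambda>i v. s i v + t i v) \<in> A"
    and smult: "\<And>x s. x \<in> X \<Longrightarrow> s \<in> A \<Longrightarrow> (\<lambda>i v. x v * s i v) \<in> A"
    and \<theta>_add: "\<And>s t. s \<in> A \<Longrightarrow> t \<in> A \<Longrightarrow> \<theta> (\<lambda>i v. s i v + t i v) = \<theta> s + \<theta> t"
    and \<theta>_smult: "\<And>x s. x \<in> X \<Longrightarrow> s \<in> A \<Longrightarrow> \<theta> (\<lambda>i v. x v * s i v) = x v0 * \<theta> s"
    and x: "\<And>j. j < m \<Longrightarrow> x j \<in> X" and \<kappa>: "\<And>j. j < m \<Longrightarrow> \<kappa> j \<in> A"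
  shows "\<theta> (lin_comb m x \<kappa>) = (\<Sum>j<m. x j v0 * \<theta> (\<kappa> j))"
  using x \<kappa>
proof (induction m)
  case 0
  have "\<theta> (\<lambda>i v. 0 + 0) = \<theta> (\<lambda>i v. 0) + \<theta> (\<lambda>i v. 0)" by (rule \<theta>_add[OF zero zero])
  then have "\<theta> (\<lambda>i v. 0) = 0" unfolding add_0 by (metis add_cancel_right_right)
  then show ?case by (simp add: lin_comb_def)
next
  case (Suc m)
  have 1: "lin_comb m x \<kappa> \<in> A"
    by (rule lin_comb_induct[OF zero add smult]) (use Suc.prems in auto)
  have "lin_comb (Suc m) x \<kappa> = (\<lambda>i v. lin_comb m x \<kappa> i v + x m v * \<kappa> m i v)"
    by (simp add: lin_comb_def)
  then have "\<theta> (lin_comb (Suc m) x \<kappa>) = \<theta> (lin_comb m x \<kappa>) + \<theta> (\<lambda>i v. x m v * \<kappa> m i v)"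
    using \<theta>_add[OF 1 smult] Suc.prems by simp
  then show ?case using Suc \<theta>_smult by simp
qed

lemma twist_power_zero: "U \<subseteq> proj_space \<Longrightarrow> (\<lambda>i (v :: 'k::field ^ 'n::finite). 0) \<in> sect (twist_power d m) U"
  by (simp add: sect_twist_power tw_zero)

lemma twist_power_add:
  fixes U :: "('k::field ^ 'n::finite) set"
  shows "s \<in> sect (twist_power d m) U \<Longrightarrow> t \<in> sect (twist_power d m) U \<Longrightarrow>
    (\<lambda>i v. s i v + t i v) \<in> sect (twist_power d m) U"
  by (auto simp: sect_twist_power intro!: tw_add)

lemma twist_power_smult:
  fixes U :: "('k::field ^ 'n::finite) set"
  shows "x \<in> twist_sections e U \<Longrightarrow> s \<in> sect (twist_power d m) U \<Longrightarrow>
    (\<lambda>i v. x v * s i v) \<in> sect (twist_power (e + d) m) U"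
  by (auto simp: sect_twist_power intro!: tw_mult)

lemma twist_power_smult0:
  fixes U :: "('k::field ^ 'n::finite) set"
  shows "x \<in> twist_sections 0 U \<Longrightarrow> s \<in> sect (twist_power d m) U \<Longrightarrow>
    (\<lambda>i v. x v * s i v) \<in> sect (twist_power d m) U"
  using twist_power_smult[of x 0 U s d m] by simp

definition unit_sect :: "nat \<Rightarrow> ('p \<Rightarrow> 'k::zero) \<Rightarrow> nat \<Rightarrow> 'p \<Rightarrow> 'k" where
  "unit_sect j u = (\<lambda>i. if i = j then u else (\<lambda>_. 0))"

lemma unit_sect_in:
  fixes U :: "('k::field ^ 'n::finite) set"
  shows "j < m \<Longrightarrow> u \<in> twist_sections d U \<Longrightarrow> U \<subseteq> proj_space \<Longrightarrow> unit_sect j u \<in> sect (twist_power d m) U"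
  by (auto simp: sect_twist_power unit_sect_def tw_zero)

lemma unit_sect_cut: "(\<lambda>i. cut V (unit_sect j u i)) = unit_sect j (cut V u)"
  by (auto simp: unit_sect_def cut_def fun_eq_iff)

text \<open>A coordinate that is nonzero at \<open>v\<close>, its inverse, or the constant one
  generates the twist near \<open>v\<close>. The range of \<open>d\<close> is that of the twists in
  the monad.\<close>

lemma local_unit:
  fixes v :: "'k::field ^ 'n::finite"
  assumes "v \<noteq> 0" "d \<in> {-1, 0, 1}"
  obtains V u where "zariski_open V" "v \<in> V" "u \<in> twist_sections d V" "\<And>w. w \<in> V \<Longrightarrow> u w \<noteq> 0"
proof -
  obtain i where i: "v $ i \<noteq> 0" using assms(1) by (auto simp: Finite_Cartesian_Product.vec_eq_iff)
  let ?V = "basic_open (\<lambda>v. v $ i) :: ('k ^ 'n) set"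
  let ?l = "cut ?V (\<lambda>v. v $ i)"
  have V: "zariski_open ?V" by (rule zariski_open_basic[OF hom_poly_coord])
  then have VP: "?V \<subseteq> proj_space" by (rule zariski_open_subset)
  have vV: "v \<in> ?V" using i assms(1) by (simp add: basic_open_def proj_space_def)
  have l: "?l \<in> twist_sections 1 ?V" using tw_hom[OF hom_poly_coord VP] by simp
  have nz: "?l w \<noteq> 0" if "w \<in> ?V" for w using that by (simp add: basic_open_def)
  consider "d = 1" | "d = 0" | "d = - 1" using assms(2) by auto
  then show ?thesis
  proof cases
    case 1
    then show ?thesis using that[OF V vV] l nz by blast
  next
    case 2
    then show ?thesis using that[OF V vV, of "cut ?V (\<lambda>_. 1)"] tw_const[OF VP, of 1] by simp
  next
    case 3
    then show ?thesis using that[OF V vV, of "\<lambda>v. inverse (?l v)"] tw_inverse[OF l nz] nz by simp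
  qed
qed

lemma sect_with_value:
  fixes v :: "'k::field ^ 'n::finite"
  assumes "zariski_open U" "v \<in> U" "d \<in> {-1, 0, 1}" "w \<in> Kn m"
  obtains V s where "zariski_open V" "v \<in> V" "V \<subseteq> U" "s \<in> sect (twist_power d m) V" "ev s v = w"
proof -
  have "v \<noteq> 0" using zariski_open_subset[OF assms(1)] assms(2) by (auto simp: proj_space_def)
  then obtain V u where V: "zariski_open V" "v \<in> V" "u \<in> twist_sections d V" "\<And>w. w \<in> V \<Longrightarrow> u w \<noteq> 0"
    using local_unit[OF _ assms(3)] by blast
  let ?V = "U \<inter> V"
  have VP: "?V \<subseteq> proj_space" using zariski_open_subset[OF assms(1)] by blast
  have "cut ?V u \<in> twist_sections d ?V" by (rule tw_cut[OF V(3)]) simp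
  from tw_mult[OF tw_const[OF VP] this]
  have *: "(\<lambda>x. cut ?V (\<lambda>_. y) x * cut ?V u x) \<in> twist_sections d ?V" for y by simp
  let ?s = "\<lambda>i x. cut ?V (\<lambda>_. w i / u v) x * cut ?V u x"
  have "?s \<in> sect (twist_power d m) ?V"
    using * assms(4) by (auto simp: sect_twist_power Kn_def cut_def)
  moreover have "ev ?s v = w" using V(2,4) assms(2) by (simp add: ev_def fun_eq_iff)
  ultimately show ?thesis using that[of ?V] zariski_open_Int[OF assms(1) V(1)] V(2) assms(2) by blast
qed

text \<open>Dividing the image of a local generator of \<open>\<O>(d)\<close> by that generator gives global sections of \<open>\<O>(1)\<close>.\<close>

lemma linear_matrix:
  fixes f :: "('k::{alg_closed_field, field_char_0} ^ 'n::finite, nat \<Rightarrow> 'k ^ 'n \<Rightarrow> 'k, nat \<Rightarrow> 'k ^ 'n \<Rightarrow> 'k) sheaf_map"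
  assumes f: "sheaf_mor proj_space (twist_power d m) (twist_power (d + 1) m') f" and d: "d \<in> {-1, 0, 1}"
  obtains A where "\<And>v. lin (A v)" "\<And>v w u. A (v + w) u = A v u + A w u" "\<And>x v u. A (x *s v) u = x \<star> A v u"
    "\<And>v u. A v u \<in> Kn m'"
    "\<And>V s v. zariski_open V \<Longrightarrow> s \<in> sect (twist_power d m) V \<Longrightarrow> v \<in> V \<Longrightarrow> ev (f V s) v = A v (ev s v)"
proof -
  have opn: "V \<in> opens proj_space" if "zariski_open V" for V :: "('k ^ 'n) set" using that by (simp add: opens_proj)
  define nice where "nice V u v \<longleftrightarrow> zariski_open V \<and> v \<in> V \<and> u \<in> twist_sections d V \<and> (\<forall>w\<in>V. u w \<noteq> 0)"
    for V u and v :: "'k ^ 'n"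
  have nice_ex: "\<exists>V u. nice V u v" if "v \<noteq> 0" for v :: "'k ^ 'n"
    using local_unit[OF that d] unfolding nice_def by metis
  have nice_closed: "f V (unit_sect j u) i \<in> twist_sections (d + 1) V" if "nice V u v" "j < m" "i < m'" for V u v j i
    using sheaf_mor_closed[OF f opn unit_sect_in[OF that(2)]] that zariski_open_subset
    unfolding nice_def sect_twist_power by blast
  have expand: "f V s i v = (\<Sum>j<m. s j v / u v * f V (unit_sect j u) i v)"
    if n: "nice V u v" and s: "s \<in> sect (twist_power d m) V" for V u v s i
  proof -
    have V: "zariski_open V" "V \<subseteq> proj_space" "u \<in> twist_sections d V" "\<And>w. w \<in> V \<Longrightarrow> u w \<noteq> 0"
      using n zariski_open_subset unfolding nice_def by blast+
    let ?x = "\<lambda>j w. s j w * inverse (u w)"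
    have x: "?x j \<in> twist_sections 0 V" if "j < m" for j
      using tw_mult[OF _ tw_inverse[OF V(3,4)], of "s j" d] s that by (simp add: sect_twist_power)
    have eq: "s = lin_comb m ?x (\<lambda>j. unit_sect j u)"
    proof (intro ext)
      fix l w
      have "lin_comb m ?x (\<lambda>j. unit_sect j u) l w = (\<Sum>j<m. if l = j then s j w * inverse (u w) * u w else 0)"
        unfolding lin_comb_def by (rule sum.cong) (auto simp: unit_sect_def)
      also have "\<dots> = (if l < m then s l w * inverse (u w) * u w else 0)" by simp
      also have "\<dots> = s l w"
        using V(4)[of w] s sect_twist_power_off[OF s, of w l] by (cases "w \<in> V") (auto simp: sect_twist_power)
      finally show "s l w = lin_comb m ?x (\<lambda>j. unit_sect j u) l w" ..
    qed
    have "f V (lin_comb m ?x (\<lambda>j. unit_sect j u)) i v = (\<Sum>j<m. ?x j v * f V (unit_sect j u) i v)"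
    proof (rule lin_comb_functional[where A = "sect (twist_power d m) V" and X = "twist_sections 0 V" and \<theta> = "\<lambda>s. f V s i v"])
      fix s t assume "s \<in> sect (twist_power d m) V" "t \<in> sect (twist_power d m) V"
      from sheaf_mor_add[OF f opn[OF V(1)] this]
      show "f V (\<lambda>i v. s i v + t i v) i v = f V s i v + f V t i v" by (simp add: twist_power_simps)
    next
      fix x s assume "x \<in> twist_sections 0 V" "s \<in> sect (twist_power d m) V"
      with sheaf_mor_smult[OF f opn[OF V(1)], of x s]
      show "f V (\<lambda>i v. x v * s i v) i v = x v * f V s i v" by (simp add: twist_power_simps)
    qed (use x unit_sect_in[OF _ V(3,2)] V in \<open>auto intro!: twist_power_zero twist_power_add twist_power_smult0\<close>)
    then show ?thesis using eq by (simp add: divide_inverse)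
  qed
  have restrict: "f V s i v = f V' (\<lambda>i. cut V' (s i)) i v"
    if "zariski_open V" "zariski_open V'" "V' \<subseteq> V" "v \<in> V'" "s \<in> sect (twist_power d m) V" for V V' v s i
    using sheaf_mor_restr[OF f opn[OF that(1)] opn[OF that(2)] that(3,5)] that(4) by (simp add: twist_power_simps)
  have nice_Int: "nice (V \<inter> V') (cut (V \<inter> V') u) v" if "nice V u v" "zariski_open V'" "v \<in> V'" for V V' u v
    using that zariski_open_Int tw_cut[of u d V "V \<inter> V'"] unfolding nice_def by auto
  have indep: "f V (unit_sect j u) i v / u v = f V' (unit_sect j u') i v / u' v"
    if n: "nice V u v" "nice V' u' v" and j: "j < m" for V u V' u' v i j
  proof -
    let ?W = "V \<inter> V'"
    have W: "zariski_open ?W" "v \<in> ?W" "u v \<noteq> 0" "u' v \<noteq> 0" "V \<subseteq> proj_space" "V' \<subseteq> proj_space"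
      "u \<in> twist_sections d V" "u' \<in> twist_sections d V'"
      using n zariski_open_Int zariski_open_subset unfolding nice_def by auto
    have nW: "nice ?W (cut ?W u') v"
      using nice_Int[OF n(2), of V] n(1) unfolding nice_def by (simp add: Int_commute)
    have inW: "unit_sect j (cut ?W u) \<in> sect (twist_power d m) ?W"
      using W by (intro unit_sect_in j tw_cut) auto
    have "f V (unit_sect j u) i v = f ?W (unit_sect j (cut ?W u)) i v"
      using restrict[of V ?W v "unit_sect j u" i] n W(1,2) unit_sect_in[OF j W(7,5)]
      unfolding nice_def by (simp add: unit_sect_cut)
    also have "\<dots> = (\<Sum>l<m. unit_sect j (cut ?W u) l v / cut ?W u' v * f ?W (unit_sect l (cut ?W u')) i v)"
      by (rule expand[OF nW inW])
    also have "\<dots> = (\<Sum>l<m. if l = j then u v / u' v * f ?W (unit_sect j (cut ?W u')) i v else 0)"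
      using W(2) by (intro sum.cong) (auto simp: unit_sect_def)
    also have "\<dots> = u v / u' v * f ?W (unit_sect j (cut ?W u')) i v" using j by simp
    also have "f ?W (unit_sect j (cut ?W u')) i v = f V' (unit_sect j u') i v"
      using restrict[of V' ?W v "unit_sect j u'" i] n W(1,2) unit_sect_in[OF j W(8,6)]
      unfolding nice_def by (simp add: unit_sect_cut)
    finally show ?thesis using W(3) by simp
  qed
  \<comment> \<open>By \<open>indep\<close> the ratio does not depend on the local generator, so the
    arbitrary choice is harmless. At the origin, which lies outside \<open>proj_space\<close>, the
    value is zero, as a section requires.\<close>
  define C where "C i j v = (if v = 0 then 0 else
    SOME x. \<exists>V u. nice V u v \<and> x = f V (unit_sect j u) i v / u v)" for i j and v :: "'k ^ 'n"
  have C: "C i j v = f V (unit_sect j u) i v / u v" if "nice V u v" "j < m" for V u i j v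
  proof -
    have "v \<noteq> 0" using that zariski_open_subset unfolding nice_def proj_space_def by blast
    moreover define P where "P x \<longleftrightarrow> (\<exists>V u. nice V u v \<and> x = f V (unit_sect j u) i v / u v)" for x
    ultimately have "C i j v = (SOME x. P x)" by (simp add: C_def)
    moreover have "P (SOME x. P x)" by (rule someI[of P]) (use that(1) in \<open>auto simp: P_def\<close>)
    ultimately obtain V' u' where n: "nice V' u' v" "C i j v = f V' (unit_sect j u') i v / u' v"
      unfolding P_def by auto
    show ?thesis unfolding n(2) by (rule indep[OF n(1) that])
  qed
  have Ctw: "C i j \<in> twist_sections 1 proj_space" if ij: "i < m'" "j < m" for i j
  proof (rule tw_local)
    fix v :: "'k ^ 'n" assume "v \<in> proj_space"
    then obtain V u where n: "nice V u v" using nice_ex[of v] by (auto simp: proj_space_def)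
    then have V: "zariski_open V" "v \<in> V" "u \<in> twist_sections d V" "\<And>w. w \<in> V \<Longrightarrow> u w \<noteq> 0" "V \<subseteq> proj_space"
      using zariski_open_subset unfolding nice_def by blast+
    have "(\<lambda>w. f V (unit_sect j u) i w * inverse (u w)) \<in> twist_sections (d + 1 + - d) V"
      by (rule tw_mult[OF nice_closed[OF n ij(2,1)] tw_inverse[OF V(3,4)]])
    moreover have "C i j w = f V (unit_sect j u) i w * inverse (u w)" if "w \<in> V" for w
      using C[of V u w j i] n ij(2) that unfolding nice_def by (simp add: divide_inverse)
    moreover have "proj_space \<inter> V = V" using V(5) by blast
    ultimately show "\<exists>W t. zariski_open W \<and> v \<in> W \<and> t \<in> twist_sections 1 (proj_space \<inter> W) \<and>
        (\<forall>w\<in>proj_space \<inter> W. C i j w = t w)"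
      using V(1,2) by (intro exI[of _ V] exI[of _ "\<lambda>w. f V (unit_sect j u) i w * inverse (u w)"]) simp
  qed (simp add: C_def proj_space_def)
  define A where "A v u = (\<lambda>i. if i < m' then \<Sum>j<m. C i j v * u j else 0)" for v u
  show ?thesis
  proof (rule that[of A])
    show "lin (A v)" for v
      unfolding A_def by (intro linI) (auto simp: fun_eq_iff fun_simps algebra_simps sum.distrib sum_distrib_left)
    show "A (v + w) u = A v u + A w u" for v w u
      unfolding A_def by (auto simp: fun_eq_iff fun_simps tw1_global(2)[OF Ctw] algebra_simps sum.distrib)
    show "A (x *s v) u = x \<star> A v u" for x v u
      unfolding A_def by (auto simp: fun_eq_iff fun_simps tw1_global(1)[OF Ctw] algebra_simps sum_distrib_left)
    show "A v u \<in> Kn m'" for v u unfolding A_def by (simp add: Kn_def)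
    fix V s and v :: "'k ^ 'n" assume V: "zariski_open V" "s \<in> sect (twist_power d m) V" "v \<in> V"
    have "v \<noteq> 0" using zariski_open_subset[OF V(1)] V(3) by (auto simp: proj_space_def)
    then obtain V0 u where n: "nice V0 u v" using nice_ex by blast
    let ?W = "V0 \<inter> V"
    have W: "zariski_open ?W" using n V(1) zariski_open_Int unfolding nice_def by blast
    have nW: "nice ?W (cut ?W u) v" by (rule nice_Int[OF n V(1,3)])
    then have vW: "v \<in> ?W" unfolding nice_def by blast
    have "f V s i v = A v (ev s v) i" for i
    proof (cases "i < m'")
      case True
      have "f V s i v = f ?W (\<lambda>i. cut ?W (s i)) i v"
        by (rule restrict[OF V(1) W _ vW V(2)]) simp
      also have "\<dots> = (\<Sum>j<m. cut ?W (s j) v / cut ?W u v * f ?W (unit_sect j (cut ?W u)) i v)"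
        by (rule expand[OF nW twist_power_cut[OF V(2)]]) simp
      also have "\<dots> = (\<Sum>j<m. C i j v * s j v)"
        using C[OF nW] vW by (intro sum.cong) auto
      finally show ?thesis using True by (simp add: A_def ev_def)
    next
      case False
      have "f V s \<in> sect (twist_power (d + 1) m') V" by (rule sheaf_mor_closed[OF f opn[OF V(1)] V(2)])
      then show ?thesis using False by (simp add: A_def sect_twist_power)
    qed
    then show "ev (f V s) v = A v (ev s v)" by (simp add: ev_def)
  qed
qed

text \<open>Finitely many neighbourhoods are intersected, which \<open>mono\<close> permits. This is
  how whole bases are lifted over one neighbourhood.\<close>

lemma common_nbhd:
  fixes U :: "('k::field ^ 'n::finite) set"
  assumes ex: "\<And>i. i < (c::nat) \<Longrightarrow> \<exists>V. zariski_open V \<and> v \<in> V \<and> V \<subseteq> U \<and> P i V"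
    and mono: "\<And>i V V'. i < c \<Longrightarrow> P i V \<Longrightarrow> V \<subseteq> U \<Longrightarrow> zariski_open V \<Longrightarrow> zariski_open V' \<Longrightarrow> V' \<subseteq> V \<Longrightarrow> P i V'"
    and U: "zariski_open U" "v \<in> U"
  obtains V where "zariski_open V" "v \<in> V" "V \<subseteq> U" "\<And>i. i < c \<Longrightarrow> P i V"
proof -
  have "\<exists>V. zariski_open V \<and> v \<in> V \<and> V \<subseteq> U \<and> (\<forall>i<k. P i V)" if "k \<le> c" for k
    using that
  proof (induction k)
    case 0
    then show ?case using U by blast
  next
    case (Suc k)
    then obtain V where V: "zariski_open V" "v \<in> V" "V \<subseteq> U" "\<forall>i<k. P i V" by auto
    obtain V' where V': "zariski_open V'" "v \<in> V'" "V' \<subseteq> U" "P k V'" using ex[of k] Suc.prems by auto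
    have W: "zariski_open (V \<inter> V')" by (rule zariski_open_Int[OF V(1) V'(1)])
    have "P i (V \<inter> V')" if "i < Suc k" for i
      using mono[of i V "V \<inter> V'"] mono[of i V' "V \<inter> V'"] V V' W that Suc.prems
      by (cases "i = k") auto
    then show ?case using W V(2,3) V'(2) by (intro exI[of _ "V \<inter> V'"]) auto
  qed
  then show ?thesis using that by blast
qed

section \<open>The kernel sheaf and the fibres of the instanton bundle\<close>

text \<open>All existential choices made in the definition of an instanton bundle are fixed here,
  together with the matrices \<open>am\<close> and \<open>bm\<close> that describe the two sheaf
  maps on values at points.\<close>

locale instanton =
  fixes E :: "('k::{alg_closed_field, field_char_0} ^ 'n::finite, 'k, 'm) mod_sheaf"
    and \<phi> :: "('k ^ 'n, 'm, ('k ^ 'n, 'm, 'k ^ 'n \<Rightarrow> 'k) sheaf_map) sheaf_map"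
    and r c N :: nat
    and a b :: "('k ^ 'n, nat \<Rightarrow> 'k ^ 'n \<Rightarrow> 'k, nat \<Rightarrow> 'k ^ 'n \<Rightarrow> 'k) sheaf_map"
    and \<pi> :: "('k ^ 'n, nat \<Rightarrow> 'k ^ 'n \<Rightarrow> 'k, 'm) sheaf_map"
    and am bm :: "'k ^ 'n \<Rightarrow> (nat \<Rightarrow> 'k) \<Rightarrow> nat \<Rightarrow> 'k"
  assumes N: "N = r + 2 * c"
    and E: "module_sheaf proj_space E"
    and a_mor: "sheaf_mor proj_space (twist_power (- 1) c) (twist_power 0 N) a"
    and b_surj: "sheaf_surj proj_space (twist_power 0 N) (twist_power 1 c) b"
    and ba: "\<And>U s. zariski_open U \<Longrightarrow> s \<in> sect (twist_power (- 1) c) U \<Longrightarrow> b U (a U s) = (\<lambda>i v. 0)"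
    and \<pi>_surj: "sheaf_surj proj_space (kernel_sheaf (twist_power 0 N) (twist_power 1 c) b) E \<pi>"
    and \<pi>_ker: "\<And>U. zariski_open U \<Longrightarrow>
      {s \<in> sect (kernel_sheaf (twist_power 0 N) (twist_power 1 c) b) U. \<pi> U s = \<zero>\<^bsub>sections E U\<^esub>} =
      image_sections proj_space (twist_power (- 1) c) (kernel_sheaf (twist_power 0 N) (twist_power 1 c) b) a U"
    and lf: "locally_free proj_space E"
    and \<phi>_iso: "sheaf_iso proj_space E (dual E) \<phi>"
    and \<phi>_sym: "\<And>U s. zariski_open U \<Longrightarrow> s \<in> sect E U \<Longrightarrow> dual_mor E \<phi> U (bidual E U s) = \<phi> U s"
    and am: "\<And>v. lin (am v)" "\<And>v w u. am (v + w) u = am v u + am w u" "\<And>x v u. am (x *s v) u = x \<star> am v u"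
      "\<And>v u. am v u \<in> Kn N"
      "\<And>V s v. zariski_open V \<Longrightarrow> s \<in> sect (twist_power (- 1) c) V \<Longrightarrow> v \<in> V \<Longrightarrow> ev (a V s) v = am v (ev s v)"
    and bm: "\<And>v. lin (bm v)" "\<And>v w u. bm (v + w) u = bm v u + bm w u" "\<And>x v u. bm (x *s v) u = x \<star> bm v u"
      "\<And>v u. bm v u \<in> Kn c"
      "\<And>V s v. zariski_open V \<Longrightarrow> s \<in> sect (twist_power 0 N) V \<Longrightarrow> v \<in> V \<Longrightarrow> ev (b V s) v = bm v (ev s v)"
begin

section \<open>Sections of the kernel sheaf\<close>

abbreviation K :: "('k ^ 'n, 'k, nat \<Rightarrow> 'k ^ 'n \<Rightarrow> 'k) mod_sheaf" where
  "K \<equiv> kernel_sheaf (twist_power 0 N) (twist_power 1 c) b"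

lemma opn: "zariski_open V \<Longrightarrow> V \<in> opens proj_space" for V :: "('k ^ 'n) set"
  by (simp add: opens_proj)

lemma open_nonzero: "zariski_open V \<Longrightarrow> v \<in> V \<Longrightarrow> v \<noteq> 0" for V :: "('k ^ 'n) set"
  using zariski_open_subset by (auto simp: proj_space_def)

lemma K_simps:
  "s \<oplus>\<^bsub>sections K U\<^esub> t = (\<lambda>i v. s i v + t i v)"
  "x \<odot>\<^bsub>sections K U\<^esub> s = (\<lambda>i v. x v * s i v)"
  "\<zero>\<^bsub>sections K U\<^esub> = (\<lambda>i v. 0)"
  "restr K U V s = (\<lambda>i. cut V (s i))"
  by (simp_all add: kernel_sheaf_def twist_power_simps)

lemma b_mor: "sheaf_mor proj_space (twist_power 0 N) (twist_power 1 c) b"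
  using b_surj unfolding sheaf_surj_def by blast

lemma \<pi>_mor: "sheaf_mor proj_space K E \<pi>"
  using \<pi>_surj unfolding sheaf_surj_def by blast

text \<open>Sections of sums of line bundles are determined by their values, so membership in the
  kernel can be tested pointwise with \<open>bm\<close>.\<close>

lemma sect_K:
  assumes "zariski_open U"
  shows "s \<in> sect K U \<longleftrightarrow> s \<in> sect (twist_power 0 N) U \<and> (\<forall>v\<in>U. bm v (ev s v) = 0)"
proof -
  have "b U s = (\<lambda>i v. 0) \<longleftrightarrow> (\<forall>v\<in>U. bm v (ev s v) = 0)" if s: "s \<in> sect (twist_power 0 N) U"
  proof
    assume "b U s = (\<lambda>i v. 0)"
    then show "\<forall>v\<in>U. bm v (ev s v) = 0"
      using bm(5)[OF assms s] by (auto simp: ev_def zero_fun_def)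
  next
    assume z: "\<forall>v\<in>U. bm v (ev s v) = 0"
    show "b U s = (\<lambda>i v. 0)"
    proof (rule twist_power_eqI)
      show "b U s \<in> sect (twist_power 1 c) U" by (rule sheaf_mor_closed[OF b_mor opn[OF assms] s])
      show "(\<lambda>i v. 0) \<in> sect (twist_power 1 c) U" by (rule twist_power_zero[OF zariski_open_subset[OF assms]])
      fix v assume "v \<in> U"
      then show "ev (b U s) v = ev (\<lambda>i v. 0) v"
        using bm(5)[OF assms s] z by (simp add: ev_def zero_fun_def)
    qed
  qed
  then show ?thesis by (auto simp: kernel_sheaf_def twist_power_simps)
qed

lemma K_sect: "s \<in> sect K U \<Longrightarrow> s \<in> sect (twist_power 0 N) U"
  by (simp add: kernel_sheaf_def)

lemma ev_zero: "ev (\<lambda>i v. 0) v = 0"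
  by (simp add: ev_def zero_fun_def)

lemma K_zero: "zariski_open U \<Longrightarrow> (\<lambda>i v. 0) \<in> sect K U"
  using twist_power_zero[OF zariski_open_subset] lin_0[OF bm(1)]
  by (auto simp: sect_K ev_zero)

lemma ev_add: "ev (\<lambda>i v. s i v + t i v) v = ev s v + ev t v"
  by (simp add: ev_def plus_fun_def)

lemma ev_smult: "ev (\<lambda>i v. x v * s i v) v = x v \<star> ev s v"
  by (simp add: ev_def smul_def)

lemma ev_lin_comb: "ev (lin_comb m x \<kappa>) v = (\<Sum>j<m. x j v \<star> ev (\<kappa> j) v)"
  by (simp add: ev_def lin_comb_def fun_eq_iff sum_fun_apply fun_simps)

lemma K_add:
  assumes "zariski_open U" "s \<in> sect K U" "t \<in> sect K U"
  shows "(\<lambda>i v. s i v + t i v) \<in> sect K U"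
  using assms twist_power_add[of s 0 N U t] by (auto simp: sect_K ev_add lin_add[OF bm(1)])

lemma K_smult:
  assumes "zariski_open U" "x \<in> twist_sections 0 U" "s \<in> sect K U"
  shows "(\<lambda>i v. x v * s i v) \<in> sect K U"
  using assms twist_power_smult0[of x U s 0 N] by (auto simp: sect_K ev_smult lin_scale[OF bm(1)])

lemma K_cut:
  assumes "zariski_open U" "zariski_open V" "V \<subseteq> U" "s \<in> sect K U"
  shows "(\<lambda>i. cut V (s i)) \<in> sect K V"
  using assms twist_power_cut[of s 0 N U V] by (auto simp: sect_K ev_cut)

lemma K_lin_comb:
  assumes "zariski_open U" "\<And>j. j < m \<Longrightarrow> x j \<in> twist_sections 0 U" "\<And>j. j < m \<Longrightarrow> \<kappa> j \<in> sect K U"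
  shows "lin_comb m x \<kappa> \<in> sect K U"
  by (rule lin_comb_induct[OF K_zero K_add K_smult]) (use assms in auto)

lemma K_functional:
  assumes "zariski_open U"
    and "\<And>s t. s \<in> sect K U \<Longrightarrow> t \<in> sect K U \<Longrightarrow> \<theta> (\<lambda>i v. s i v + t i v) = \<theta> s + \<theta> t"
    and "\<And>x s. x \<in> twist_sections 0 U \<Longrightarrow> s \<in> sect K U \<Longrightarrow> \<theta> (\<lambda>i v. x v * s i v) = x v0 * \<theta> s"
    and "\<And>j. j < m \<Longrightarrow> x j \<in> twist_sections 0 U" "\<And>j. j < m \<Longrightarrow> \<kappa> j \<in> sect K U"
  shows "\<theta> (lin_comb m x \<kappa>) = (\<Sum>j<m. x j v0 * \<theta> (\<kappa> j))"
  by (rule lin_comb_functional[OF K_zero K_add K_smult assms(2,3)]) (use assms in auto)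

lemma \<pi>_closed: "zariski_open U \<Longrightarrow> s \<in> sect K U \<Longrightarrow> \<pi> U s \<in> sect E U"
  by (rule sheaf_mor_closed[OF \<pi>_mor opn])

lemma \<pi>_add: "zariski_open U \<Longrightarrow> s \<in> sect K U \<Longrightarrow> t \<in> sect K U \<Longrightarrow>
    \<pi> U (\<lambda>i v. s i v + t i v) = \<pi> U s \<oplus>\<^bsub>sections E U\<^esub> \<pi> U t"
  using sheaf_mor_add[OF \<pi>_mor opn] by (simp add: K_simps)

lemma \<pi>_smult: "zariski_open U \<Longrightarrow> x \<in> twist_sections 0 U \<Longrightarrow> s \<in> sect K U \<Longrightarrow>
    \<pi> U (\<lambda>i v. x v * s i v) = x \<odot>\<^bsub>sections E U\<^esub> \<pi> U s"
  using sheaf_mor_smult[OF \<pi>_mor opn] by (simp add: K_simps)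

lemma \<pi>_restr: "zariski_open U \<Longrightarrow> zariski_open V \<Longrightarrow> V \<subseteq> U \<Longrightarrow> s \<in> sect K U \<Longrightarrow>
    \<pi> V (\<lambda>i. cut V (s i)) = restr E U V (\<pi> U s)"
  using sheaf_mor_restr[OF \<pi>_mor opn opn] by (simp add: K_simps)

lemma a_closed: "zariski_open U \<Longrightarrow> s \<in> sect (twist_power (- 1) c) U \<Longrightarrow> a U s \<in> sect K U"
  using sheaf_mor_closed[OF a_mor opn] ba by (simp add: kernel_sheaf_def twist_power_simps)

lemma cut_whole: "s \<in> sect (twist_power d m) U \<Longrightarrow> (\<lambda>i. cut U (s i)) = s"
  by (auto simp: fun_eq_iff cut_def sect_twist_power_off)

lemma \<pi>_a:
  assumes U: "zariski_open U" and s: "s \<in> sect (twist_power (- 1) c) U"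
  shows "\<pi> U (a U s) = \<zero>\<^bsub>sections E U\<^esub>"
proof -
  have aK: "a U s \<in> sect K U" by (rule a_closed[OF U s])
  have "restr K U U (a U s) = a U s"
    using cut_whole[OF K_sect[OF aK]] by (simp add: K_simps)
  then have "a U s \<in> image_sections proj_space (twist_power (- 1) c) K a U"
    unfolding image_sections_def using aK opn[OF U] s by auto
  then show ?thesis using \<pi>_ker[OF U] by blast
qed

text \<open>The kernel of \<open>\<pi>\<close> is the image sheaf of \<open>a\<close>, so a preimage
  under \<open>a\<close> is available only after shrinking the open set.\<close>

lemma \<pi>_zero_local:
  assumes U: "zariski_open U" and s: "s \<in> sect K U" "\<pi> U s = \<zero>\<^bsub>sections E U\<^esub>" and v: "v \<in> U"
  obtains V \<sigma> where "zariski_open V" "v \<in> V" "V \<subseteq> U" "\<sigma> \<in> sect (twist_power (- 1) c) V"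
    "\<And>w. w \<in> V \<Longrightarrow> ev s w = am w (ev \<sigma> w)"
proof -
  have "s \<in> image_sections proj_space (twist_power (- 1) c) K a U" using s \<pi>_ker[OF U] by blast
  then have "\<exists>V\<in>opens proj_space. v \<in> V \<and> V \<subseteq> U \<and> restr K U V s \<in> a V ` sect (twist_power (- 1) c) V"
    using v unfolding image_sections_def by blast
  then obtain V \<sigma> where V: "zariski_open V" "v \<in> V" "V \<subseteq> U" "\<sigma> \<in> sect (twist_power (- 1) c) V"
    "(\<lambda>i. cut V (s i)) = a V \<sigma>"
    by (auto simp: opens_proj K_simps)
  have "ev s w = am w (ev \<sigma> w)" if "w \<in> V" for w
    using am(5)[OF V(1,4) that] ev_cut[OF that, of s] V(5) by simp
  then show ?thesis using that V by blast
qed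

lemma lift:
  assumes U: "zariski_open U" and t: "t \<in> sect E U" and v: "v \<in> U"
  obtains V \<tau> where "zariski_open V" "v \<in> V" "V \<subseteq> U" "\<tau> \<in> sect K V" "\<pi> V \<tau> = restr E U V t"
proof -
  have "t \<in> image_sections proj_space K E \<pi> U" using \<pi>_surj t opn[OF U] unfolding sheaf_surj_def by blast
  then have "\<exists>V\<in>opens proj_space. v \<in> V \<and> V \<subseteq> U \<and> restr E U V t \<in> \<pi> V ` sect K V"
    using v unfolding image_sections_def by blast
  then show ?thesis using that by (auto simp: opens_proj)
qed

text \<open>Away from the origin a local section with value \<open>u\<close> transfers the equation
  from sheaves to matrices; at the origin, where no section lives, linearity in the point gives
  it.\<close>

lemma bm_am: "u \<in> Kn c \<Longrightarrow> bm v (am v u) = 0"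
proof (cases "v = 0")
  case True
  have "bm (0 *s v) w = 0 \<star> bm v w" for w by (rule bm(3))
  then have "bm v (am v u) = 0 \<star> bm v (am v u)" using True by simp
  then show ?thesis by (simp only: fv.scale_zero_left)
next
  case False
  assume u: "u \<in> Kn c"
  have vP: "v \<in> proj_space" using False by (simp add: proj_space_def)
  obtain V s where V: "zariski_open V" "v \<in> V" "s \<in> sect (twist_power (- 1) c) V" "ev s v = u"
    by (rule sect_with_value[OF zariski_open_proj vP _ u, of "- 1"]) (simp, rule that)
  have "ev (b V (a V s)) v = bm v (am v u)"
    using bm(5)[OF V(1) K_sect[OF a_closed[OF V(1,3)]] V(2)] am(5)[OF V(1,3,2)] V(4) by simp
  then show ?thesis using ba[OF V(1,3)] by (simp add: ev_def zero_fun_def)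
qed

lemma bm_surj:
  assumes v: "v \<noteq> 0" and p: "p \<in> Kn c"
  shows "\<exists>w\<in>Kn N. bm v w = p"
proof -
  have vP: "v \<in> proj_space" using v by (simp add: proj_space_def)
  obtain V t where V: "zariski_open V" "v \<in> V" "t \<in> sect (twist_power 1 c) V" "ev t v = p"
    by (rule sect_with_value[OF zariski_open_proj vP _ p, of 1]) (simp, rule that)
  have "t \<in> image_sections proj_space (twist_power 0 N) (twist_power 1 c) b V"
    using b_surj V(3) opn[OF V(1)] unfolding sheaf_surj_def by blast
  then have "\<exists>W\<in>opens proj_space. v \<in> W \<and> W \<subseteq> V \<and>
      restr (twist_power 1 c) V W t \<in> b W ` sect (twist_power 0 N) W"
    using V(2) unfolding image_sections_def by blast
  then obtain W s where W: "zariski_open W" "v \<in> W" "s \<in> sect (twist_power 0 N) W" "(\<lambda>i. cut W (t i)) = b W s"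
    by (auto simp: opens_proj twist_power_simps)
  have "bm v (ev s v) = p" using bm(5)[OF W(1,3,2)] ev_cut[OF W(2), of t] W(4) V(4) by simp
  then show ?thesis using ev_Kn[OF W(3)] by blast
qed

text \<open>The \<open>\<kappa> j\<close> are the images of the unit vectors under a regular map
  from the trivial bundle to the kernel of \<open>b\<close> that is the identity on the kernel. They
  exhibit the kernel over \<open>V\<close> as a direct summand.\<close>

definition good :: "('k ^ 'n) set \<Rightarrow> (nat \<Rightarrow> nat \<Rightarrow> 'k ^ 'n \<Rightarrow> 'k) \<Rightarrow> bool" where
  "good V \<kappa> \<longleftrightarrow> zariski_open V \<and> (\<forall>j<N. \<kappa> j \<in> sect K V) \<and>
     (\<forall>v\<in>V. \<forall>w\<in>Kn N. bm v w = 0 \<longrightarrow> (\<Sum>j<N. w j \<star> ev (\<kappa> j) v) = w)"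

text \<open>Local sections \<open>R\<^sub>i\<close> with \<open>b R\<^sub>i = u e\<^sub>i\<close> split \<open>b\<close> near \<open>v\<close>; project the unit vectors along them.\<close>

lemma good_exists:
  assumes v: "v \<noteq> 0"
  obtains V \<kappa> where "good V \<kappa>" "v \<in> V"
proof -
  obtain U u where U: "zariski_open U" "v \<in> U" "u \<in> twist_sections 1 U" "\<And>w. w \<in> U \<Longrightarrow> u w \<noteq> 0"
    using local_unit[OF v, of 1] by auto
  have UP: "U \<subseteq> proj_space" by (rule zariski_open_subset[OF U(1)])
  define P where "P i V \<longleftrightarrow> (\<exists>R\<in>sect (twist_power 0 N) V. \<forall>w\<in>V. bm w (ev R w) = u w \<star> unitv i)" for i V
  obtain V where V: "zariski_open V" "v \<in> V" "V \<subseteq> U" "\<And>i. i < c \<Longrightarrow> P i V"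
  proof (rule common_nbhd[of c v U P])
    fix i assume i: "i < c"
    let ?t = "unit_sect i u"
    have t: "?t \<in> sect (twist_power 1 c) U" by (rule unit_sect_in[OF i U(3) UP])
    then have "?t \<in> image_sections proj_space (twist_power 0 N) (twist_power 1 c) b U"
      using b_surj opn[OF U(1)] unfolding sheaf_surj_def by blast
    then have "\<exists>W\<in>opens proj_space. v \<in> W \<and> W \<subseteq> U \<and>
        restr (twist_power 1 c) U W ?t \<in> b W ` sect (twist_power 0 N) W"
      using U(2) unfolding image_sections_def by blast
    then obtain W R where W: "zariski_open W" "v \<in> W" "W \<subseteq> U" "R \<in> sect (twist_power 0 N) W"
      "(\<lambda>i. cut W (?t i)) = b W R"
      by (auto simp: opens_proj twist_power_simps)
    have "bm w (ev R w) = u w \<star> unitv i" if w: "w \<in> W" for w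
    proof -
      have "bm w (ev R w) = ev ?t w" using bm(5)[OF W(1,4) w] ev_cut[OF w, of ?t] W(5) by simp
      also have "\<dots> = u w \<star> unitv i" by (auto simp: ev_def unit_sect_def unitv_def fun_eq_iff fun_simps)
      finally show ?thesis .
    qed
    then show "\<exists>V. zariski_open V \<and> v \<in> V \<and> V \<subseteq> U \<and> P i V" using W unfolding P_def by blast
  next
    fix i V V' assume PV: "P i V" "V \<subseteq> U" "zariski_open V" "zariski_open V'" "V' \<subseteq> V"
    then obtain R where R: "R \<in> sect (twist_power 0 N) V" "\<forall>w\<in>V. bm w (ev R w) = u w \<star> unitv i"
      unfolding P_def by blast
    have "(\<lambda>i. cut V' (R i)) \<in> sect (twist_power 0 N) V'" by (rule twist_power_cut[OF R(1) PV(5)])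
    moreover have "bm w (ev (\<lambda>i. cut V' (R i)) w) = u w \<star> unitv i" if "w \<in> V'" for w
      using R(2) PV(5) that by (auto simp: ev_cut)
    ultimately show "P i V'" unfolding P_def by blast
  qed (use U in auto)
  from V(4) obtain R where R: "\<And>i. i < c \<Longrightarrow> R i \<in> sect (twist_power 0 N) V"
    "\<And>i w. i < c \<Longrightarrow> w \<in> V \<Longrightarrow> bm w (ev (R i) w) = u w \<star> unitv i"
    unfolding P_def by metis
  have VP: "V \<subseteq> proj_space" by (rule zariski_open_subset[OF V(1)])
  have uV: "(\<lambda>w. inverse (cut V u w)) \<in> twist_sections (- 1) V"
    by (rule tw_inverse[OF tw_cut[OF U(3) V(3)]]) (use U(4) V(3) in auto)
  define e where "e j = unit_sect j (cut V (\<lambda>_ :: 'k ^ 'n. 1 :: 'k))" for j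
  have e: "e j \<in> sect (twist_power 0 N) V" if "j < N" for j
    unfolding e_def by (rule unit_sect_in[OF that tw_const[OF VP] VP])
  have ev_e: "ev (e j) w = unitv j" if "w \<in> V" for j w
    using that by (auto simp: e_def ev_def unit_sect_def unitv_def fun_eq_iff)
  \<comment> \<open>The minus sign of the projection is put into the coefficients, because
    \<open>lin_comb\<close> only adds. Division by the generator \<open>u\<close> turns sections of
    \<open>twist 1\<close> into regular functions.\<close>
  define x where "x j i w = - (b V (e j) i w * inverse (cut V u w))" for j i w
  have x: "x j i \<in> twist_sections 0 V" if "j < N" "i < c" for j i
  proof -
    have "b V (e j) i \<in> twist_sections 1 V"
      using sheaf_mor_closed[OF b_mor opn[OF V(1)] e[OF that(1)]] that(2) by (simp add: sect_twist_power)
    from tw_mult[OF this uV] have "(\<lambda>w. b V (e j) i w * inverse (cut V u w)) \<in> twist_sections 0 V" by simp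
    from tw_mult[OF tw_const[OF VP, of "- 1"] this]
    have m: "(\<lambda>w. cut V (\<lambda>_. - 1) w * (b V (e j) i w * inverse (cut V u w))) \<in> twist_sections 0 V" by simp
    have "x j i = (\<lambda>w. cut V (\<lambda>_. - 1) w * (b V (e j) i w * inverse (cut V u w)))"
      using tw_off[OF uV] by (auto simp: x_def fun_eq_iff cut_def)
    then show ?thesis using m by simp
  qed
  define \<kappa> where "\<kappa> j = (\<lambda>i w. e j i w + lin_comb c (x j) R i w)" for j
  have ev_b: "ev (b V (e j)) w = bm w (unitv j)" if "j < N" "w \<in> V" for j w
    using bm(5)[OF V(1) e[OF that(1)] that(2)] ev_e[OF that(2)] by simp
  have xw: "x j i w = - (bm w (unitv j) i / u w)" if "j < N" "w \<in> V" for i j w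
    using fun_cong[OF ev_b[OF that], of i] that(2) by (simp add: x_def ev_def divide_inverse)
  have ev\<kappa>: "ev (\<kappa> j) w = unitv j - (\<Sum>i<c. (bm w (unitv j) i / u w) \<star> ev (R i) w)" if "j < N" "w \<in> V" for j w
    unfolding \<kappa>_def ev_add ev_lin_comb ev_e[OF that(2)] xw[OF that]
    by (simp add: sum_negf)
  have expand_u: "(\<Sum>i<c. (bm w z i / u w) \<star> (u w \<star> unitv i)) = bm w z" if "w \<in> V" for w z
  proof -
    have "u w \<noteq> 0" using U(4) V(3) that by blast
    then show ?thesis using Kn_expand[OF bm(4)[of w z]] by simp
  qed
  have "\<kappa> j \<in> sect K V" if j: "j < N" for j
    unfolding sect_K[OF V(1)]
  proof (intro conjI ballI)
    have "lin_comb c (x j) R \<in> sect (twist_power 0 N) V"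
      by (rule lin_comb_induct[OF twist_power_zero[OF VP] twist_power_add twist_power_smult0])
        (use R(1) x j in auto)
    then show "\<kappa> j \<in> sect (twist_power 0 N) V"
      unfolding \<kappa>_def by (rule twist_power_add[OF e[OF j]])
    fix w assume w: "w \<in> V"
    have "bm w (ev (\<kappa> j) w) = bm w (unitv j) - (\<Sum>i<c. (bm w (unitv j) i / u w) \<star> bm w (ev (R i) w))"
      unfolding ev\<kappa>[OF j w] by (simp add: lin_diff[OF bm(1)] lin_sum[OF bm(1)] lin_scale[OF bm(1)])
    also have "(\<Sum>i<c. (bm w (unitv j) i / u w) \<star> bm w (ev (R i) w)) = bm w (unitv j)"
      using expand_u[OF w, of "unitv j"] R(2)[OF _ w] by (simp del: fv.scale_scale)
    finally show "bm w (ev (\<kappa> j) w) = 0" by simp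
  qed
  moreover have "(\<Sum>j<N. z j \<star> ev (\<kappa> j) w) = z" if w: "w \<in> V" and z: "z \<in> Kn N" "bm w z = 0" for w z
  proof -
    have z0: "(\<Sum>j<N. z j * bm w (unitv j) i) = 0" for i
    proof -
      have "bm w z = bm w (\<Sum>j<N. z j \<star> unitv j)" using Kn_expand[OF z(1)] by (rule arg_cong)
      also have "\<dots> = (\<Sum>j<N. z j \<star> bm w (unitv j))" by (simp only: lin_sum[OF bm(1)] lin_scale[OF bm(1)])
      finally have "0 = (\<Sum>j<N. z j \<star> bm w (unitv j)) i" using z(2) by (simp add: zero_fun_apply)
      then show ?thesis by (simp add: sum_fun_apply fun_simps)
    qed
    have "(\<Sum>j<N. z j \<star> ev (\<kappa> j) w) =
        (\<Sum>j<N. z j \<star> unitv j) - (\<Sum>j<N. z j \<star> (\<Sum>i<c. (bm w (unitv j) i / u w) \<star> ev (R i) w))"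
      unfolding sum_subtractf[symmetric]
      by (rule sum.cong) (use w in \<open>auto simp: ev\<kappa> fv.scale_right_diff_distrib\<close>)
    also have "(\<Sum>j<N. z j \<star> (\<Sum>i<c. (bm w (unitv j) i / u w) \<star> ev (R i) w)) =
        (\<Sum>i<c. ((\<Sum>j<N. z j * bm w (unitv j) i) / u w) \<star> ev (R i) w)"
      unfolding fv.scale_sum_right by (subst sum.swap)
        (simp add: fv.scale_sum_left sum_divide_distrib)
    also have "\<dots> = 0" by (simp add: z0)
    finally show ?thesis using Kn_expand[OF z(1)] by simp
  qed
  ultimately have "good V \<kappa>" using V(1) unfolding good_def by blast
  then show ?thesis using that V(2) by blast
qed

lemma good_cut:
  assumes "good V \<kappa>" "zariski_open W" "W \<subseteq> V"
  shows "good W (\<lambda>j i. cut W (\<kappa> j i))"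
  using assms K_cut[of V W] unfolding good_def by (auto simp: ev_cut subset_iff)

text \<open>The coefficients are the coordinates of \<open>s\<close> itself, since the projection
  encoded by \<open>\<kappa>\<close> fixes the values of \<open>s\<close>.\<close>

lemma good_expand:
  assumes g: "good V \<kappa>" and s: "s \<in> sect K V"
  shows "s = lin_comb N s \<kappa>"
proof (rule twist_power_eqI)
  have V: "zariski_open V" and \<kappa>: "\<And>j. j < N \<Longrightarrow> \<kappa> j \<in> sect K V" using g unfolding good_def by auto
  show s': "s \<in> sect (twist_power 0 N) V" by (rule K_sect[OF s])
  then have "lin_comb N s \<kappa> \<in> sect K V"
    by (intro K_lin_comb[OF V]) (auto simp: \<kappa> sect_twist_power)
  then show "lin_comb N s \<kappa> \<in> sect (twist_power 0 N) V" by (rule K_sect)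
  fix v assume v: "v \<in> V"
  have "ev s v \<in> Kn N" "bm v (ev s v) = 0" using ev_Kn[OF s'] s v by (auto simp: sect_K[OF V])
  then show "ev s v = ev (lin_comb N s \<kappa>) v"
    using g v unfolding good_def ev_lin_comb by (simp add: ev_def)
qed

text \<open>The constant vector \<open>w\<close> is pushed into the kernel. At each point of
  \<open>V\<close> where \<open>w\<close> already lies in the kernel the value is \<open>w\<close>,
  so one section follows a vector that is killed along a line.\<close>

definition const_sect :: "('k ^ 'n) set \<Rightarrow> (nat \<Rightarrow> nat \<Rightarrow> 'k ^ 'n \<Rightarrow> 'k) \<Rightarrow> (nat \<Rightarrow> 'k) \<Rightarrow> nat \<Rightarrow> 'k ^ 'n \<Rightarrow> 'k" where
  "const_sect V \<kappa> w = lin_comb N (\<lambda>j. cut V (\<lambda>_. w j)) \<kappa>"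

lemma const_sect:
  assumes "good V \<kappa>"
  shows "const_sect V \<kappa> w \<in> sect K V"
    and "\<lbrakk>v \<in> V; w \<in> Kn N; bm v w = 0\<rbrakk> \<Longrightarrow> ev (const_sect V \<kappa> w) v = w"
proof -
  have V: "zariski_open V" using assms unfolding good_def by blast
  show "const_sect V \<kappa> w \<in> sect K V"
    unfolding const_sect_def using assms tw_const[OF zariski_open_subset[OF V]]
    by (intro K_lin_comb[OF V]) (auto simp: good_def)
  show "\<lbrakk>v \<in> V; w \<in> Kn N; bm v w = 0\<rbrakk> \<Longrightarrow> ev (const_sect V \<kappa> w) v = w"
    using assms unfolding const_sect_def ev_lin_comb good_def by simp
qed

lemma good_nbhd:
  assumes "zariski_open U" "v \<in> U"
  obtains V \<kappa> where "good V \<kappa>" "v \<in> V" "V \<subseteq> U"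
proof -
  obtain V \<kappa> where "good V \<kappa>" "v \<in> V" using good_exists[OF open_nonzero[OF assms]] by blast
  moreover from this have "zariski_open (V \<inter> U)" unfolding good_def using zariski_open_Int assms(1) by blast
  ultimately show ?thesis using good_cut[of V \<kappa> "V \<inter> U"] that[of "V \<inter> U"] assms(2) by auto
qed

text \<open>Expansion of a germ in \<open>\<kappa>\<close> shows that such a functional sees only
  the value of the section at \<open>v\<close>. Linear functionals on \<open>Kn N\<close> thereby
  replace stalks and fibres of sheaves.\<close>

lemma germ_linear:
  assumes U: "zariski_open U" "v \<in> U"
    and add: "\<And>V s t. \<lbrakk>zariski_open V; v \<in> V; V \<subseteq> U; s \<in> sect K V; t \<in> sect K V\<rbrakk> \<Longrightarrow>
      \<theta> V (\<lambda>i v. s i v + t i v) = \<theta> V s + \<theta> V t"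
    and smult: "\<And>V x s. \<lbrakk>zariski_open V; v \<in> V; V \<subseteq> U; x \<in> twist_sections 0 V; s \<in> sect K V\<rbrakk> \<Longrightarrow>
      \<theta> V (\<lambda>i v. x v * s i v) = x v * \<theta> V s"
    and res: "\<And>V W s. \<lbrakk>zariski_open V; zariski_open W; v \<in> W; W \<subseteq> V; V \<subseteq> U; s \<in> sect K V\<rbrakk> \<Longrightarrow>
      \<theta> W (\<lambda>i. cut W (s i)) = \<theta> V s"
  obtains g where "linf g" "\<And>V s. \<lbrakk>zariski_open V; v \<in> V; V \<subseteq> U; s \<in> sect K V\<rbrakk> \<Longrightarrow> \<theta> V s = g (ev s v)"
proof -
  obtain V0 \<kappa> where V0: "good V0 \<kappa>" "v \<in> V0" "V0 \<subseteq> U" using good_nbhd[OF U] by blast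
  have V0o: "zariski_open V0" and \<kappa>: "\<And>j. j < N \<Longrightarrow> \<kappa> j \<in> sect K V0" using V0(1) unfolding good_def by auto
  define g where "g w = (\<Sum>j<N. w j * \<theta> V0 (\<kappa> j))" for w
  have "linf g" unfolding g_def
    by (intro linfI) (simp_all add: fun_simps algebra_simps sum.distrib sum_distrib_left)
  moreover have "\<theta> V s = g (ev s v)" if V: "zariski_open V" "v \<in> V" "V \<subseteq> U" and s: "s \<in> sect K V" for V s
  proof -
    let ?W = "V \<inter> V0"
    have W: "zariski_open ?W" by (rule zariski_open_Int[OF V(1) V0o])
    have vW: "v \<in> ?W" "?W \<subseteq> U" using V V0 by auto
    let ?s = "\<lambda>i. cut ?W (s i)" and ?\<kappa> = "\<lambda>j i. cut ?W (\<kappa> j i)"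
    have gW: "good ?W ?\<kappa>" by (rule good_cut[OF V0(1) W]) simp
    have sW: "?s \<in> sect K ?W" by (rule K_cut[OF V(1) W _ s]) simp
    have "\<theta> V s = \<theta> ?W ?s" by (rule res[OF V(1) W vW(1) _ V(3) s, symmetric]) simp
    also have "\<dots> = \<theta> ?W (lin_comb N ?s ?\<kappa>)" using good_expand[OF gW sW] by simp
    also have "\<dots> = (\<Sum>j<N. ?s j v * \<theta> ?W (?\<kappa> j))"
      using gW K_sect[OF sW] unfolding good_def
      by (intro K_functional[OF W] add smult W vW) (auto simp: sect_twist_power)
    also have "\<dots> = (\<Sum>j<N. s j v * \<theta> V0 (\<kappa> j))"
    proof (rule sum.cong[OF refl])
      fix j assume "j \<in> {..<N}"
      then have "\<theta> ?W (?\<kappa> j) = \<theta> V0 (\<kappa> j)" using \<kappa> by (intro res[OF V0o W vW(1) _ V0(3)]) auto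
      then show "?s j v * \<theta> ?W (?\<kappa> j) = s j v * \<theta> V0 (\<kappa> j)" using vW(1) by simp
    qed
    finally show ?thesis by (simp add: g_def ev_def)
  qed
  ultimately show ?thesis using that by blast
qed

text \<open>The fibre of \<open>E\<close> at \<open>v\<close>, which is \<open>ker (bm v) / im (am v)\<close>, has dimension \<open>k\<close>.\<close>

definition fibre :: "'k ^ 'n \<Rightarrow> nat \<Rightarrow> bool" where
  "fibre v k \<longleftrightarrow> (\<exists>P T. lin P \<and> lin T \<and> (\<forall>w. P w \<in> Kn k) \<and>
     (\<forall>z\<in>Kn k. T z \<in> Kn N \<and> bm v (T z) = 0 \<and> P (T z) = z) \<and> (\<forall>u\<in>Kn c. P (am v u) = 0) \<and>
     (\<forall>w\<in>Kn N. bm v w = 0 \<longrightarrow> (\<exists>u\<in>Kn c. w - T (P w) = am v u)))"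

section \<open>The dimension of the fibres\<close>

lemma fibre_le:
  assumes "fibre v k" "fibre v l"
  shows "k \<le> l"
proof -
  obtain P T where 1: "lin P" "lin T" "\<forall>w. P w \<in> Kn k" "\<forall>z\<in>Kn k. T z \<in> Kn N \<and> bm v (T z) = 0 \<and> P (T z) = z"
    "\<forall>u\<in>Kn c. P (am v u) = 0" using assms(1) unfolding fibre_def by blast
  obtain P' T' where 2: "lin P'" "lin T'" "\<forall>w. P' w \<in> Kn l"
    "\<forall>w\<in>Kn N. bm v w = 0 \<longrightarrow> (\<exists>u\<in>Kn c. w - T' (P' w) = am v u)" using assms(2) unfolding fibre_def by blast
  show ?thesis
  proof (rule lin_inj_le[OF lin_comp[OF 1(2) 2(1)]])
    show "(\<lambda>u. P' (T u)) ` Kn k \<subseteq> Kn l" using 2(3) by auto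
    fix z :: "nat \<Rightarrow> 'k" assume z: "z \<in> Kn k" "P' (T z) = 0"
    obtain u where "u \<in> Kn c" "T z - T' (P' (T z)) = am v u" using 1(4) 2(4) z(1) by blast
    then have "T z = am v u" using z(2) by (simp add: lin_0[OF 2(2)])
    then have "P (T z) = 0" using 1(5) \<open>u \<in> Kn c\<close> by simp
    then show "z = 0" using 1(4) z(1) by simp
  qed
qed

text \<open>Dimension count with \<open>N = c + r + c\<close>: a right inverse of
  \<open>bm v\<close>, the lift \<open>T\<close> of the fibre and \<open>am v\<close> combine to a
  map of \<open>Kn N\<close> onto itself. It is then injective, in particular on the block where it
  is \<open>am v\<close>.\<close>

lemma fibre_injective:
  assumes f: "fibre v r" and v: "v \<noteq> 0" and u: "u \<in> Kn c" "am v u = 0"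
  shows "u = 0"
proof -
  obtain P T where 1: "lin P" "lin T" "\<forall>w. P w \<in> Kn r" "\<forall>z\<in>Kn r. T z \<in> Kn N \<and> bm v (T z) = 0 \<and> P (T z) = z"
    "\<forall>u\<in>Kn c. P (am v u) = 0" "\<forall>w\<in>Kn N. bm v w = 0 \<longrightarrow> (\<exists>u\<in>Kn c. w - T (P w) = am v u)"
    using f unfolding fibre_def by blast
  have "Kn c \<subseteq> bm v ` Kn N" using bm_surj[OF v] by blast
  moreover obtain R where R: "range R \<subseteq> Kn N" "lin R" "\<forall>p\<in>bm v ` Kn N. bm v (R p) = p"
    using fvp.linear_exists_right_inverse_on[OF bm(1)[of v] subspace_Kn] by blast
  ultimately have R': "bm v (R p) = p" "R p \<in> Kn N" if "p \<in> Kn c" for p using that by blast+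
  define part where "part k l w = (\<lambda>i. if i < l then w (k + i) else 0)" for k l and w :: "nat \<Rightarrow> 'k"
  have part: "lin (part k l)" "part k l w \<in> Kn l" for k l w
    by (auto intro!: linI simp: part_def fun_eq_iff fun_simps Kn_def)
  define \<Phi> where "\<Phi> w = R (part 0 c w) + T (part c r w) + am v (part (c + r) c w)" for w
  have lin\<Phi>: "lin \<Phi>"
    unfolding \<Phi>_def
    by (intro linI) (simp_all add: lin_add[OF part(1)] lin_add[OF R(2)] lin_add[OF 1(2)] lin_add[OF am(1)]
        lin_scale[OF part(1)] lin_scale[OF R(2)] lin_scale[OF 1(2)] lin_scale[OF am(1)] fv.scale_right_distrib)
  have "\<Phi> ` Kn N = Kn N"
  proof
    show "\<Phi> ` Kn N \<subseteq> Kn N"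
      unfolding \<Phi>_def using R' 1(4) part(2) am(4) by (intro image_subsetI Kn_add) auto
    show "Kn N \<subseteq> \<Phi> ` Kn N"
    proof
      fix w :: "nat \<Rightarrow> 'k" assume w: "w \<in> Kn N"
      let ?p = "bm v w"
      let ?w = "w - R ?p"
      have "bm v ?w = 0" "?w \<in> Kn N" using R' bm(4) w by (auto simp: lin_diff[OF bm(1)])
      then obtain u where u: "u \<in> Kn c" "?w - T (P ?w) = am v u" using 1(6) by blast
      let ?z = "\<lambda>i. if i < c then ?p i else if i < c + r then P ?w (i - c) else if i < N then u (i - (c + r)) else 0"
      have "part 0 c ?z = ?p" using bm(4)[of v w] by (auto simp: part_def Kn_def fun_eq_iff)
      moreover have "part c r ?z = P ?w" using 1(3) by (auto simp: part_def Kn_def fun_eq_iff)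
      moreover have "part (c + r) c ?z = u" using u(1) N by (auto simp: part_def Kn_def fun_eq_iff)
      ultimately have "w = \<Phi> ?z" using u(2) by (simp add: \<Phi>_def algebra_simps)
      moreover have "?z \<in> Kn N" using N by (auto simp: Kn_def)
      ultimately show "w \<in> \<Phi> ` Kn N" by (rule image_eqI)
    qed
  qed
  moreover define z where "z = (\<lambda>i. if c + r \<le> i \<and> i < N then u (i - (c + r)) else 0)"
  have "part 0 c z = 0" "part c r z = 0" using N by (auto simp: part_def z_def fun_eq_iff zero_fun_apply)
  moreover have "part (c + r) c z = u" using u(1) N by (auto simp: part_def z_def Kn_def fun_eq_iff)
  ultimately have "\<Phi> z = 0" using u(2) by (simp add: \<Phi>_def lin_0[OF R(2)] lin_0[OF 1(2)])
  moreover have "z \<in> Kn N" by (auto simp: z_def Kn_def)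
  ultimately have "z = 0" using lin_surj_inj[OF lin\<Phi> \<open>\<Phi> ` Kn N = Kn N\<close>] by blast
  then have "part (c + r) c z = 0" by (simp add: lin_0[OF part(1)])
  then show ?thesis using \<open>part (c + r) c z = u\<close> by simp
qed

text \<open>By \<open>germ_linear\<close> the \<open>\<theta> j\<close> descend to values at
  \<open>v\<close> and give \<open>P\<close>, the dual sections \<open>\<tau> j\<close> give
  \<open>T\<close>, and \<open>ker\<close> accounts for what is left. It is applied to a frame of
  \<open>E\<close> and to the trivialisation on the line.\<close>

lemma fibre_of_germs:
  assumes U: "zariski_open U" "v \<in> U"
    and add: "\<And>j V s t. \<lbrakk>zariski_open V; v \<in> V; V \<subseteq> U; s \<in> sect K V; t \<in> sect K V\<rbrakk> \<Longrightarrow>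
      \<theta> j V (\<lambda>i v. s i v + t i v) = \<theta> j V s + \<theta> j V t"
    and smult: "\<And>j V x s. \<lbrakk>zariski_open V; v \<in> V; V \<subseteq> U; x \<in> twist_sections 0 V; s \<in> sect K V\<rbrakk> \<Longrightarrow>
      \<theta> j V (\<lambda>i v. x v * s i v) = x v * \<theta> j V s"
    and res: "\<And>j V W s. \<lbrakk>zariski_open V; zariski_open W; v \<in> W; W \<subseteq> V; V \<subseteq> U; s \<in> sect K V\<rbrakk> \<Longrightarrow>
      \<theta> j W (\<lambda>i. cut W (s i)) = \<theta> j V s"
    and a0: "\<And>j V \<sigma>. \<lbrakk>zariski_open V; v \<in> V; V \<subseteq> U; \<sigma> \<in> sect (twist_power (- 1) c) V\<rbrakk> \<Longrightarrow> \<theta> j V (a V \<sigma>) = 0"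
    and lifts: "zariski_open U'" "v \<in> U'" "U' \<subseteq> U" "\<And>j. j < k \<Longrightarrow> \<tau> j \<in> sect K U'"
      "\<And>i j. i < k \<Longrightarrow> j < k \<Longrightarrow> \<theta> i U' (\<tau> j) = (if i = j then 1 else 0)"
    and ker: "\<And>V s. \<lbrakk>zariski_open V; v \<in> V; V \<subseteq> U; s \<in> sect K V; \<And>j. j < k \<Longrightarrow> \<theta> j V s = 0\<rbrakk> \<Longrightarrow>
      \<exists>u\<in>Kn c. ev s v = am v u"
  shows "fibre v k"
proof -
  have "\<exists>g. linf g \<and> (\<forall>V s. zariski_open V \<longrightarrow> v \<in> V \<longrightarrow> V \<subseteq> U \<longrightarrow> s \<in> sect K V \<longrightarrow> \<theta> j V s = g (ev s v))" for j
  proof (rule germ_linear[of U v "\<theta> j", OF U add smult res])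
    fix g assume "linf g" "\<And>V s. \<lbrakk>zariski_open V; v \<in> V; V \<subseteq> U; s \<in> sect K V\<rbrakk> \<Longrightarrow> \<theta> j V s = g (ev s v)"
    then show ?thesis by blast
  qed
  then obtain g where g: "\<And>j. linf (g j)"
    "\<And>j V s. zariski_open V \<Longrightarrow> v \<in> V \<Longrightarrow> V \<subseteq> U \<Longrightarrow> s \<in> sect K V \<Longrightarrow> \<theta> j V s = g j (ev s v)"
    by metis
  define P where "P w = (\<lambda>j. if j < k then g j w else 0)" for w
  define T where "T z = (\<Sum>j<k. z j \<star> ev (\<tau> j) v)" for z
  have linP: "lin P" unfolding P_def
    by (intro linI) (auto simp: fun_eq_iff fun_simps linf_add[OF g(1)] linf_scale[OF g(1)])
  have linT: "lin T" unfolding T_def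
    by (intro linI) (simp_all add: fun_simps fv.scale_left_distrib sum.distrib fv.scale_sum_right)
  have TK: "T z \<in> Kn N" "bm v (T z) = 0" for z
  proof -
    have \<tau>: "ev (\<tau> j) v \<in> Kn N" "bm v (ev (\<tau> j) v) = 0" if "j < k" for j
      using lifts(2) lifts(4)[OF that] ev_Kn[OF K_sect[OF lifts(4)[OF that]]] by (auto simp: sect_K[OF lifts(1)])
    show "T z \<in> Kn N" unfolding T_def
      by (intro fv.subspace_sum[OF subspace_Kn] Kn_scale) (use \<tau> in auto)
    show "bm v (T z) = 0" unfolding T_def using \<tau> by (simp add: lin_sum[OF bm(1)] lin_scale[OF bm(1)])
  qed
  have PT: "P (T z) = z" if "z \<in> Kn k" for z :: "nat \<Rightarrow> 'k"
  proof
    fix i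
    have "g i (T z) = (\<Sum>j<k. z j * g i (ev (\<tau> j) v))"
      unfolding T_def by (simp add: linf_sum[OF g(1)] linf_scale[OF g(1)])
    also have "\<dots> = (\<Sum>j<k. if i = j then z j else 0)" if "i < k"
      using lifts(5)[OF that] g(2)[OF lifts(1-4)] by (intro sum.cong) auto
    finally have "g i (T z) = z i" if "i < k" using that by simp
    then show "P (T z) i = z i" using \<open>z \<in> Kn k\<close> by (auto simp: P_def Kn_def)
  qed
  have Pa: "P (am v u) = 0" if u: "u \<in> Kn c" for u
  proof -
    obtain V \<sigma> where V: "zariski_open V" "v \<in> V" "V \<subseteq> U" "\<sigma> \<in> sect (twist_power (- 1) c) V" "ev \<sigma> v = u"
      by (rule sect_with_value[OF U _ u, of "- 1"]) (simp, rule that)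
    have "g j (am v u) = 0" for j
      using g(2)[OF V(1-3) a_closed[OF V(1,4)], of j] a0[OF V(1-4), of j] am(5)[OF V(1,4,2)] V(5) by simp
    then show ?thesis by (auto simp: P_def fun_eq_iff zero_fun_apply)
  qed
  have "\<exists>u\<in>Kn c. w - T (P w) = am v u" if w: "w \<in> Kn N" "bm v w = 0" for w
  proof -
    have w': "w - T (P w) \<in> Kn N" "bm v (w - T (P w)) = 0"
      using w TK by (auto simp: lin_diff[OF bm(1)])
    obtain V \<kappa> where V: "good V \<kappa>" "v \<in> V" "V \<subseteq> U" using good_nbhd[OF U] by blast
    have Vo: "zariski_open V" using V(1) unfolding good_def by blast
    let ?s = "const_sect V \<kappa> (w - T (P w))"
    have s: "?s \<in> sect K V" "ev ?s v = w - T (P w)"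
      using const_sect[OF V(1)] V(2) w' by auto
    have "\<theta> j V ?s = 0" if "j < k" for j
    proof -
      have "P (w - T (P w)) = 0"
        using PT[of "P w"] by (simp add: lin_diff[OF linP]) (simp add: P_def Kn_def)
      then have "g j (w - T (P w)) = 0" using that by (auto simp: P_def fun_eq_iff zero_fun_apply split: if_splits)
      then show ?thesis using g(2)[OF Vo V(2,3) s(1)] s(2) by simp
    qed
    from ker[OF Vo V(2,3) s(1) this] show ?thesis using s(2) by simp
  qed
  moreover have "P w \<in> Kn k" for w by (simp add: P_def Kn_def)
  ultimately show ?thesis unfolding fibre_def using linP linT TK PT Pa by blast
qed

end

section \<open>Local frames and the induced form\<close>

text \<open>Irreducibility of projective space, reduced to the line through the two points, where
  each open set misses finitely many parameters. If the points agree projectively, invariance under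
  scaling suffices.\<close>

lemma open_sets_meet:
  fixes U V :: "('k::field_char_0 ^ 'n::finite) set"
  assumes "zariski_open U" "v \<in> U" "zariski_open V" "w \<in> V"
  obtains x where "x \<in> U" "x \<in> V"
proof (cases "independent_points v w")
  case False
  have v: "v \<noteq> 0" "w \<noteq> 0" using assms zariski_open_subset by (auto simp: proj_space_def)
  then obtain x where "w = x *s v" using dependent_points[OF False] by blast
  then have "w \<in> U" using zariski_open_conic[OF assms(1,2)] v by auto
  then show ?thesis using that assms(4) by blast
next
  case True
  have nz: "v + t *s w \<noteq> 0" "w + t *s v \<noteq> 0" for t
  proof -
    have "1 *s v + t *s w \<noteq> 0" "t *s v + 1 *s w \<noteq> 0"
      using True unfolding independent_points_def by (metis zero_neq_one)+
    then show "v + t *s w \<noteq> 0" "w + t *s v \<noteq> 0" by (simp_all add: add.commute)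
  qed
  obtain p where p: "poly p 0 \<noteq> 0" "\<And>t. poly p t \<noteq> 0 \<Longrightarrow> v + t *s w \<in> U"
    using zariski_open_line[OF assms(1,2) nz(1)] by blast
  obtain q where q: "poly q 0 \<noteq> 0" "\<And>t. poly q t \<noteq> 0 \<Longrightarrow> w + t *s v \<in> V"
    using zariski_open_line[OF assms(3,4) nz(2)] by blast
  \<comment> \<open>\<open>reflect_poly\<close> carries \<open>q\<close> from the chart centred at
    \<open>w\<close> to the one centred at \<open>v\<close>; the factor \<open>[:0, 1:]\<close>
    excludes \<open>t = 0\<close>, where the change of charts is undefined.\<close>
  have pq: "p * reflect_poly q * [:0, 1:] \<noteq> 0" using p(1) q(1) by auto
  then have "finite {t. poly (p * reflect_poly q * [:0, 1:]) t = 0}" by (rule poly_roots_finite)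
  then obtain t where "poly (p * reflect_poly q * [:0, 1:]) t \<noteq> 0"
    using infinite_UNIV_char_0[where 'a = 'k] by (metis (mono_tags, lifting) UNIV_eq_I mem_Collect_eq)
  then have t: "poly p t \<noteq> 0" "t \<noteq> 0" "poly (reflect_poly q) t \<noteq> 0" by auto
  then have "poly q (inverse t) \<noteq> 0" by (simp add: poly_reflect_poly_nz)
  then have "t *s (w + inverse t *s v) \<in> V" using q(2) zariski_open_conic[OF assms(3)] t(2) by blast
  moreover have "t *s (w + inverse t *s v) = v + t *s w"
    using t(2) by (simp add: Finite_Cartesian_Product.vec_eq_iff field_simps)
  ultimately show ?thesis using that p(2)[OF t(1)] by simp
qed

context instanton
begin

section \<open>Local frames of the bundle\<close>

lemma E_group: "zariski_open U \<Longrightarrow> abelian_group (sections E U)"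
  using module_sheaf.module[OF E opn] by (rule Module.module.axioms(2))

lemma E_restr_closed: "\<lbrakk>zariski_open U; zariski_open V; V \<subseteq> U; s \<in> sect E U\<rbrakk> \<Longrightarrow> restr E U V s \<in> sect E V"
  by (rule module_sheaf.restr_closed[OF E opn opn])

definition frame :: "('k ^ 'n) set \<Rightarrow> nat \<Rightarrow> ('k ^ 'n, 'm, nat \<Rightarrow> 'k ^ 'n \<Rightarrow> 'k) sheaf_map \<Rightarrow> bool" where
  "frame U k f \<longleftrightarrow> zariski_open U \<and> sheaf_iso U E (twist_power 0 k) f"

lemma frame_exists:
  assumes "v \<noteq> 0"
  obtains U k f where "frame U k f" "v \<in> U"
proof -
  have "v \<in> proj_space" using assms by (simp add: proj_space_def)
  then have "\<exists>U\<in>opens proj_space. v \<in> U \<and> (\<exists>k f. sheaf_iso U E (twist_power 0 k) f)"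
    using lf unfolding locally_free_def by blast
  then show ?thesis using that unfolding frame_def opens_proj by blast
qed

context
  fixes U :: "('k ^ 'n) set" and k :: nat and f :: "('k ^ 'n, 'm, nat \<Rightarrow> 'k ^ 'n \<Rightarrow> 'k) sheaf_map"
  assumes fr: "frame U k f"
begin

lemma Uo: "zariski_open U"
  using fr unfolding frame_def by blast

lemma f_mor: "sheaf_mor U E (twist_power 0 k) f"
  using fr unfolding frame_def sheaf_iso_def by blast

lemma opnU: "zariski_open V \<Longrightarrow> V \<subseteq> U \<Longrightarrow> V \<in> opens U"
  using opens_open[OF Uo] by blast

lemma f_bij: "zariski_open V \<Longrightarrow> V \<subseteq> U \<Longrightarrow> bij_betw (f V) (sect E V) (sect (twist_power 0 k) V)"
  using fr opnU unfolding frame_def sheaf_iso_def by blast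

lemma p_closed: "\<lbrakk>zariski_open V; V \<subseteq> U; s \<in> sect K V\<rbrakk> \<Longrightarrow> f V (\<pi> V s) \<in> sect (twist_power 0 k) V"
  by (rule sheaf_mor_closed[OF f_mor opnU \<pi>_closed])

lemma f_add: "\<lbrakk>zariski_open V; V \<subseteq> U; s \<in> sect E V; t \<in> sect E V\<rbrakk> \<Longrightarrow>
    f V (s \<oplus>\<^bsub>sections E V\<^esub> t) = (\<lambda>i v. f V s i v + f V t i v)"
  using sheaf_mor_add[OF f_mor opnU, of V s t] by (simp add: twist_power_simps)

lemma f_smult: "\<lbrakk>zariski_open V; V \<subseteq> U; x \<in> twist_sections 0 V; s \<in> sect E V\<rbrakk> \<Longrightarrow>
    f V (x \<odot>\<^bsub>sections E V\<^esub> s) = (\<lambda>i v. x v * f V s i v)"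
  using sheaf_mor_smult[OF f_mor opnU, of V x s] by (simp add: twist_power_simps)

lemma f_restr: "\<lbrakk>zariski_open V; zariski_open W; W \<subseteq> V; V \<subseteq> U; s \<in> sect E V\<rbrakk> \<Longrightarrow>
    f W (restr E V W s) = (\<lambda>i. cut W (f V s i))"
  using sheaf_mor_restr[OF f_mor opnU opnU, of V W s] by (simp add: twist_power_simps)

lemma f_zero: 
  assumes "zariski_open V" "V \<subseteq> U"
  shows "f V \<zero>\<^bsub>sections E V\<^esub> = (\<lambda>i v. 0)"
proof -
  interpret abelian_group "sections E V" by (rule E_group[OF assms(1)])
  have "f V \<zero>\<^bsub>sections E V\<^esub> = (\<lambda>i v. f V \<zero>\<^bsub>sections E V\<^esub> i v + f V \<zero>\<^bsub>sections E V\<^esub> i v)"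
    using f_add[OF assms zero_closed zero_closed] by simp
  then have "f V \<zero>\<^bsub>sections E V\<^esub> i v = f V \<zero>\<^bsub>sections E V\<^esub> i v + f V \<zero>\<^bsub>sections E V\<^esub> i v" for i v
    by metis
  then show ?thesis by (metis add_cancel_right_right)
qed

lemma p_add: "\<lbrakk>zariski_open V; V \<subseteq> U; s \<in> sect K V; t \<in> sect K V\<rbrakk> \<Longrightarrow>
    f V (\<pi> V (\<lambda>i v. s i v + t i v)) = (\<lambda>i v. f V (\<pi> V s) i v + f V (\<pi> V t) i v)"
  by (simp add: \<pi>_add f_add \<pi>_closed)

lemma p_smult: "\<lbrakk>zariski_open V; V \<subseteq> U; x \<in> twist_sections 0 V; s \<in> sect K V\<rbrakk> \<Longrightarrow>
    f V (\<pi> V (\<lambda>i v. x v * s i v)) = (\<lambda>i v. x v * f V (\<pi> V s) i v)"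
  by (simp add: \<pi>_smult f_smult \<pi>_closed)

lemma p_cut: "\<lbrakk>zariski_open V; zariski_open W; W \<subseteq> V; V \<subseteq> U; s \<in> sect K V\<rbrakk> \<Longrightarrow>
    f W (\<pi> W (\<lambda>i. cut W (s i))) = (\<lambda>i. cut W (f V (\<pi> V s) i))"
  by (simp add: \<pi>_restr f_restr \<pi>_closed)

lemma p_a: "\<lbrakk>zariski_open V; V \<subseteq> U; \<sigma> \<in> sect (twist_power (- 1) c) V\<rbrakk> \<Longrightarrow> f V (\<pi> V (a V \<sigma>)) = (\<lambda>i v. 0)"
  by (simp add: \<pi>_a f_zero)

lemma p_zero:
  assumes V: "zariski_open V" "V \<subseteq> U" and s: "s \<in> sect K V" "f V (\<pi> V s) = (\<lambda>i v. 0)"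
  shows "\<pi> V s = \<zero>\<^bsub>sections E V\<^esub>"
proof -
  interpret abelian_group "sections E V" by (rule E_group[OF V(1)])
  have "f V (\<pi> V s) = f V \<zero>\<^bsub>sections E V\<^esub>" using s(2) f_zero[OF V] by simp
  then show ?thesis
    using f_bij[OF V] \<pi>_closed[OF V(1) s(1)] zero_closed unfolding bij_betw_def inj_on_def by blast
qed

lemma p_lifts:
  assumes V: "zariski_open V" "V \<subseteq> U" "v \<in> V"
  obtains W \<tau> where "zariski_open W" "v \<in> W" "W \<subseteq> V" "\<And>j. j < k \<Longrightarrow> \<tau> j \<in> sect K W"
    "\<And>j. j < k \<Longrightarrow> f W (\<pi> W (\<tau> j)) = unit_sect j (cut W (\<lambda>_. 1))"
proof -
  define P where "P j W \<longleftrightarrow> (\<exists>\<tau>\<in>sect K W. f W (\<pi> W \<tau>) = unit_sect j (cut W (\<lambda>_. 1)))" for j W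
  have VP: "V \<subseteq> proj_space" by (rule zariski_open_subset[OF V(1)])
  obtain W where W: "zariski_open W" "v \<in> W" "W \<subseteq> V" "\<And>j. j < k \<Longrightarrow> P j W"
  proof (rule common_nbhd[of k v V P])
    fix j assume j: "j < k"
    let ?e = "unit_sect j (cut V (\<lambda>_. 1 :: 'k))"
    have "?e \<in> sect (twist_power 0 k) V" by (rule unit_sect_in[OF j tw_const[OF VP] VP])
    then have "?e \<in> f V ` sect E V" using f_bij[OF V(1,2)] by (simp add: bij_betw_imp_surj_on)
    then obtain t where t: "t \<in> sect E V" "f V t = ?e" by (metis imageE)
    obtain W \<tau> where W: "zariski_open W" "v \<in> W" "W \<subseteq> V" "\<tau> \<in> sect K W" "\<pi> W \<tau> = restr E V W t"
      by (rule lift[OF V(1) t(1) V(3)]) (rule that)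
    have "f W (\<pi> W \<tau>) = (\<lambda>i. cut W (?e i))" using f_restr[OF V(1) W(1,3) V(2) t(1)] t(2) W(5) by simp
    also have "\<dots> = unit_sect j (cut W (\<lambda>_. 1))"
      unfolding unit_sect_cut cut_cut[OF W(3)] ..
    finally have "P j W" unfolding P_def using W(4) by blast
    then show "\<exists>W. zariski_open W \<and> v \<in> W \<and> W \<subseteq> V \<and> P j W" using W(1-3) by blast
  next
    fix j W W' assume PW: "P j W" "W \<subseteq> V" "zariski_open W" "zariski_open W'" "W' \<subseteq> W"
    then obtain \<tau> where \<tau>: "\<tau> \<in> sect K W" "f W (\<pi> W \<tau>) = unit_sect j (cut W (\<lambda>_. 1))"
      unfolding P_def by blast
    have "f W' (\<pi> W' (\<lambda>i. cut W' (\<tau> i))) = (\<lambda>i. cut W' (unit_sect j (cut W (\<lambda>_. 1)) i))"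
      using p_cut[OF PW(3,4,5) _ \<tau>(1)] PW(2) V(2) \<tau>(2) by auto
    also have "\<dots> = unit_sect j (cut W' (\<lambda>_. 1))" unfolding unit_sect_cut cut_cut[OF PW(5)] ..
    finally show "P j W'" unfolding P_def using K_cut[OF PW(3,4,5) \<tau>(1)] by blast
  qed (use V in auto)
  from W(4) obtain \<tau> where "\<And>j. j < k \<Longrightarrow> \<tau> j \<in> sect K W"
    "\<And>j. j < k \<Longrightarrow> f W (\<pi> W (\<tau> j)) = unit_sect j (cut W (\<lambda>_. 1))"
    unfolding P_def by metis
  then show ?thesis using that[OF W(1-3)] by blast
qed

text \<open>Subtracting from \<open>s\<close> the lifts of the frame, weighted by the coordinates of
  \<open>s\<close>, leaves a section in the kernel of \<open>\<pi>\<close>, and such a section comes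
  locally from \<open>a\<close>.\<close>

lemma frame_decompose:
  assumes V: "zariski_open V" "V \<subseteq> U" "v \<in> V" and s: "s \<in> sect K V"
  obtains W \<tau> \<sigma> where "zariski_open W" "v \<in> W" "W \<subseteq> V" "\<And>j. j < k \<Longrightarrow> \<tau> j \<in> sect K W"
    "\<sigma> \<in> sect (twist_power (- 1) c) W"
    "\<And>w. w \<in> W \<Longrightarrow> ev s w = (\<Sum>j<k. f V (\<pi> V s) j w \<star> ev (\<tau> j) w) + am w (ev \<sigma> w)"
proof -
  obtain W \<tau> where W: "zariski_open W" "v \<in> W" "W \<subseteq> V" "\<And>j. j < k \<Longrightarrow> \<tau> j \<in> sect K W"
    "\<And>j. j < k \<Longrightarrow> f W (\<pi> W (\<tau> j)) = unit_sect j (cut W (\<lambda>_. 1))"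
    by (rule p_lifts[OF V]) (rule that)
  have WU: "W \<subseteq> U" using W(3) V(2) by blast
  have WP: "W \<subseteq> proj_space" by (rule zariski_open_subset[OF W(1)])
  let ?x = "\<lambda>j w. cut W (\<lambda>_. - 1) w * cut W (f V (\<pi> V s) j) w"
  have x: "?x j \<in> twist_sections 0 W" if "j < k" for j
  proof -
    have "f V (\<pi> V s) j \<in> twist_sections 0 V"
      using p_closed[OF V(1,2) s] that by (simp add: sect_twist_power)
    from tw_mult[OF tw_const[OF WP, of "- 1"] tw_cut[OF this W(3)]] show ?thesis by simp
  qed
  let ?s = "\<lambda>i. cut W (s i)" and ?l = "lin_comb k ?x \<tau>"
  define s1 where "s1 = (\<lambda>i w. ?s i w + ?l i w)"
  have sW: "?s \<in> sect K W" by (rule K_cut[OF V(1) W(1,3) s])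
  have lW: "?l \<in> sect K W" by (rule K_lin_comb[OF W(1) x W(4)])
  have s1: "s1 \<in> sect K W" unfolding s1_def by (rule K_add[OF W(1) sW lW])
  have "f W (\<pi> W s1) = (\<lambda>i v. 0)"
  proof (rule twist_power_eqI[OF p_closed[OF W(1) WU s1] twist_power_zero[OF WP]])
    fix w assume w: "w \<in> W"
    have "f W (\<pi> W s1) i w = 0" for i
    proof (cases "i < k")
      case True
      have "f W (\<pi> W ?l) i w = (\<Sum>j<k. ?x j w * f W (\<pi> W (\<tau> j)) i w)"
        by (rule K_functional[where \<theta> = "\<lambda>s. f W (\<pi> W s) i w", OF W(1) _ _ x W(4)])
          (simp_all add: p_add[OF W(1) WU] p_smult[OF W(1) WU])
      also have "\<dots> = (\<Sum>j<k. if i = j then - f V (\<pi> V s) j w else 0)"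
        using w W(5) by (intro sum.cong) (auto simp: unit_sect_def)
      also have "\<dots> = - f V (\<pi> V s) i w" using True by simp
      finally show ?thesis
        using p_add[OF W(1) WU sW lW] p_cut[OF V(1) W(1,3) V(2) s] w by (simp add: s1_def)
    next
      case False
      then show ?thesis using p_closed[OF W(1) WU s1] by (simp add: sect_twist_power)
    qed
    then show "ev (f W (\<pi> W s1)) w = ev (\<lambda>i v. 0) w" by (simp add: ev_def)
  qed
  then have "\<pi> W s1 = \<zero>\<^bsub>sections E W\<^esub>" by (rule p_zero[OF W(1) WU s1])
  then obtain W' \<sigma> where W': "zariski_open W'" "v \<in> W'" "W' \<subseteq> W" "\<sigma> \<in> sect (twist_power (- 1) c) W'"
    "\<And>w. w \<in> W' \<Longrightarrow> ev s1 w = am w (ev \<sigma> w)"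
    using \<pi>_zero_local[OF W(1) s1 _ W(2)] by blast
  have eq: "ev s w = (\<Sum>j<k. f V (\<pi> V s) j w \<star> ev (\<tau> j) w) + am w (ev \<sigma> w)" if w: "w \<in> W'" for w
  proof -
    have wW: "w \<in> W" using w W'(3) by blast
    have "ev s1 w = ev s w + (\<Sum>j<k. - f V (\<pi> V s) j w \<star> ev (\<tau> j) w)"
      unfolding s1_def ev_add ev_lin_comb ev_cut[OF wW] using wW by simp
    then have "ev s w = ev s1 w + (\<Sum>j<k. f V (\<pi> V s) j w \<star> ev (\<tau> j) w)"
      by (simp add: sum_negf)
    then show ?thesis using W'(5)[OF w] by (simp add: add.commute)
  qed
  have tW: "(\<lambda>i. cut W' (\<tau> j i)) \<in> sect K W'" if "j < k" for j by (rule K_cut[OF W(1) W'(1,3) W(4)[OF that]])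
  show ?thesis
  proof (rule that[OF W'(1,2) _ tW W'(4)])
    show "W' \<subseteq> V" using W'(3) W(3) by blast
    show "ev s w = (\<Sum>j<k. f V (\<pi> V s) j w \<star> ev (\<lambda>i. cut W' (\<tau> j i)) w) + am w (ev \<sigma> w)" if "w \<in> W'" for w
      using eq[OF that] by (simp add: ev_cut[OF that])
  qed
qed

lemma frame_kernel:
  assumes V: "zariski_open V" "V \<subseteq> U" "v \<in> V" and s: "s \<in> sect K V" "\<And>j. j < k \<Longrightarrow> f V (\<pi> V s) j v = 0"
  shows "\<exists>u\<in>Kn c. ev s v = am v u"
proof -
  obtain W \<tau> \<sigma> where W: "zariski_open W" "v \<in> W" "W \<subseteq> V" "\<And>j. j < k \<Longrightarrow> \<tau> j \<in> sect K W"
    "\<sigma> \<in> sect (twist_power (- 1) c) W"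
    "\<And>w. w \<in> W \<Longrightarrow> ev s w = (\<Sum>j<k. f V (\<pi> V s) j w \<star> ev (\<tau> j) w) + am w (ev \<sigma> w)"
    by (rule frame_decompose[OF V s(1)]) (rule that)
  have "ev s v = am v (ev \<sigma> v)" using W(6)[OF W(2)] s(2) by simp
  then show ?thesis using ev_Kn[OF W(5)] by blast
qed

lemma fibre_frame:
  assumes v: "v \<in> U"
  shows "fibre v k"
proof -
  obtain W \<tau> where W: "zariski_open W" "v \<in> W" "W \<subseteq> U" "\<And>j. j < k \<Longrightarrow> \<tau> j \<in> sect K W"
    "\<And>j. j < k \<Longrightarrow> f W (\<pi> W (\<tau> j)) = unit_sect j (cut W (\<lambda>_. 1))"
    by (rule p_lifts[OF Uo _ v]) (simp, rule that)
  show ?thesis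
  proof (rule fibre_of_germs[where \<theta> = "\<lambda>j V s. f V (\<pi> V s) j v", OF Uo v _ _ _ _ W(1-4)])
    show "f W (\<pi> W (\<tau> j)) i v = (if i = j then 1 else 0)" if "i < k" "j < k" for i j
      using W(2,5) that by (simp add: unit_sect_def)
    show "\<exists>u\<in>Kn c. ev s v = am v u"
      if "zariski_open V" "v \<in> V" "V \<subseteq> U" "s \<in> sect K V" "\<And>j. j < k \<Longrightarrow> f V (\<pi> V s) j v = 0" for V s
      using frame_kernel[OF that(1,3,2,4,5)] .
  qed (simp_all add: p_add p_smult p_cut p_a)
qed

end

text \<open>Frames around any two points overlap, and at a common point their ranks agree. A
  dimension found at one point therefore holds everywhere.\<close>

lemma fibre_constant:
  assumes "fibre v k" "v \<noteq> 0" "w \<noteq> 0"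
  shows "fibre w k"
proof -
  obtain U l f where U: "frame U l f" "v \<in> U" using frame_exists[OF assms(2)] by blast
  obtain V m g where V: "frame V m g" "w \<in> V" using frame_exists[OF assms(3)] by blast
  obtain x where "x \<in> U" "x \<in> V"
    using open_sets_meet[OF _ U(2) _ V(2)] U(1) V(1) unfolding frame_def by blast
  then have "l = m" using fibre_le fibre_frame[OF U(1)] fibre_frame[OF V(1)] by (meson le_antisym)
  moreover have "k = l" using fibre_le fibre_frame[OF U] assms(1) by (meson le_antisym)
  ultimately show ?thesis using fibre_frame[OF V] by simp
qed

section \<open>The form induced on the kernel sheaf\<close>

definition form :: "('k ^ 'n) set \<Rightarrow> (nat \<Rightarrow> 'k ^ 'n \<Rightarrow> 'k) \<Rightarrow> (nat \<Rightarrow> 'k ^ 'n \<Rightarrow> 'k) \<Rightarrow> 'k ^ 'n \<Rightarrow> 'k" where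
  "form V s t = \<phi> V (\<pi> V s) V (\<pi> V t)"

lemma \<phi>_mor: "sheaf_mor proj_space E (dual E) \<phi>"
  using \<phi>_iso unfolding sheaf_iso_def by blast

lemma sect_dual: "h \<in> sect (dual E) U \<longleftrightarrow> sheaf_mor U E structure_sheaf h \<and> clip U E h = h"
  by (simp add: dual_def)

lemma dual_mor_sect:
  assumes "zariski_open V" "e \<in> sect E V"
  shows "sheaf_mor V E structure_sheaf (\<phi> V e)"
  using sheaf_mor_closed[OF \<phi>_mor opn[OF assms(1)] assms(2)] by (simp add: sect_dual)

lemma self_open: "zariski_open V \<Longrightarrow> V \<in> opens V" for V :: "('k ^ 'n) set"
  by (simp add: opens_open)

lemma form_closed:
  assumes "zariski_open V" "s \<in> sect K V" "t \<in> sect K V"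
  shows "form V s t \<in> twist_sections 0 V"
  using sheaf_mor_closed[OF dual_mor_sect[OF assms(1) \<pi>_closed[OF assms(1,2)]] self_open[OF assms(1)]
      \<pi>_closed[OF assms(1,3)]]
  by (simp add: form_def twist_simps)

lemma form_add_right:
  assumes "zariski_open V" "s \<in> sect K V" "t \<in> sect K V" "t' \<in> sect K V"
  shows "form V s (\<lambda>i v. t i v + t' i v) v = form V s t v + form V s t' v"
  using sheaf_mor_add[OF dual_mor_sect[OF assms(1) \<pi>_closed[OF assms(1,2)]] self_open[OF assms(1)]
      \<pi>_closed[OF assms(1,3)] \<pi>_closed[OF assms(1,4)]]
  by (simp add: form_def \<pi>_add[OF assms(1,3,4)] twist_simps)

lemma form_smult_right:
  assumes "zariski_open V" "s \<in> sect K V" "x \<in> twist_sections 0 V" "t \<in> sect K V"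
  shows "form V s (\<lambda>i v. x v * t i v) v = x v * form V s t v"
  using sheaf_mor_smult[OF dual_mor_sect[OF assms(1) \<pi>_closed[OF assms(1,2)]] self_open[OF assms(1)],
      of x "\<pi> V t"] assms(3) \<pi>_closed[OF assms(1,4)]
  by (simp add: form_def \<pi>_smult[OF assms(1,3,4)] twist_simps)

text \<open>Evaluating the transpose of \<open>\<phi>\<close> on the canonical image of a section in
  the double dual exchanges the two arguments. Over \<open>V\<close> itself all clippings
  disappear.\<close>

lemma form_sym:
  assumes V: "zariski_open V" "s \<in> sect K V" "t \<in> sect K V"
  shows "form V s t = form V t s"
proof -
  let ?s = "\<pi> V s" and ?t = "\<pi> V t"
  note st = \<pi>_closed[OF V(1,2)] \<pi>_closed[OF V(1,3)]
  have "\<phi> V ?s V ?t = dual_mor E \<phi> V (bidual E V ?s) V ?t" using \<phi>_sym[OF V(1) st(1)] by simp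
  also have "\<dots> = bidual E V ?s V (\<phi> V ?t)"
    using self_open[OF V(1)] st(2) by (simp add: dual_mor_def clip_def)
  also have "\<dots> = \<phi> V ?t V (restr E V V ?s)"
    using self_open[OF V(1)] sheaf_mor_closed[OF \<phi>_mor opn[OF V(1)] st(2)] by (simp add: bidual_def clip_def)
  also have "restr E V V ?s = ?s" by (rule module_sheaf.restr_id[OF E opn[OF V(1)] st(1)])
  finally show ?thesis by (simp add: form_def)
qed

lemma form_cut:
  assumes "zariski_open V" "zariski_open W" "W \<subseteq> V" "s \<in> sect K V" "t \<in> sect K V"
  shows "form W (\<lambda>i. cut W (s i)) (\<lambda>i. cut W (t i)) = cut W (form V s t)"
proof -
  note st = \<pi>_closed[OF assms(1,4)] \<pi>_closed[OF assms(1,5)]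
  have WV: "W \<in> opens V" using assms(1-3) by (simp add: opens_open)
  have "\<phi> W (restr E V W (\<pi> V s)) = clip W E (\<phi> V (\<pi> V s))"
    using sheaf_mor_restr[OF \<phi>_mor opn[OF assms(1)] opn[OF assms(2)] assms(3) st(1)] by (simp add: dual_def)
  then have "form W (\<lambda>i. cut W (s i)) (\<lambda>i. cut W (t i)) = clip W E (\<phi> V (\<pi> V s)) W (restr E V W (\<pi> V t))"
    by (simp add: form_def \<pi>_restr[OF assms(1-3) assms(4)] \<pi>_restr[OF assms(1-3) assms(5)])
  also have "\<dots> = \<phi> V (\<pi> V s) W (restr E V W (\<pi> V t))"
    using self_open[OF assms(2)] E_restr_closed[OF assms(1-3) st(2)] by (simp add: clip_def)
  also have "\<dots> = cut W (form V s t)"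
    using sheaf_mor_restr[OF dual_mor_sect[OF assms(1) st(1)] self_open[OF assms(1)] WV assms(3) st(2)]
    by (simp add: form_def twist_simps)
  finally show ?thesis .
qed

definition nbhd :: "'k ^ 'n \<Rightarrow> ('k ^ 'n) set \<times> (nat \<Rightarrow> nat \<Rightarrow> 'k ^ 'n \<Rightarrow> 'k)" where
  "nbhd v = (SOME p. good (fst p) (snd p) \<and> v \<in> fst p)"

text \<open>The value at \<open>v\<close> is meaningful only on \<open>ker (bm v)\<close>; the formula extends it to all vectors.\<close>

definition form_at :: "'k ^ 'n \<Rightarrow> (nat \<Rightarrow> 'k) \<Rightarrow> (nat \<Rightarrow> 'k) \<Rightarrow> 'k" where
  "form_at v w w' = (\<Sum>j<N. \<Sum>l<N. w j * (w' l * form (fst (nbhd v)) (snd (nbhd v) j) (snd (nbhd v) l) v))"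

lemma form_at_linear: "linf (form_at v w)" "linf (\<lambda>w'. form_at v w' w)"
  unfolding form_at_def
  by (auto intro!: linfI simp: fun_simps algebra_simps sum.distrib sum_distrib_left)

text \<open>Both arguments expand in the sections chosen by \<open>nbhd v\<close>, so the value is
  their Gram matrix applied to the two coordinate vectors. Linearity in the left argument is
  obtained from symmetry.\<close>

lemma form_at:
  assumes V: "zariski_open V" "v \<in> V" and st: "s \<in> sect K V" "t \<in> sect K V"
  shows "form V s t v = form_at v (ev s v) (ev t v)"
proof -
  obtain V1 \<kappa>1 where "good V1 \<kappa>1" "v \<in> V1" using good_exists[OF open_nonzero[OF V]] by blast
  then have "good (fst (nbhd v)) (snd (nbhd v)) \<and> v \<in> fst (nbhd v)"
    unfolding nbhd_def by (intro someI[of "\<lambda>p. good (fst p) (snd p) \<and> v \<in> fst p" "(V1, \<kappa>1)"]) simp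
  then obtain V0 \<kappa> where eq: "nbhd v = (V0, \<kappa>)" and V0: "good V0 \<kappa>" "v \<in> V0"
    by (cases "nbhd v") auto
  have V0o: "zariski_open V0" and \<kappa>: "\<And>j. j < N \<Longrightarrow> \<kappa> j \<in> sect K V0" using V0(1) unfolding good_def by auto
  let ?W = "V \<inter> V0"
  have W: "zariski_open ?W" by (rule zariski_open_Int[OF V(1) V0o])
  have vW: "v \<in> ?W" using V V0 by auto
  let ?s = "\<lambda>i. cut ?W (s i)" and ?t = "\<lambda>i. cut ?W (t i)" and ?\<kappa> = "\<lambda>j i. cut ?W (\<kappa> j i)"
  have gW: "good ?W ?\<kappa>" by (rule good_cut[OF V0(1) W]) simp
  have sW: "?s \<in> sect K ?W" "?t \<in> sect K ?W" by (rule K_cut[OF V(1) W _ st(1)], simp) (rule K_cut[OF V(1) W _ st(2)], simp)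
  have \<kappa>W: "?\<kappa> j \<in> sect K ?W" if "j < N" for j using gW that unfolding good_def by blast
  have x: "?s j \<in> twist_sections 0 ?W" "?t j \<in> twist_sections 0 ?W" if "j < N" for j
    using K_sect[OF sW(1)] K_sect[OF sW(2)] that by (auto simp: sect_twist_power)
  have right: "form ?W u ?t v = (\<Sum>l<N. ?t l v * form ?W u (?\<kappa> l) v)" if u: "u \<in> sect K ?W" for u
  proof -
    have "form ?W u ?t v = form ?W u (lin_comb N ?t ?\<kappa>) v" using good_expand[OF gW sW(2)] by simp
    also have "\<dots> = (\<Sum>l<N. ?t l v * form ?W u (?\<kappa> l) v)"
      by (rule K_functional[where \<theta> = "\<lambda>t. form ?W u t v", OF W form_add_right[OF W u] form_smult_right[OF W u] x(2) \<kappa>W])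
    finally show ?thesis .
  qed
  have left: "form ?W ?s u v = (\<Sum>j<N. ?s j v * form ?W (?\<kappa> j) u v)" if u: "u \<in> sect K ?W" for u
  proof -
    have "form ?W ?s u v = form ?W u (lin_comb N ?s ?\<kappa>) v"
      using good_expand[OF gW sW(1)] form_sym[OF W sW(1) u] by simp
    also have "\<dots> = (\<Sum>j<N. ?s j v * form ?W u (?\<kappa> j) v)"
      by (rule K_functional[where \<theta> = "\<lambda>t. form ?W u t v", OF W form_add_right[OF W u] form_smult_right[OF W u] x(1) \<kappa>W])
    also have "\<dots> = (\<Sum>j<N. ?s j v * form ?W (?\<kappa> j) u v)"
      using form_sym[OF W u \<kappa>W] by (intro sum.cong) auto
    finally show ?thesis .
  qed
  have "form V s t v = form ?W ?s ?t v"
    using form_cut[OF V(1) W _ st] vW by simp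
  also have "\<dots> = (\<Sum>j<N. s j v * (\<Sum>l<N. t l v * form ?W (?\<kappa> j) (?\<kappa> l) v))"
    using left[OF sW(2)] right[OF \<kappa>W] vW by simp
  also have "\<dots> = (\<Sum>j<N. s j v * (\<Sum>l<N. t l v * form V0 (\<kappa> j) (\<kappa> l) v))"
    using form_cut[OF V0o W _ \<kappa> \<kappa>] vW by (intro sum.cong arg_cong2[where f = "(*)"]) auto
  also have "\<dots> = form_at v (ev s v) (ev t v)"
    by (simp add: form_at_def eq ev_def sum_distrib_left)
  finally show ?thesis .
qed

lemma section_through:
  assumes "zariski_open U" "v \<in> U" "w \<in> Kn N" "bm v w = 0"
  obtains V s where "zariski_open V" "v \<in> V" "V \<subseteq> U" "s \<in> sect K V" "ev s v = w"
proof -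
  obtain V \<kappa> where V: "good V \<kappa>" "v \<in> V" "V \<subseteq> U" using good_nbhd[OF assms(1,2)] by blast
  then have "zariski_open V" unfolding good_def by blast
  then show ?thesis using that const_sect[OF V(1)] V(2,3) assms(3,4) by blast
qed

lemma form_at_sym:
  assumes v: "v \<noteq> 0" and w: "w \<in> Kn N" "bm v w = 0" and w': "w' \<in> Kn N" "bm v w' = 0"
  shows "form_at v w w' = form_at v w' w"
proof -
  obtain V \<kappa> where V: "good V \<kappa>" "v \<in> V" using good_exists[OF v] by blast
  then have Vo: "zariski_open V" unfolding good_def by blast
  note s = const_sect(1)[OF V(1), of w] const_sect(2)[OF V w]
  note s' = const_sect(1)[OF V(1), of w'] const_sect(2)[OF V w']
  show ?thesis
    using form_at[OF Vo V(2) s(1) s'(1)] form_at[OF Vo V(2) s'(1) s(1)] form_sym[OF Vo s(1) s'(1)] s(2) s'(2)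
    by simp
qed

text \<open>A section with value \<open>am v u\<close> can be taken of the form
  \<open>a W \<sigma>\<close>, and \<open>\<pi>\<close> sends it to zero.\<close>

lemma form_at_radical:
  assumes v: "v \<noteq> 0" and u: "u \<in> Kn c" and w: "w \<in> Kn N" "bm v w = 0"
  shows "form_at v (am v u) w = 0"
proof -
  obtain V \<kappa> where V: "good V \<kappa>" "v \<in> V" using good_exists[OF v] by blast
  then have Vo: "zariski_open V" unfolding good_def by blast
  obtain W \<sigma> where W: "zariski_open W" "v \<in> W" "W \<subseteq> V" "\<sigma> \<in> sect (twist_power (- 1) c) W" "ev \<sigma> v = u"
    by (rule sect_with_value[OF Vo V(2) _ u, of "- 1"]) (simp, rule that)
  let ?a = "a W \<sigma>" and ?t = "\<lambda>i. cut W (const_sect V \<kappa> w i)"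
  have aK: "?a \<in> sect K W" by (rule a_closed[OF W(1,4)])
  have tK: "?t \<in> sect K W" by (rule K_cut[OF Vo W(1,3) const_sect(1)[OF V(1)]])
  interpret abelian_group "sections E W" by (rule E_group[OF W(1)])
  have "sheaf_mor W E structure_sheaf (\<phi> W (\<pi> W ?t))" by (rule dual_mor_sect[OF W(1) \<pi>_closed[OF W(1) tK]])
  from sheaf_mor_add[OF this self_open[OF W(1)] zero_closed zero_closed]
  have "form W ?t ?a = (\<lambda>v. form W ?t ?a v + form W ?t ?a v)"
    by (simp add: twist_simps form_def \<pi>_a[OF W(1,4)])
  then have "form W ?t ?a v = form W ?t ?a v + form W ?t ?a v" by (rule fun_cong)
  then have "form W ?t ?a v = 0" by (simp only: add_cancel_right_right)
  then have "form W ?a ?t v = 0" using form_sym[OF W(1) aK tK] by simp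
  then show ?thesis
    using form_at[OF W(1,2) aK tK] am(5)[OF W(1,4,2)] W(5) ev_cut[OF W(2), of "const_sect V \<kappa> w"]
      const_sect(2)[OF V w] by simp
qed

text \<open>Near \<open>v\<close> the coordinate functions of a frame are the forms \<open>form \<theta>\<^sub>j\<close> of sections \<open>\<theta>\<^sub>j\<close>, since
  \<open>\<phi>\<close> is onto the dual.\<close>

lemma form_at_nondegenerate:
  assumes v: "v \<noteq> 0" and w: "w \<in> Kn N" "bm v w = 0"
    and zero: "\<And>w'. w' \<in> Kn N \<Longrightarrow> bm v w' = 0 \<Longrightarrow> form_at v w' w = 0"
  shows "\<exists>u\<in>Kn c. w = am v u"
proof -
  obtain U k f where U: "frame U k f" "v \<in> U" using frame_exists[OF v] by blast
  note Uo = Uo[OF U(1)]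
  obtain V s where V: "zariski_open V" "v \<in> V" "V \<subseteq> U" "s \<in> sect K V" "ev s v = w"
    by (rule section_through[OF Uo U(2) w]) (rule that)
  have "f V (\<pi> V s) j v = 0" if j: "j < k" for j
  proof -
    let ?\<epsilon> = "clip U E (\<lambda>V t. f V t j)"
    have "sheaf_mor U E structure_sheaf ?\<epsilon>"
      unfolding sheaf_mor_def
    proof (intro conjI ballI impI funcsetI)
      fix V s assume V: "V \<in> opens U" and s: "s \<in> sect E V"
      have Vo: "zariski_open V" "V \<subseteq> U" using V opens_open[OF Uo] by auto
      have "f V s \<in> sect (twist_power 0 k) V" by (rule sheaf_mor_closed[OF f_mor[OF U(1)] V s])
      then show "?\<epsilon> V s \<in> sect structure_sheaf V" using V s j by (simp add: clip_def sect_twist_power twist_simps)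
      interpret abelian_group "sections E V" by (rule E_group[OF Vo(1)])
      interpret M: Module.module "regular_ring V" "sections E V" by (rule module_sheaf.module[OF E opn[OF Vo(1)]])
      show "?\<epsilon> V (s \<oplus>\<^bsub>sections E V\<^esub> t) = ?\<epsilon> V s \<oplus>\<^bsub>sections structure_sheaf V\<^esub> ?\<epsilon> V t" if "t \<in> sect E V" for t
        using V s that f_add[OF U(1) Vo s that] by (simp add: clip_def twist_simps)
      show "?\<epsilon> V (x \<odot>\<^bsub>sections E V\<^esub> s) = x \<odot>\<^bsub>sections structure_sheaf V\<^esub> ?\<epsilon> V s"
        if "x \<in> carrier (regular_ring V)" for x
        using V s that f_smult[OF U(1) Vo _ s, of x] M.smult_closed[OF that s] by (simp add: clip_def twist_simps)
      show "?\<epsilon> W (restr E V W s) = restr structure_sheaf V W (?\<epsilon> V s)" if W: "W \<in> opens U" "W \<subseteq> V" for W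
      proof -
        have Wo: "zariski_open W" using W opens_open[OF Uo] by auto
        show ?thesis
          using V s W f_restr[OF U(1) Vo(1) Wo W(2) Vo(2) s] E_restr_closed[OF Vo(1) Wo W(2) s]
          by (simp add: clip_def twist_simps)
      qed
    qed
    moreover have "clip U E ?\<epsilon> = ?\<epsilon>" unfolding clip_def by (intro ext) simp
    ultimately have "?\<epsilon> \<in> sect (dual E) U" by (simp add: sect_dual)
    moreover have "\<phi> U ` sect E U = sect (dual E) U"
      using \<phi>_iso opn[OF Uo] unfolding sheaf_iso_def bij_betw_def by blast
    ultimately have "?\<epsilon> \<in> \<phi> U ` sect E U" by simp
    then obtain \<eta> where \<eta>: "\<eta> \<in> sect E U" "\<phi> U \<eta> = ?\<epsilon>" by (elim imageE) (rule that, simp_all)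
    obtain W \<theta> where W: "zariski_open W" "v \<in> W" "W \<subseteq> V" "\<theta> \<in> sect K W"
      "\<pi> W \<theta> = restr E V W (restr E U V \<eta>)"
      by (rule lift[OF V(1) E_restr_closed[OF Uo V(1,3) \<eta>(1)] V(2)]) (rule that)
    have WU: "W \<subseteq> U" using W(3) V(3) by blast
    have \<theta>: "\<pi> W \<theta> = restr E U W \<eta>"
      using W(5) module_sheaf.restr_comp[OF E opn[OF Uo] opn[OF V(1)] opn[OF W(1)] W(3) V(3) \<eta>(1)] by simp
    let ?s = "\<lambda>i. cut W (s i)"
    have sW: "?s \<in> sect K W" by (rule K_cut[OF V(1) W(1,3) V(4)])
    have "\<phi> W (restr E U W \<eta>) = clip W E ?\<epsilon>"
      using sheaf_mor_restr[OF \<phi>_mor opn[OF Uo] opn[OF W(1)] WU \<eta>(1)] \<eta>(2) by (simp add: dual_def)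
    then have "form W \<theta> ?s = clip W E ?\<epsilon> W (\<pi> W ?s)" by (simp add: form_def \<theta>)
    also have "\<dots> = f W (\<pi> W ?s) j"
      using self_open[OF W(1)] \<pi>_closed[OF W(1) sW] opens_open[OF Uo] W(1) WU by (simp add: clip_def)
    also have "\<dots> = cut W (f V (\<pi> V s) j)" using p_cut[OF U(1) V(1) W(1,3) V(3,4)] by simp
    finally have "f V (\<pi> V s) j v = form W \<theta> ?s v" using W(2) by simp
    also have "\<dots> = form_at v (ev \<theta> v) w"
      using form_at[OF W(1,2,4) sW] ev_cut[OF W(2), of s] V(5) by simp
    also have "\<dots> = 0"
      using zero ev_Kn[OF K_sect[OF W(4)]] W(2,4) by (auto simp: sect_K[OF W(1)])
    finally show ?thesis .
  qed
  from frame_kernel[OF U(1) V(1,3,2,4) this] show ?thesis using V(5) by simp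
qed

lemma bm_combination: "bm v w = 0 \<Longrightarrow> bm v' w = 0 \<Longrightarrow> bm (x *s v + y *s v') w = 0"
  by (simp add: bm)

text \<open>Along the line through \<open>v\<close> and \<open>v'\<close> the value
  \<open>form_at z w w'\<close> is a regular function of \<open>z\<close>: near each point it is the
  form of two sections that follow \<open>w\<close> and \<open>w'\<close>. Regular functions on a
  projective line are constant.\<close>

lemma form_at_constant:
  assumes ind: "independent_points v v'" and w: "w \<in> Kn N" "bm v w = 0" "bm v' w = 0"
    and w': "w' \<in> Kn N" "bm v w' = 0" "bm v' w' = 0"
  shows "form_at v w w' = form_at v' w w'"
proof -
  define M where "M = {x *s v + y *s v' | x y. True} - {0}"
  let ?q = "\<lambda>z. if z \<in> M then form_at z w w' else 0"
  have "?q \<in> twist_sections 0 M"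
  proof (rule tw_local)
    fix z assume z: "z \<in> M"
    then obtain V \<kappa> where V: "good V \<kappa>" "z \<in> V" using good_exists[of z] unfolding M_def by blast
    then have Vo: "zariski_open V" unfolding good_def by blast
    note s = const_sect(1)[OF V(1), of w] const_sect(1)[OF V(1), of w']
    have "?q y = cut (M \<inter> V) (form V (const_sect V \<kappa> w) (const_sect V \<kappa> w')) y" if y: "y \<in> M \<inter> V" for y
    proof -
      have "bm y w = 0" "bm y w' = 0" using y w w' bm_combination unfolding M_def by blast+
      then show ?thesis
        using form_at[OF Vo _ s, of y] const_sect(2)[OF V(1), of y] y w(1) w'(1) by simp
    qed
    moreover have "cut (M \<inter> V) (form V (const_sect V \<kappa> w) (const_sect V \<kappa> w')) \<in> twist_sections 0 (M \<inter> V)"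
      by (rule tw_cut[OF form_closed[OF Vo s]]) simp
    ultimately show "\<exists>W t. zariski_open W \<and> z \<in> W \<and> t \<in> twist_sections 0 (M \<inter> W) \<and> (\<forall>w\<in>M \<inter> W. ?q w = t w)"
      using Vo V(2) by blast
  qed simp
  then have "?q v = ?q v'"
    by (rule tw0_line[OF _ _ ind]) (auto simp: M_def)
  moreover have "v = 1 *s v + 0 *s v'" "v' = 0 *s v + 1 *s v'" by simp_all
  then have "v \<in> {x *s v + y *s v' | x y. True}" "v' \<in> {x *s v + y *s v' | x y. True}" by blast+
  moreover have "v \<noteq> 0" "v' \<noteq> 0"
    using ind unfolding independent_points_def by (metis vector_smult_lzero vector_smult_rzero zero_neq_one add_0)+
  ultimately show ?thesis unfolding M_def by auto
qed

end

section \<open>Restriction to the splitting line\<close>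

locale instanton_line = instanton +
  fixes x y :: "'a ^ 'b" and L :: "('a ^ 'b) set" and \<rho> :: "('a ^ 'b, 'c, nat \<Rightarrow> 'a ^ 'b \<Rightarrow> 'a) sheaf_map"
  assumes L: "L = {s *s x + t *s y | s t. True}" and xy: "independent_points x y"
    and \<rho>_surj: "sheaf_surj proj_space E (direct_image (L - {0}) (twist_power 0 r)) \<rho>"
    and \<rho>_ker: "\<And>U. zariski_open U \<Longrightarrow>
      {s \<in> sect E U. \<rho> U s = \<zero>\<^bsub>sections (direct_image (L - {0}) (twist_power 0 r)) U\<^esub>} = ideal_times (L - {0}) E U"
begin

section \<open>The trivialisation on the line\<close>

abbreviation Y :: "('a ^ 'b) set" where "Y \<equiv> L - {0}"
abbreviation DI :: "('a ^ 'b, 'a, nat \<Rightarrow> 'a ^ 'b \<Rightarrow> 'a) mod_sheaf" where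
  "DI \<equiv> direct_image Y (twist_power 0 r)"

lemma DI_simps:
  "sect DI U = sect (twist_power 0 r) (U \<inter> Y)"
  "s \<oplus>\<^bsub>sections DI U\<^esub> t = (\<lambda>i v. s i v + t i v)"
  "z \<odot>\<^bsub>sections DI U\<^esub> s = (\<lambda>i v. cut (U \<inter> Y) z v * s i v)"
  "\<zero>\<^bsub>sections DI U\<^esub> = (\<lambda>i v. 0)"
  "restr DI U V s = (\<lambda>i. cut (V \<inter> Y) (s i))"
  by (simp_all add: direct_image_def twist_power_simps)

lemma \<rho>_mor: "sheaf_mor proj_space E DI \<rho>"
  using \<rho>_surj unfolding sheaf_surj_def by blast

lemma YP: "V \<inter> Y \<subseteq> proj_space"
  by (auto simp: proj_space_def)

definition tr :: "('a ^ 'b) set \<Rightarrow> (nat \<Rightarrow> 'a ^ 'b \<Rightarrow> 'a) \<Rightarrow> nat \<Rightarrow> 'a ^ 'b \<Rightarrow> 'a" where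
  "tr V s = \<rho> V (\<pi> V s)"

lemma tr_closed: "zariski_open V \<Longrightarrow> s \<in> sect K V \<Longrightarrow> tr V s \<in> sect (twist_power 0 r) (V \<inter> Y)"
  using sheaf_mor_closed[OF \<rho>_mor opn \<pi>_closed] by (simp add: tr_def DI_simps)

lemma tr_add: "\<lbrakk>zariski_open V; s \<in> sect K V; t \<in> sect K V\<rbrakk> \<Longrightarrow>
    tr V (\<lambda>i v. s i v + t i v) = (\<lambda>i v. tr V s i v + tr V t i v)"
  using sheaf_mor_add[OF \<rho>_mor opn \<pi>_closed \<pi>_closed, of V s t] by (simp add: tr_def DI_simps \<pi>_add)

lemma tr_smult: "\<lbrakk>zariski_open V; z \<in> twist_sections 0 V; s \<in> sect K V\<rbrakk> \<Longrightarrow>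
    tr V (\<lambda>i v. z v * s i v) = (\<lambda>i v. cut (V \<inter> Y) z v * tr V s i v)"
  using sheaf_mor_smult[OF \<rho>_mor opn _ \<pi>_closed, of V z s] by (simp add: tr_def DI_simps \<pi>_smult)

lemma tr_cut: "\<lbrakk>zariski_open V; zariski_open W; W \<subseteq> V; s \<in> sect K V\<rbrakk> \<Longrightarrow>
    tr W (\<lambda>i. cut W (s i)) = (\<lambda>i. cut (W \<inter> Y) (tr V s i))"
  using sheaf_mor_restr[OF \<rho>_mor opn opn _ \<pi>_closed, of V W s] by (simp add: tr_def DI_simps \<pi>_restr)

lemma tr_a:
  assumes V: "zariski_open V" and \<sigma>: "\<sigma> \<in> sect (twist_power (- 1) c) V"
  shows "tr V (a V \<sigma>) = (\<lambda>i v. 0)"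
proof -
  interpret abelian_group "sections E V" by (rule E_group[OF V])
  let ?z = "\<rho> V \<zero>\<^bsub>sections E V\<^esub>"
  have eq: "?z = (\<lambda>i v. ?z i v + ?z i v)"
    using sheaf_mor_add[OF \<rho>_mor opn[OF V] zero_closed zero_closed] by (simp add: DI_simps)
  have "?z i v = 0" for i v
    using fun_cong[OF fun_cong[OF eq, of i], of v] by (simp only: add_cancel_right_right)
  then show ?thesis unfolding tr_def \<pi>_a[OF assms] by blast
qed

lemma tr_lifts:
  assumes V: "zariski_open V" "v \<in> V"
  obtains W \<tau> where "zariski_open W" "v \<in> W" "W \<subseteq> V" "\<And>j. j < r \<Longrightarrow> \<tau> j \<in> sect K W"
    "\<And>j. j < r \<Longrightarrow> tr W (\<tau> j) = unit_sect j (cut (W \<inter> Y) (\<lambda>_. 1))"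
proof -
  define P where "P j W \<longleftrightarrow> (\<exists>\<tau>\<in>sect K W. tr W \<tau> = unit_sect j (cut (W \<inter> Y) (\<lambda>_. 1)))" for j W
  obtain W where W: "zariski_open W" "v \<in> W" "W \<subseteq> V" "\<And>j. j < r \<Longrightarrow> P j W"
  proof (rule common_nbhd[of r v V P])
    fix j assume j: "j < r"
    let ?e = "unit_sect j (cut (V \<inter> Y) (\<lambda>_. 1 :: 'a))"
    have "?e \<in> sect DI V" unfolding DI_simps by (rule unit_sect_in[OF j tw_const[OF YP] YP])
    then have "?e \<in> image_sections proj_space E DI \<rho> V" using \<rho>_surj opn[OF V(1)] unfolding sheaf_surj_def by blast
    then have "\<exists>W\<in>opens proj_space. v \<in> W \<and> W \<subseteq> V \<and> restr DI V W ?e \<in> \<rho> W ` sect E W"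
      using V(2) unfolding image_sections_def by blast
    then obtain W t where W: "zariski_open W" "v \<in> W" "W \<subseteq> V" "t \<in> sect E W" "restr DI V W ?e = \<rho> W t"
      by (auto simp: opens_proj)
    obtain X \<tau> where X: "zariski_open X" "v \<in> X" "X \<subseteq> W" "\<tau> \<in> sect K X" "\<pi> X \<tau> = restr E W X t"
      by (rule lift[OF W(1,4,2)]) (rule that)
    have "tr X \<tau> = restr DI W X (\<rho> W t)"
      unfolding tr_def X(5) by (rule sheaf_mor_restr[OF \<rho>_mor opn[OF W(1)] opn[OF X(1)] X(3) W(4)])
    also have "\<dots> = (\<lambda>i. cut (X \<inter> Y) (unit_sect j (cut (W \<inter> Y) (cut (V \<inter> Y) (\<lambda>_. 1))) i))"
      unfolding W(5)[symmetric] DI_simps unit_sect_cut ..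
    also have "\<dots> = unit_sect j (cut (X \<inter> Y) (\<lambda>_. 1))"
      using W(3) X(3) unfolding unit_sect_cut by (subst cut_cut, blast)+ (rule refl)
    finally have "P j X" unfolding P_def using X(4) by blast
    then show "\<exists>W. zariski_open W \<and> v \<in> W \<and> W \<subseteq> V \<and> P j W" using X(1-3) W(3) by blast
  next
    fix j W W' assume PW: "P j W" "W \<subseteq> V" "zariski_open W" "zariski_open W'" "W' \<subseteq> W"
    then obtain \<tau> where \<tau>: "\<tau> \<in> sect K W" "tr W \<tau> = unit_sect j (cut (W \<inter> Y) (\<lambda>_. 1))"
      unfolding P_def by blast
    have "tr W' (\<lambda>i. cut W' (\<tau> i)) = (\<lambda>i. cut (W' \<inter> Y) (unit_sect j (cut (W \<inter> Y) (\<lambda>_. 1)) i))"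
      using tr_cut[OF PW(3,4,5) \<tau>(1)] \<tau>(2) by simp
    also have "\<dots> = unit_sect j (cut (W' \<inter> Y) (\<lambda>_. 1))"
      using PW(5) unfolding unit_sect_cut by (subst cut_cut, blast) (rule refl)
    finally show "P j W'" unfolding P_def using K_cut[OF PW(3,4,5) \<tau>(1)] by blast
  qed (use V in auto)
  from W(4) obtain \<tau> where "\<And>j. j < r \<Longrightarrow> \<tau> j \<in> sect K W"
    "\<And>j. j < r \<Longrightarrow> tr W (\<tau> j) = unit_sect j (cut (W \<inter> Y) (\<lambda>_. 1))"
    unfolding P_def by metis
  then show ?thesis using that[OF W(1-3)] by blast
qed

text \<open>The kernel of \<open>\<rho>\<close> is the ideal of the line times \<open>E\<close>. In
  a frame such elements have coordinates vanishing on the line, so of \<open>frame_decompose\<close>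
  only the image of \<open>a\<close> remains there.\<close>

lemma tr_zero_local:
  assumes V: "zariski_open V" "v \<in> V" and s: "s \<in> sect K V" "tr V s = (\<lambda>i v. 0)"
  obtains W \<sigma> where "zariski_open W" "v \<in> W" "W \<subseteq> V" "\<sigma> \<in> sect (twist_power (- 1) c) W"
    "\<And>w. w \<in> W \<inter> Y \<Longrightarrow> ev s w = am w (ev \<sigma> w)"
proof -
  have "\<pi> V s \<in> ideal_times Y E V"
    using \<rho>_ker[OF V(1)] \<pi>_closed[OF V(1) s(1)] s(2) unfolding DI_simps tr_def by blast
  then have "\<exists>W\<in>opens proj_space. v \<in> W \<and> W \<subseteq> V \<and>
      (\<exists>k::nat. \<exists>z\<in>{..<k} \<rightarrow> ideal_sections Y W. \<exists>t\<in>{..<k} \<rightarrow> sect E W.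
        restr E V W (\<pi> V s) = (\<Oplus>\<^bsub>sections E W\<^esub>i\<in>{..<k}. z i \<odot>\<^bsub>sections E W\<^esub> t i))"
    using V(2) unfolding ideal_times_def by blast
  then obtain W m z t where W: "W \<in> opens proj_space" "v \<in> W" "W \<subseteq> V"
    "z \<in> {..<m::nat} \<rightarrow> ideal_sections Y W" "t \<in> {..<m} \<rightarrow> sect E W"
    "restr E V W (\<pi> V s) = (\<Oplus>\<^bsub>sections E W\<^esub>i\<in>{..<m}. z i \<odot>\<^bsub>sections E W\<^esub> t i)"
    by (elim bexE exE conjE) (rule that)
  have Wo: "zariski_open W" using W(1) by (simp add: opens_proj)
  obtain U k f where U: "frame U k f" "v \<in> U" using frame_exists[OF open_nonzero[OF V]] by blast
  let ?X = "W \<inter> U"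
  have X: "zariski_open ?X" by (rule zariski_open_Int[OF Wo Uo[OF U(1)]])
  have XU: "?X \<subseteq> U" "?X \<subseteq> W" "?X \<subseteq> V" and vX: "v \<in> ?X" using W U by auto
  interpret abelian_group "sections E W" by (rule E_group[OF Wo])
  interpret M: Module.module "regular_ring W" "sections E W" by (rule module_sheaf.module[OF E opn[OF Wo]])
  let ?\<zeta> = "\<lambda>t j w. f ?X (restr E W ?X t) j w"
  have zeta_add: "?\<zeta> (e \<oplus>\<^bsub>sections E W\<^esub> e') j w = ?\<zeta> e j w + ?\<zeta> e' j w"
    if "e \<in> sect E W" "e' \<in> sect E W" for e e' j w
    using module_sheaf.restr_add[OF E opn[OF Wo] opn[OF X] XU(2) that]
      f_add[OF U(1) X XU(1) E_restr_closed[OF Wo X XU(2) that(1)] E_restr_closed[OF Wo X XU(2) that(2)]]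
    by simp
  have zeta_smult: "?\<zeta> (h \<odot>\<^bsub>sections E W\<^esub> e) j w = 0"
    if "h \<in> ideal_sections Y W" "e \<in> sect E W" "w \<in> ?X \<inter> Y" for h e j w
  proof -
    have h: "h \<in> carrier (regular_ring W)" "h w = 0" using that(1,3) by (auto simp: ideal_sections_def)
    have "cut ?X h \<in> twist_sections 0 ?X" using tw_cut[OF _ XU(2)] h(1) by simp
    then show ?thesis
      using module_sheaf.restr_smult[OF E opn[OF Wo] opn[OF X] XU(2) h(1) that(2)]
        f_smult[OF U(1) X XU(1) _ E_restr_closed[OF Wo X XU(2) that(2)], of "cut ?X h"] h(2) that(3)
      by simp
  qed
  have zeta_zero: "?\<zeta> \<zero>\<^bsub>sections E W\<^esub> j w = 0" for j w
    using zeta_add[OF zero_closed zero_closed, of j w] by (metis add_cancel_right_right l_zero zero_closed)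
  have summand: "z i \<odot>\<^bsub>sections E W\<^esub> t i \<in> sect E W" if "i < m" for i
  proof (rule M.smult_closed)
    show "z i \<in> carrier (regular_ring W)" using W(4) that by (auto simp: ideal_sections_def Pi_def)
    show "t i \<in> sect E W" using W(5) that by auto
  qed
  have sum0: "?\<zeta> (\<Oplus>\<^bsub>sections E W\<^esub>i\<in>{..<l}. z i \<odot>\<^bsub>sections E W\<^esub> t i) j w = 0"
    if "l \<le> m" "w \<in> ?X \<inter> Y" for l j w
    using that
  proof (induction l)
    case 0
    show ?case by (simp add: zeta_zero)
  next
    case (Suc l)
    have c: "(\<lambda>i. z i \<odot>\<^bsub>sections E W\<^esub> t i) \<in> {..<l} \<rightarrow> sect E W" using summand Suc.prems(1) by auto
    have "(\<Oplus>\<^bsub>sections E W\<^esub>i\<in>{..<Suc l}. z i \<odot>\<^bsub>sections E W\<^esub> t i) =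
        z l \<odot>\<^bsub>sections E W\<^esub> t l \<oplus>\<^bsub>sections E W\<^esub> (\<Oplus>\<^bsub>sections E W\<^esub>i\<in>{..<l}. z i \<odot>\<^bsub>sections E W\<^esub> t i)"
      unfolding lessThan_Suc using summand[of l] Suc.prems(1) c by (intro finsum_insert) auto
    moreover have "?\<zeta> (z l \<odot>\<^bsub>sections E W\<^esub> t l) j w = 0"
      using W(4,5) Suc.prems by (intro zeta_smult) (auto simp: Pi_def)
    ultimately show ?case
      using zeta_add[OF summand[of l] finsum_closed[OF c], of j w] Suc by simp
  qed
  let ?s = "\<lambda>i. cut ?X (s i)"
  have sX: "?s \<in> sect K ?X" by (rule K_cut[OF V(1) X XU(3) s(1)])
  have "\<pi> ?X ?s = restr E W ?X (restr E V W (\<pi> V s))"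
    using \<pi>_restr[OF V(1) X XU(3) s(1)]
      module_sheaf.restr_comp[OF E opn[OF V(1)] W(1) opn[OF X] XU(2) W(3) \<pi>_closed[OF V(1) s(1)]] by simp
  then have p0: "f ?X (\<pi> ?X ?s) j w = 0" if "w \<in> ?X \<inter> Y" for j w
    using sum0[OF order_refl that] W(6) by simp
  obtain W' \<tau> \<sigma> where W': "zariski_open W'" "v \<in> W'" "W' \<subseteq> ?X" "\<And>j. j < k \<Longrightarrow> \<tau> j \<in> sect K W'"
    "\<sigma> \<in> sect (twist_power (- 1) c) W'"
    "\<And>w. w \<in> W' \<Longrightarrow> ev ?s w = (\<Sum>j<k. f ?X (\<pi> ?X ?s) j w \<star> ev (\<tau> j) w) + am w (ev \<sigma> w)"
    by (rule frame_decompose[OF U(1) X XU(1) vX sX]) (rule that)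
  have "ev s w = am w (ev \<sigma> w)" if "w \<in> W' \<inter> Y" for w
  proof -
    have w: "w \<in> W'" "w \<in> ?X" "w \<in> ?X \<inter> Y" using that W'(3) by auto
    show ?thesis using W'(6)[OF w(1)] p0[OF w(3)] ev_cut[OF w(2), of s] by simp
  qed
  then show ?thesis using that[OF W'(1,2) _ W'(5)] W'(3) XU(3) by blast
qed

text \<open>If the restriction to the line vanishes at \<open>v\<close>, its components extend to functions \<open>G\<^sub>j\<close> near \<open>v\<close>
  that vanish at \<open>v\<close>; subtracting the corresponding combination of lifts makes it vanish on the line.\<close>

lemma tr_kernel:
  assumes V: "zariski_open V" "v \<in> V" "v \<in> Y" and s: "s \<in> sect K V" "\<And>j. j < r \<Longrightarrow> tr V s j v = 0"
  shows "\<exists>u\<in>Kn c. ev s v = am v u"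
proof -
  obtain W \<tau> where W: "zariski_open W" "v \<in> W" "W \<subseteq> V" "\<And>j. j < r \<Longrightarrow> \<tau> j \<in> sect K W"
    "\<And>j. j < r \<Longrightarrow> tr W (\<tau> j) = unit_sect j (cut (W \<inter> Y) (\<lambda>_. 1))"
    by (rule tr_lifts[OF V(1,2)]) (rule that)
  define P where "P j X \<longleftrightarrow> (\<exists>G\<in>twist_sections 0 X. \<forall>w\<in>X \<inter> Y. G w = tr V s j w)" for j X
  obtain X where X: "zariski_open X" "v \<in> X" "X \<subseteq> W" "\<And>j. j < r \<Longrightarrow> P j X"
  proof (rule common_nbhd[of r v W P])
    fix j assume j: "j < r"
    have g: "tr V s j \<in> twist_sections 0 (V \<inter> Y)"
      using tr_closed[OF V(1) s(1)] j by (simp add: sect_twist_power)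
    have vVY: "v \<in> V \<inter> Y" using V by blast
    obtain X e e' g h where X: "g \<in> hom_poly e" "h \<in> hom_poly e'" "zariski_open X" "v \<in> X" "int e - int e' = 0"
      "\<And>w. w \<in> V \<inter> Y \<inter> X \<Longrightarrow> h w \<noteq> 0" "\<And>w. w \<in> V \<inter> Y \<inter> X \<Longrightarrow> tr V s j w = g w / h w"
      by (rule twE[OF g vVY]) (rule that)
    \<comment> \<open>The denominator \<open>h\<close> is known to be nonzero only along the line.
      On the locus where it is nonzero, \<open>g / h\<close> is a regular function on an open subset
      of projective space.\<close>
    let ?X = "W \<inter> X \<inter> basic_open h"
    have Xo: "zariski_open ?X" by (intro zariski_open_Int W(1) X(3) zariski_open_basic[OF X(2)])
    then have XP: "?X \<subseteq> proj_space" by (rule zariski_open_subset)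
    have "(\<lambda>w. inverse (cut ?X h w)) \<in> twist_sections (- int e') ?X"
      by (rule tw_inverse[OF tw_hom[OF X(2) XP]]) (simp add: basic_open_def)
    from tw_mult[OF tw_hom[OF X(1) XP] this]
    have G: "(\<lambda>w. cut ?X g w * inverse (cut ?X h w)) \<in> twist_sections 0 ?X" using X(5) by simp
    have "cut ?X g w * inverse (cut ?X h w) = tr V s j w" if "w \<in> ?X \<inter> Y" for w
    proof -
      have "w \<in> V \<inter> Y \<inter> X" "w \<in> ?X" using that W(3) by blast+
      then show ?thesis using X(7)[of w] by (simp add: divide_inverse)
    qed
    then have "P j ?X" unfolding P_def by (intro bexI[OF _ G]) blast
    moreover have "v \<in> ?X" using W(2) X(4) X(6)[of v] V open_nonzero[OF V(1,2)] by (simp add: basic_open_def proj_space_def)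
    ultimately show "\<exists>V. zariski_open V \<and> v \<in> V \<and> V \<subseteq> W \<and> P j V" using Xo by blast
  next
    fix j X X' assume PX: "P j X" "X \<subseteq> W" "zariski_open X" "zariski_open X'" "X' \<subseteq> X"
    then obtain G where G: "G \<in> twist_sections 0 X" "\<forall>w\<in>X \<inter> Y. G w = tr V s j w" unfolding P_def by blast
    have "\<forall>w\<in>X' \<inter> Y. cut X' G w = tr V s j w" using G(2) PX(5) by auto
    then show "P j X'" unfolding P_def using tw_cut[OF G(1) PX(5)] by blast
  qed (use W in auto)
  from X(4) obtain G where G: "\<And>j. j < r \<Longrightarrow> G j \<in> twist_sections 0 X"
    "\<And>j w. j < r \<Longrightarrow> w \<in> X \<inter> Y \<Longrightarrow> G j w = tr V s j w"
    unfolding P_def by metis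
  have XV: "X \<subseteq> V" using X(3) W(3) by blast
  have XP: "X \<subseteq> proj_space" by (rule zariski_open_subset[OF X(1)])
  let ?z = "\<lambda>j w. cut X (\<lambda>_. - 1) w * G j w" and ?\<tau> = "\<lambda>j i. cut X (\<tau> j i)"
  have z: "?z j \<in> twist_sections 0 X" if "j < r" for j
    using tw_mult[OF tw_const[OF XP, of "- 1"] G(1)[OF that]] by simp
  have \<tau>: "?\<tau> j \<in> sect K X" if "j < r" for j by (rule K_cut[OF W(1) X(1,3) W(4)[OF that]])
  have tr\<tau>: "tr X (?\<tau> j) i w = (if i = j then 1 else 0)" if "j < r" "w \<in> X \<inter> Y" for i j w
    using tr_cut[OF W(1) X(1,3) W(4)[OF that(1)]] W(5)[OF that(1)] X(3) that(2)
    by (auto simp: unit_sect_def)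
  let ?s = "\<lambda>i. cut X (s i)" and ?l = "lin_comb r ?z ?\<tau>"
  define s1 where "s1 = (\<lambda>i w. ?s i w + ?l i w)"
  have sX: "?s \<in> sect K X" by (rule K_cut[OF V(1) X(1) XV s(1)])
  have lX: "?l \<in> sect K X" by (rule K_lin_comb[OF X(1) z \<tau>])
  have s1: "s1 \<in> sect K X" unfolding s1_def by (rule K_add[OF X(1) sX lX])
  have "tr X s1 = (\<lambda>i v. 0)"
  proof (rule twist_power_eqI[OF tr_closed[OF X(1) s1] twist_power_zero[OF YP]])
    fix w assume w: "w \<in> X \<inter> Y"
    have "tr X s1 i w = 0" for i
    proof (cases "i < r")
      case True
      have "tr X ?l i w = (\<Sum>j<r. ?z j w * tr X (?\<tau> j) i w)"
        by (rule K_functional[where \<theta> = "\<lambda>s. tr X s i w", OF X(1) _ _ z \<tau>])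
          (use w in \<open>simp_all add: tr_add[OF X(1)] tr_smult[OF X(1)]\<close>)
      also have "\<dots> = (\<Sum>j<r. if i = j then - G j w else 0)"
        using w tr\<tau>[OF _ w] by (intro sum.cong) auto
      also have "\<dots> = - tr V s i w" using True G(2)[OF True w] by simp
      finally show ?thesis
        using tr_add[OF X(1) sX lX] tr_cut[OF V(1) X(1) XV s(1)] w by (simp add: s1_def)
    next
      case False
      then show ?thesis using tr_closed[OF X(1) s1] by (simp add: sect_twist_power)
    qed
    then show "ev (tr X s1) w = ev (\<lambda>i v. 0) w" by (simp add: ev_def)
  qed
  then obtain W' \<sigma> where W': "zariski_open W'" "v \<in> W'" "W' \<subseteq> X" "\<sigma> \<in> sect (twist_power (- 1) c) W'"
    "\<And>w. w \<in> W' \<inter> Y \<Longrightarrow> ev s1 w = am w (ev \<sigma> w)"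
    using tr_zero_local[OF X(1,2) s1] by blast
  have vXY: "v \<in> X \<inter> Y" using X(2) V(3) by blast
  have "ev s1 v = ev s v"
    unfolding s1_def ev_add ev_lin_comb ev_cut[OF X(2)] using G(2)[OF _ vXY] s(2) by simp
  then show ?thesis using W'(5)[of v] W'(2) V(3) ev_Kn[OF W'(4)] by auto
qed

text \<open>The trivialisation supplies \<open>r\<close> functionals on germs together with dual
  lifts. Here the number \<open>r\<close> of the monad becomes the dimension of a fibre of
  \<open>E\<close>.\<close>

lemma fibre_line:
  assumes v: "v \<in> Y"
  shows "fibre v r"
proof -
  have vP: "v \<in> proj_space" using v by (simp add: proj_space_def)
  obtain W \<tau> where W: "zariski_open W" "v \<in> W" "W \<subseteq> proj_space" "\<And>j. j < r \<Longrightarrow> \<tau> j \<in> sect K W"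
    "\<And>j. j < r \<Longrightarrow> tr W (\<tau> j) = unit_sect j (cut (W \<inter> Y) (\<lambda>_. 1))"
    by (rule tr_lifts[OF zariski_open_proj vP]) (rule that)
  show ?thesis
  proof (rule fibre_of_germs[where \<theta> = "\<lambda>j V s. tr V s j v", OF zariski_open_proj vP _ _ _ _ W(1-4)])
    show "tr W (\<tau> j) i v = (if i = j then 1 else 0)" if "i < r" "j < r" for i j
      using W(2,5) that v by (simp add: unit_sect_def)
    show "\<exists>u\<in>Kn c. ev s v = am v u"
      if "zariski_open V" "v \<in> V" "s \<in> sect K V" "\<And>j. j < r \<Longrightarrow> tr V s j v = 0" for V s
      using tr_kernel[OF that(1,2) v that(3,4)] .
  qed (use v in \<open>simp_all add: tr_add tr_smult tr_cut tr_a\<close>)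
qed

lemma x_nz: "x \<noteq> 0" and y_nz: "y \<noteq> 0"
  using xy unfolding independent_points_def by (metis vector_smult_lzero vector_smult_rzero zero_neq_one add_0)+

lemma xL: "x \<in> Y" and yL: "y \<in> Y"
proof -
  have "x = 1 *s x + 0 *s y" "y = 0 *s x + 1 *s y" by simp_all
  then have "x \<in> L" "y \<in> L" unfolding L by blast+
  then show "x \<in> Y" "y \<in> Y" using x_nz y_nz by auto
qed

text \<open>The fibre has dimension \<open>r\<close> at the point \<open>x\<close> of the line,
  hence at every point, and \<open>fibre_injective\<close> applies everywhere.\<close>

lemma am_injective: "v \<noteq> 0 \<Longrightarrow> u \<in> Kn c \<Longrightarrow> am v u = 0 \<Longrightarrow> u = 0"
  using fibre_injective fibre_constant[OF fibre_line[OF xL] x_nz] by blast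

text \<open>Restriction to the line is linear over regular functions, so by
  \<open>germ_linear\<close> it depends on a section only through its value.\<close>

lemma tr_value:
  assumes v: "v \<in> Y" and V: "zariski_open V" "v \<in> V" "s \<in> sect K V" and W: "zariski_open W" "v \<in> W" "t \<in> sect K W"
    and eq: "ev s v = ev t v"
  shows "tr V s j v = tr W t j v"
proof -
  have vP: "v \<in> proj_space" using v by (simp add: proj_space_def)
  show ?thesis
  proof (rule germ_linear[where \<theta> = "\<lambda>V s. tr V s j v", OF zariski_open_proj vP])
    fix g assume "\<And>V s. \<lbrakk>zariski_open V; v \<in> V; V \<subseteq> proj_space; s \<in> sect K V\<rbrakk> \<Longrightarrow> tr V s j v = g (ev s v)"
    then show ?thesis using V W eq zariski_open_subset by metis
  qed (use v in \<open>simp_all add: tr_add tr_smult tr_cut\<close>)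
qed

lemma tw_line_zero:
  assumes "g \<in> twist_sections 0 Y" "g x = 0" "v \<in> Y"
  shows "g v = 0"
proof (cases "independent_points x v")
  case True
  have L_closed: "s *s p + t *s q \<in> L" if "p \<in> L" "q \<in> L" for p q s t
  proof -
    obtain s1 t1 s2 t2 where "p = s1 *s x + t1 *s y" "q = s2 *s x + t2 *s y" using \<open>p \<in> L\<close> \<open>q \<in> L\<close> unfolding L by blast
    then have "s *s p + t *s q = (s * s1 + t * s2) *s x + (s * t1 + t * t2) *s y"
      by (simp add: Finite_Cartesian_Product.vec_eq_iff algebra_simps)
    then show ?thesis unfolding L by blast
  qed
  have "g x = g v"
    by (rule tw0_line[OF assms(1) _ True]) (use L_closed xL assms(3) in auto)
  then show ?thesis using assms(2) by simp
next
  case False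
  then obtain t where t: "v = t *s x" using dependent_points x_nz by blast
  then have "t \<noteq> 0" using assms(3) by auto
  then show ?thesis using tw_scale[of g 0 0 Y x t] assms t xL by simp
qed

text \<open>A vector \<open>w = am x u\<close> killed by \<open>bm\<close> along the line is a constant section of the kernel. Its image
  in the trivial bundle is constant and vanishes at \<open>x\<close>, so \<open>w = am v (\<sigma> v)\<close> along the line with \<open>\<sigma>\<close> a
  section of \<open>\<O>(-1)\<^sup>c\<close>, which is zero.\<close>

lemma line_nondegenerate:
  assumes u: "u \<in> Kn c" "bm y (am x u) = 0"
  shows "u = 0"
proof -
  define w where "w = am x u"
  have wN: "w \<in> Kn N" by (simp add: w_def am(4))
  have bw: "bm v w = 0" if "v \<in> Y" for v
    using that bm_am[OF u(1), of x] u(2) bm_combination unfolding L w_def by blast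
  \<comment> \<open>Any local section of the kernel with value \<open>w\<close> at \<open>v\<close>
    yields the same number, by \<open>tr_value\<close>. One choice per point therefore defines a
    function that agrees with every local description.\<close>
  define \<gamma> where "\<gamma> j v = (if v \<in> Y then
    tr (fst (nbhd v)) (const_sect (fst (nbhd v)) (snd (nbhd v)) w) j v else 0)" for j v
  have nb: "good (fst (nbhd v)) (snd (nbhd v)) \<and> v \<in> fst (nbhd v)" if v: "v \<in> Y" for v
  proof -
    have "v \<noteq> 0" using v by simp
    then obtain V \<kappa> where "good V \<kappa>" "v \<in> V" using good_exists by blast
    then show ?thesis
      unfolding nbhd_def by (intro someI[of "\<lambda>p. good (fst p) (snd p) \<and> v \<in> fst p" "(V, \<kappa>)"]) simp
  qed
  have \<gamma>: "\<gamma> j v = tr V s j v" if v: "v \<in> Y" and V: "zariski_open V" "v \<in> V" "s \<in> sect K V" "ev s v = w" for j v V s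
  proof -
    let ?V = "fst (nbhd v)" and ?s = "const_sect (fst (nbhd v)) (snd (nbhd v)) w"
    have n: "good ?V (snd (nbhd v))" "v \<in> ?V" using nb[OF v] by auto
    have "zariski_open ?V" using n(1) unfolding good_def by blast
    then have "tr ?V ?s j v = tr V s j v"
      using const_sect(1)[OF n(1)] const_sect(2)[OF n wN bw[OF v]] V n(2) by (intro tr_value[OF v]) auto
    then show ?thesis using v by (simp add: \<gamma>_def)
  qed
  have \<gamma>tw: "\<gamma> j \<in> twist_sections 0 Y" if j: "j < r" for j
  proof (rule tw_local)
    fix v assume v: "v \<in> Y"
    then have "v \<noteq> 0" by simp
    then obtain V \<kappa> where V: "good V \<kappa>" "v \<in> V" using good_exists by blast
    have Vo: "zariski_open V" using V(1) unfolding good_def by blast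
    let ?s = "const_sect V \<kappa> w"
    have "tr V ?s j \<in> twist_sections 0 (Y \<inter> V)"
      using tr_closed[OF Vo const_sect(1)[OF V(1)]] j by (simp add: sect_twist_power Int_commute)
    moreover have "\<gamma> j v' = tr V ?s j v'" if "v' \<in> Y \<inter> V" for v'
      using that const_sect[OF V(1)] wN bw by (intro \<gamma> Vo) auto
    ultimately show "\<exists>W t. zariski_open W \<and> v \<in> W \<and> t \<in> twist_sections 0 (Y \<inter> W) \<and> (\<forall>w\<in>Y \<inter> W. \<gamma> j w = t w)"
      using Vo V(2) by blast
  qed (auto simp: \<gamma>_def)
  have \<gamma>x: "\<gamma> j x = 0" for j
  proof -
    have xP: "x \<in> proj_space" using x_nz by (simp add: proj_space_def)
    obtain V \<sigma> where V: "zariski_open V" "x \<in> V" "\<sigma> \<in> sect (twist_power (- 1) c) V" "ev \<sigma> x = u"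
      by (rule sect_with_value[OF zariski_open_proj xP _ u(1), of "- 1"]) (simp, rule that)
    have "ev (a V \<sigma>) x = w" using am(5)[OF V(1,3,2)] V(4) by (simp add: w_def)
    then have "\<gamma> j x = tr V (a V \<sigma>) j x" using V a_closed by (intro \<gamma> xL) auto
    then show ?thesis using tr_a[OF V(1,3)] by simp
  qed
  have local: "\<exists>V \<sigma>. zariski_open V \<and> v \<in> V \<and> \<sigma> \<in> sect (twist_power (- 1) c) V \<and>
      (\<forall>v'\<in>V \<inter> Y. w = am v' (ev \<sigma> v'))" if v: "v \<in> Y" for v
  proof -
    have "v \<noteq> 0" using v by simp
    then obtain V \<kappa> where V: "good V \<kappa>" "v \<in> V" using good_exists by blast
    have Vo: "zariski_open V" using V(1) unfolding good_def by blast
    let ?s = "const_sect V \<kappa> w"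
    have s: "?s \<in> sect K V" by (rule const_sect(1)[OF V(1)])
    have evs: "ev ?s v' = w" if "v' \<in> V \<inter> Y" for v'
      using that const_sect(2)[OF V(1)] wN bw by auto
    have "tr V ?s = (\<lambda>i v. 0)"
    proof (rule twist_power_eqI[OF tr_closed[OF Vo s] twist_power_zero[OF YP]])
      fix v' assume v': "v' \<in> V \<inter> Y"
      have "tr V ?s j v' = 0" for j
      proof (cases "j < r")
        case True
        have "\<gamma> j v' = tr V ?s j v'" using v' s evs by (intro \<gamma> Vo) auto
        then show ?thesis using tw_line_zero[OF \<gamma>tw[OF True] \<gamma>x] v' by auto
      next
        case False
        then show ?thesis using tr_closed[OF Vo s] by (simp add: sect_twist_power)
      qed
      then show "ev (tr V ?s) v' = ev (\<lambda>i v. 0) v'" by (simp add: ev_def)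
    qed
    then obtain W \<sigma> where W: "zariski_open W" "v \<in> W" "W \<subseteq> V" "\<sigma> \<in> sect (twist_power (- 1) c) W"
      "\<And>w. w \<in> W \<inter> Y \<Longrightarrow> ev ?s w = am w (ev \<sigma> w)"
      using tr_zero_local[OF Vo V(2) s] by blast
    have "\<forall>v'\<in>W \<inter> Y. w = am v' (ev \<sigma> v')"
    proof
      fix v' assume v': "v' \<in> W \<inter> Y"
      then have "ev ?s v' = w" using W(3) by (intro evs) blast
      then show "w = am v' (ev \<sigma> v')" using W(5)[OF v'] by simp
    qed
    then show ?thesis using W(1,2,4) by (intro exI[of _ W] exI[of _ \<sigma>] conjI)
  qed
  \<comment> \<open>The local sections \<open>\<sigma>\<close> are glued through their values: as
    \<open>am v\<close> is injective, the solution of \<open>am v u = w\<close> is unique and the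
    choice made here agrees with every local one.\<close>
  define \<mu> where "\<mu> j v = (if v \<in> Y then (SOME u. u \<in> Kn c \<and> am v u = w) j else 0)" for j v
  have \<mu>: "\<mu> j v = z j" if "v \<in> Y" "z \<in> Kn c" "am v z = w" for j v z
  proof -
    have "(SOME u. u \<in> Kn c \<and> am v u = w) \<in> Kn c \<and> am v (SOME u. u \<in> Kn c \<and> am v u = w) = w"
      by (rule someI[of "\<lambda>u. u \<in> Kn c \<and> am v u = w" z]) (use that in simp)
    then have "am v ((SOME u. u \<in> Kn c \<and> am v u = w) - z) = 0" "(SOME u. u \<in> Kn c \<and> am v u = w) - z \<in> Kn c"
      using that by (auto simp: lin_diff[OF am(1)])
    then have "(SOME u. u \<in> Kn c \<and> am v u = w) - z = 0" using am_injective that(1) by blast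
    then show ?thesis using that(1) by (simp add: \<mu>_def)
  qed
  have \<mu>tw: "\<mu> j \<in> twist_sections (- 1) Y" if j: "j < c" for j
  proof (rule tw_local)
    fix v assume v: "v \<in> Y"
    obtain V \<sigma> where V: "zariski_open V" "v \<in> V" "\<sigma> \<in> sect (twist_power (- 1) c) V"
      "\<forall>v'\<in>V \<inter> Y. w = am v' (ev \<sigma> v')" using local[OF v] by blast
    have "\<sigma> j \<in> twist_sections (- 1) V" using V(3) j by (simp add: sect_twist_power)
    then have "cut (Y \<inter> V) (\<sigma> j) \<in> twist_sections (- 1) (Y \<inter> V)" by (rule tw_cut) simp
    moreover have "\<mu> j v' = cut (Y \<inter> V) (\<sigma> j) v'" if v': "v' \<in> Y \<inter> V" for v'
    proof -
      have "\<mu> j v' = ev \<sigma> v' j" using v' V(4) ev_Kn[OF V(3)] by (intro \<mu>) auto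
      then show ?thesis using v' by (simp add: ev_def)
    qed
    ultimately show "\<exists>W t. zariski_open W \<and> v \<in> W \<and> t \<in> twist_sections (- 1) (Y \<inter> W) \<and> (\<forall>w\<in>Y \<inter> W. \<mu> j w = t w)"
      using V(1,2) by blast
  qed (simp only: \<mu>_def if_False)
  have "u j = 0" for j
  proof (cases "j < c")
    case True
    have "\<mu> j x = 0"
      by (rule tw_neg_line[OF \<mu>tw[OF True] _ xy]) (auto simp: L)
    moreover have "\<mu> j x = u j" by (rule \<mu>[OF xL u(1)]) (simp add: w_def)
    ultimately show ?thesis by simp
  qed (use u(1) in \<open>simp add: Kn_def\<close>)
  then show ?thesis by (auto simp: fun_eq_iff zero_fun_apply)
qed

lemma orthogonal_monad: "orthogonal_monad c N am bm form_at"
proof (rule orthogonal_monad.intro)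
  fix v :: "'a ^ 'b" and u :: "nat \<Rightarrow> 'a" assume "v \<noteq> 0" "u \<in> Kn c" "am v u = 0"
  then show "u = 0" by (rule am_injective)
next
  fix v :: "'a ^ 'b" and w w' :: "nat \<Rightarrow> 'a" assume "v \<noteq> 0" "w \<in> Kn N" "w' \<in> Kn N" "bm v w = 0" "bm v w' = 0"
  then show "form_at v w w' = form_at v w' w" by (intro form_at_sym)
next
  fix v :: "'a ^ 'b" and u w :: "nat \<Rightarrow> 'a" assume "v \<noteq> 0" "u \<in> Kn c" "w \<in> Kn N" "bm v w = 0"
  then show "form_at v (am v u) w = 0" by (rule form_at_radical)
next
  fix v :: "'a ^ 'b" and w :: "nat \<Rightarrow> 'a" assume "v \<noteq> 0" "w \<in> Kn N" "bm v w = 0"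
    "\<And>w'. w' \<in> Kn N \<Longrightarrow> bm v w' = 0 \<Longrightarrow> form_at v w' w = 0"
  then show "\<exists>u\<in>Kn c. w = am v u" by (rule form_at_nondegenerate)
next
  fix v v' :: "'a ^ 'b" and w w' :: "nat \<Rightarrow> 'a" assume "independent_points v v'" "w \<in> Kn N" "w' \<in> Kn N" "bm v w = 0" "bm v' w = 0"
    "bm v w' = 0" "bm v' w' = 0"
  then show "form_at v w w' = form_at v' w w'" by (intro form_at_constant)
next
  fix v :: "'a ^ 'b" and p :: "nat \<Rightarrow> 'a" assume "v \<noteq> 0" "p \<in> Kn c"
  then show "\<exists>w\<in>Kn N. bm v w = p" by (rule bm_surj)
qed (simp_all add: am bm bm_am form_at_linear)

end

section \<open>The charge is even\<close>

lemma plane_basis: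
  fixes L :: "('k::field ^ 'n::finite) set"
  assumes "vec.subspace L" "vec.dim L = 2"
  obtains x y where "independent_points x y" "L = {s *s x + t *s y | s t. True}"
proof -
  obtain B where B: "B \<subseteq> L" "vec.independent B" "L \<subseteq> vec.span B" "card B = 2"
    using vec.basis_exists[of L] assms(2) by metis
  obtain x y where xy: "B = {x, y}" "x \<noteq> y" using B(4) by (auto simp: card_2_iff)
  have "vec.span B = L"
    using B(1,3) assms(1) vec.span_minimal by blast
  moreover have "vec.span B = {s *s x + t *s y | s t. True}"
  proof
    have "vec.subspace {s *s x + t *s y | s t. True}"
      unfolding vec.subspace_def
    proof (intro conjI ballI allI)
      have "0 = 0 *s x + 0 *s y" by simp
      then show "0 \<in> {s *s x + t *s y | s t. True}" by blast
    next
      fix p q assume "p \<in> {s *s x + t *s y | s t. True}" "q \<in> {s *s x + t *s y | s t. True}"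
      then obtain s t s' t' where "p = s *s x + t *s y" "q = s' *s x + t' *s y" by blast
      then have "p + q = (s + s') *s x + (t + t') *s y"
        by (simp add: Finite_Cartesian_Product.vec_eq_iff algebra_simps)
      then show "p + q \<in> {s *s x + t *s y | s t. True}" by blast
    next
      fix a p assume "p \<in> {s *s x + t *s y | s t. True}"
      then obtain s t where "p = s *s x + t *s y" by blast
      then have "a *s p = (a * s) *s x + (a * t) *s y"
        by (simp add: Finite_Cartesian_Product.vec_eq_iff algebra_simps)
      then show "a *s p \<in> {s *s x + t *s y | s t. True}" by blast
    qed
    moreover have "x = 1 *s x + 0 *s y" "y = 0 *s x + 1 *s y" by simp_all
    then have "B \<subseteq> {s *s x + t *s y | s t. True}" unfolding xy by blast
    ultimately show "vec.span B \<subseteq> {s *s x + t *s y | s t. True}" by (intro vec.span_minimal)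
    show "{s *s x + t *s y | s t. True} \<subseteq> vec.span B"
    proof safe
      fix s t show "s *s x + t *s y \<in> vec.span B"
        unfolding xy by (intro vec.span_add vec.span_scale vec.span_base) auto
    qed
  qed
  moreover have "independent_points x y"
    unfolding independent_points_def
  proof (intro allI impI)
    fix s t assume st: "s *s x + t *s y = 0"
    let ?u = "\<lambda>v. if v = x then s else t"
    have "(\<Sum>v\<in>B. ?u v *s v) = 0" unfolding xy(1) using xy(2) st by simp
    then have "?u v = 0" if "v \<in> B" for v
      using vec.independentD[OF B(2), of B ?u v] xy(1) that by simp
    from this[of x] this[of y] have "s = 0" "t = 0" using xy by simp_all
    then show "s = 0 \<and> t = 0" by simp
  qed
  ultimately show ?thesis using that by blast
qed

lemma independent_triple:
  fixes x y z :: "'k::field ^ 'n::finite"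
  assumes xy: "independent_points x y" and z: "z \<notin> {s *s x + t *s y | s t. True}"
    and eq: "p *s x + q *s y + t *s z = 0"
  shows "p = 0 \<and> q = 0 \<and> t = 0"
proof -
  have "t = 0"
  proof (rule ccontr)
    assume "t \<noteq> 0"
    then have "z = (- p / t) *s x + (- q / t) *s y"
      using eq by (simp add: Finite_Cartesian_Product.vec_eq_iff field_simps) (metis add.commute add_eq_0_iff minus_add_distrib)
    then show False using z by blast
  qed
  then have "p *s x + q *s y = 0" using eq by simp
  then show ?thesis using xy \<open>t = 0\<close> unfolding independent_points_def by blast
qed

lemma even_charge:
  fixes E :: "('k::{alg_closed_field, field_char_0} ^ 'n::finite, 'k, 'm) mod_sheaf"
  assumes card: "CARD('n) = n + 1" "n \<ge> 2"
    and E: "orthogonal_instanton_bundle r c E \<phi>" and triv: "trivial_splitting_type r E"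
  shows "even c"
proof -
  from E have ib: "instanton_sheaf r c E" "locally_free proj_space E" and \<phi>: "sheaf_iso proj_space E (dual E) \<phi>"
    and sym: "\<And>U s. U \<in> opens proj_space \<Longrightarrow> s \<in> sect E U \<Longrightarrow> dual_mor E \<phi> U (bidual E U s) = \<phi> U s"
    unfolding orthogonal_instanton_bundle_def instanton_bundle_def by blast+
  from ib(1) obtain a b where Es: "module_sheaf proj_space E" and ab: "instanton_monad r c a b" "monad_cohomology r c a b E"
    unfolding instanton_sheaf_def by blast
  from ab(1) have a: "sheaf_mor proj_space (twist_power (- 1) c) (twist_power 0 (r + 2 * c)) a"
    and b: "sheaf_surj proj_space (twist_power 0 (r + 2 * c)) (twist_power 1 c) b"
    and ba: "\<And>U s. U \<in> opens proj_space \<Longrightarrow> s \<in> sect (twist_power (- 1) c) U \<Longrightarrow> b U (a U s) = (\<lambda>i v. 0)"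
    unfolding instanton_monad_def sheaf_inj_def twist_power_simps by blast+
  let ?K = "kernel_sheaf (twist_power 0 (r + 2 * c)) (twist_power 1 c) b"
  from ab(2) obtain \<pi> where \<pi>: "sheaf_surj proj_space ?K E \<pi>"
    "\<And>U. U \<in> opens proj_space \<Longrightarrow> {s \<in> sect ?K U. \<pi> U s = \<zero>\<^bsub>sections E U\<^esub>} =
      image_sections proj_space (twist_power (- 1) c) ?K a U"
    unfolding monad_cohomology_def Let_def by blast
  have a': "sheaf_mor proj_space (twist_power (- 1) c) (twist_power (- 1 + 1) (r + 2 * c)) a" using a by simp
  obtain am where am: "\<And>v. lin (am v)" "\<And>v w u. am (v + w) u = am v u + am w u" "\<And>x v u. am (x *s v) u = x \<star> am v u"
    "\<And>v u. am v u \<in> Kn (r + 2 * c)"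
    "\<And>V s v. zariski_open V \<Longrightarrow> s \<in> sect (twist_power (- 1) c) V \<Longrightarrow> v \<in> V \<Longrightarrow> ev (a V s) v = am v (ev s v)"
    by (rule linear_matrix[OF a']) (simp, rule that)
  have b': "sheaf_mor proj_space (twist_power 0 (r + 2 * c)) (twist_power (0 + 1) c) b"
    using b unfolding sheaf_surj_def by simp
  obtain bm where bm: "\<And>v. lin (bm v)" "\<And>v w u. bm (v + w) u = bm v u + bm w u" "\<And>x v u. bm (x *s v) u = x \<star> bm v u"
    "\<And>v u. bm v u \<in> Kn c"
    "\<And>V s v. zariski_open V \<Longrightarrow> s \<in> sect (twist_power 0 (r + 2 * c)) V \<Longrightarrow> v \<in> V \<Longrightarrow> ev (b V s) v = bm v (ev s v)"
    by (rule linear_matrix[OF b']) (simp, rule that)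
  from triv obtain L \<rho> where L: "vec.subspace L" "vec.dim L = 2"
    and \<rho>: "sheaf_surj proj_space E (direct_image (L - {0}) (twist_power 0 r)) \<rho>"
    "\<And>U. U \<in> opens proj_space \<Longrightarrow>
      {s \<in> sect E U. \<rho> U s = \<zero>\<^bsub>sections (direct_image (L - {0}) (twist_power 0 r)) U\<^esub>} = ideal_times (L - {0}) E U"
    unfolding trivial_splitting_type_def is_restriction_def by blast
  obtain x y where plane: "independent_points x y" "L = {s *s x + t *s y | s t. True}"
    by (rule plane_basis[OF L]) (rule that)
  \<comment> \<open>Here \<open>n \<ge> 2\<close> enters: the ambient dimension \<open>n + 1\<close>
    exceeds the dimension two of \<open>L\<close>, so a third point \<open>z\<close> exists off the
    line.\<close>
  have "L \<noteq> UNIV"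
  proof (rule notI)
    assume "L = UNIV"
    have "vec.dim L = CARD('n)" unfolding \<open>L = UNIV\<close> by (rule vec_dim_card)
    then show False using L(2) card by simp
  qed
  then obtain z where z: "z \<notin> L" by blast
  have "instanton E \<phi> r c (r + 2 * c) a b \<pi> am bm"
    by (rule instanton.intro) (simp_all add: Es a b ba \<pi> ib(2) \<phi> sym am bm opens_proj)
  then interpret instanton_line E \<phi> r c "r + 2 * c" a b \<pi> am bm x y L \<rho>
    by (rule instanton_line.intro) (rule instanton_line_axioms.intro, rule plane(2), rule plane(1), rule \<rho>(1), rule \<rho>(2), simp add: opens_proj)
  show ?thesis
  proof (rule orthogonal_monad.even_charge[OF orthogonal_monad])
    show "p = 0 \<and> q = 0 \<and> t = 0" if "p *s x + q *s y + t *s z = 0" for p q t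
      using independent_triple[OF plane(1) _ that] z plane(2) by blast
    show "u = 0" if "u \<in> Kn c" "bm y (am x u) = 0" for u
      by (rule line_nondegenerate[OF that])
  qed
qed

theorem lemma4p3:
  fixes n :: nat
  assumes "CARD('n::finite) = n + 1" and "n \<ge> 2"
  shows "(\<forall>(E :: ('k::{alg_closed_field, field_char_0} ^ 'n, 'k, 'm) mod_sheaf) \<phi> r c.
            orthogonal_instanton_bundle r c E \<phi> \<and> trivial_splitting_type r E \<longrightarrow> even c)
       \<and> (\<forall>r c. odd c \<and> r > 0 \<longrightarrow>
            (orthogonal_moduli r c ::
               (('k ^ 'n, 'k, 'm) mod_sheaf \<times>
                ('k ^ 'n, 'm, ('k ^ 'n, 'm, 'k ^ 'n \<Rightarrow> 'k) sheaf_map) sheaf_map) set set) = {})"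
proof (intro conjI allI impI)
  fix E :: "('k ^ 'n, 'k, 'm) mod_sheaf" and \<phi> r c
  assume "orthogonal_instanton_bundle r c E \<phi> \<and> trivial_splitting_type r E"
  then show "even c" by (elim conjE) (rule even_charge[OF assms])
next
  fix r c :: nat assume c: "odd c \<and> r > 0"
  let ?A = "{(E :: ('k ^ 'n, 'k, 'm) mod_sheaf, \<phi>). orthogonal_instanton_bundle r c E \<phi> \<and> trivial_splitting_type r E}"
  have "?A = {}"
  proof (rule equals0I)
    fix p assume "p \<in> ?A"
    then obtain E \<phi> where "orthogonal_instanton_bundle r c (E :: ('k ^ 'n, 'k, 'm) mod_sheaf) \<phi>"
      "trivial_splitting_type r E" by blast
    then have "even c" by (rule even_charge[OF assms])
    then show False using c by blast
  qed
  then show "(orthogonal_moduli r c ::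
      (('k ^ 'n, 'k, 'm) mod_sheaf \<times>
       ('k ^ 'n, 'm, ('k ^ 'n, 'm, 'k ^ 'n \<Rightarrow> 'k) sheaf_map) sheaf_map) set set) = {}"
    unfolding orthogonal_moduli_def Let_def by (simp only: quotient_empty)
qed

end
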